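(* Let $G$ be a commutative multiplicative group, let $L$ be a $G$-graded field with graded subfields $l$, $K$ and $k\subseteq l\cap K$, and let $\psi_{L/l,K/k}\colon\mathbf P_{L/l}\to\mathbf P_{K/k}$, $\mathcal O\mapsto\mathcal O\cap K$. Then: (1) $\psi_{L/l,K/k}$ is surjective if and only if $l$ and $K$ are in general position with respect to $k$; (2) $\psi_{L/l,K/k}$ has finite fibers (resp. is injective) if $L/K$ is finite (resp. $L=K$); (3) $\psi_{L/l,K/k}$ is bijective if $l/k$ is algebraic, $L_1=K_1$, and $\rho(L^\times)/\rho(K^\times)$ is a torsion group.
   Context: A graded field is a nonzero $G$-graded ring whose nonzero homogeneous elements are invertible; $F_1$ is its degree-$1$ part, $F^\times$ its group of nonzero homogeneous elements and $\rho\colon F^\times\to G$ the grading. For graded fields $k\subseteq F$, $\mathbf P_{F/k}$ is the set of graded valuation rings of $F$ containing $k$ (graded subrings $\mathcal O$ with $f\in\mathcal O$ or $f^{-1}\in\mathcal O$ for every nonzero homogeneous $f$), topologized by sets $\{\mathcal O:f_1,\dots,f_n\in\mathcal O\}$. A finite set $S\subseteq F^\times$ is algebraically independent over $k$ if the graded $k$-algebra map $k[\rho(s)^{-1}T_s]_{s\in S}\to F$, $T_s\mapsto s$, is injective; $F/k$ is finite if $F$ has finite rank as a graded $k$-module, algebraic if every element is integral over $k$; transcendence degree is the cardinality of a maximal algebraically independent set. Graded subfields $l,K$ of $L$ containing $k$ are in general position with respect to $k$ if every subset of $l^\times$ algebraically independent over $k$ is algebraically independent over $K$ (equivalently $\mathrm{trdeg}_k(l'K')=\mathrm{trdeg}_k(l')+\mathrm{trdeg}_k(K')$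 for all finitely generated graded subfields $k\subseteq l'\subseteq l$, $k\subseteq K'\subseteq K$). *)

theory Defs
  imports "HOL-Algebra.Group"
begin

text \<open>The ambient graded field L is the whole type 'a (a commutative ring with 1).
  The grading group G is an HOL-Algebra (multiplicative) commutative group; the grading is
  given by the family of homogeneous components D g (g in carrier G).\<close>

definition graded_ring :: "('g, 'b) monoid_scheme \<Rightarrow> ('g \<Rightarrow> 'a::comm_ring_1 set) \<Rightarrow> bool" where
  "graded_ring G D \<longleftrightarrow>
     (\<forall>g\<in>carrier G. 0 \<in> D g \<and> (\<forall>x\<in>D g. \<forall>y\<in>D g. x + y \<in> D g \<and> - x \<in> D g)) \<and>
     (\<forall>g\<in>carrier G. \<forall>h\<in>carrier G. \<forall>x\<in>D g. \<forall>y\<in>D h. x * y \<in> D (g \<otimes>\<^bsub>G\<^esub> h)) \<and>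
     (\<forall>x. \<exists>S f. finite S \<and> S \<subseteq> carrier G \<and> (\<forall>g\<in>S. f g \<in> D g) \<and> x = (\<Sum>g\<in>S. f g)) \<and>
     (\<forall>S f. finite S \<and> S \<subseteq> carrier G \<and> (\<forall>g\<in>S. f g \<in> D g) \<and> (\<Sum>g\<in>S. f g) = 0
            \<longrightarrow> (\<forall>g\<in>S. f g = 0))"

definition homog :: "('g, 'b) monoid_scheme \<Rightarrow> ('g \<Rightarrow> 'a set) \<Rightarrow> 'a set" where
  "homog G D = (\<Union>g\<in>carrier G. D g)"

definition units_h :: "('g, 'b) monoid_scheme \<Rightarrow> ('g \<Rightarrow> 'a::zero set) \<Rightarrow> 'a set \<Rightarrow> 'a set" where
  "units_h G D F = {x \<in> F \<inter> homog G D. x \<noteq> 0}"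

definition deg :: "('g, 'b) monoid_scheme \<Rightarrow> ('g \<Rightarrow> 'a set) \<Rightarrow> 'a \<Rightarrow> 'g" where
  "deg G D x = (THE g. g \<in> carrier G \<and> x \<in> D g)"

definition graded_field :: "('g, 'b) monoid_scheme \<Rightarrow> ('g \<Rightarrow> 'a::comm_ring_1 set) \<Rightarrow> bool" where
  "graded_field G D \<longleftrightarrow> graded_ring G D \<and> (0::'a) \<noteq> 1 \<and>
     (\<forall>x\<in>units_h G D UNIV. \<exists>y. x * y = 1)"

definition graded_subring :: "('g, 'b) monoid_scheme \<Rightarrow> ('g \<Rightarrow> 'a::comm_ring_1 set) \<Rightarrow> 'a set \<Rightarrow> bool" where
  "graded_subring G D S \<longleftrightarrow> 0 \<in> S \<and> 1 \<in> S \<and>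
     (\<forall>x\<in>S. \<forall>y\<in>S. x + y \<in> S \<and> x * y \<in> S \<and> - x \<in> S) \<and>
     (\<forall>x\<in>S. \<forall>T f. finite T \<and> T \<subseteq> carrier G \<and> (\<forall>g\<in>T. f g \<in> D g) \<and> x = (\<Sum>g\<in>T. f g)
            \<longrightarrow> (\<forall>g\<in>T. f g \<in> S))"

definition graded_subfield :: "('g, 'b) monoid_scheme \<Rightarrow> ('g \<Rightarrow> 'a::comm_ring_1 set) \<Rightarrow> 'a set \<Rightarrow> bool" where
  "graded_subfield G D F \<longleftrightarrow> graded_subring G D F \<and>
     (\<forall>x\<in>units_h G D F. \<exists>y\<in>F. x * y = 1)"

definition gval_rings :: "('g, 'b) monoid_scheme \<Rightarrow> ('g \<Rightarrow> 'a::comm_ring_1 set) \<Rightarrow> 'a set \<Rightarrow> 'a set \<Rightarrow> 'a set set" where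
  "gval_rings G D F k = {R. graded_subring G D R \<and> R \<subseteq> F \<and> k \<subseteq> R \<and>
     (\<forall>f\<in>units_h G D F. f \<in> R \<or> (\<exists>y\<in>R. f * y = 1))}"

text \<open>A finite set S is algebraically independent over k: the evaluation map
  k[T_s]_{s in S} -> L, T_s |-> s, is injective, i.e. no nonzero polynomial
  (finitely many monomials alpha, supported on S, with coefficients in k) vanishes at S.\<close>
definition alg_indep :: "'a::comm_ring_1 set \<Rightarrow> 'a set \<Rightarrow> bool" where
  "alg_indep k S \<longleftrightarrow> finite S \<and>
     (\<forall>M c. finite M \<and> (\<forall>\<alpha>\<in>M. \<forall>s. s \<notin> S \<longrightarrow> \<alpha> s = 0) \<and> (\<forall>\<alpha>\<in>M. c \<alpha> \<in> k) \<and>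
        (\<Sum>\<alpha>\<in>M. c \<alpha> * (\<Prod>s\<in>S. s ^ \<alpha> s)) = 0 \<longrightarrow> (\<forall>\<alpha>\<in>M. c \<alpha> = 0))"

definition general_position ::
  "('g, 'b) monoid_scheme \<Rightarrow> ('g \<Rightarrow> 'a::comm_ring_1 set) \<Rightarrow> 'a set \<Rightarrow> 'a set \<Rightarrow> 'a set \<Rightarrow> bool" where
  "general_position G D k l K \<longleftrightarrow>
     (\<forall>S. finite S \<and> S \<subseteq> units_h G D l \<and> alg_indep k S \<longrightarrow> alg_indep K S)"

definition graded_algebraic :: "'a::comm_ring_1 set \<Rightarrow> 'a set \<Rightarrow> bool" where
  "graded_algebraic k F \<longleftrightarrow>
     (\<forall>x\<in>F. \<exists>n c. (\<forall>i<n. c i \<in> k) \<and> x ^ n + (\<Sum>i<n. c i * x ^ i) = 0)"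

definition graded_finite :: "('g, 'b) monoid_scheme \<Rightarrow> ('g \<Rightarrow> 'a::comm_ring_1 set) \<Rightarrow> 'a set \<Rightarrow> 'a set \<Rightarrow> bool" where
  "graded_finite G D K F \<longleftrightarrow> (\<exists>B. finite B \<and> B \<subseteq> F \<inter> homog G D \<and>
     (\<forall>x\<in>F. \<exists>c. (\<forall>b\<in>B. c b \<in> K) \<and> x = (\<Sum>b\<in>B. c b * b)) \<and>
     (\<forall>c. (\<forall>b\<in>B. c b \<in> K) \<and> (\<Sum>b\<in>B. c b * b) = 0 \<longrightarrow> (\<forall>b\<in>B. c b = 0)))"

end

theory Submission
  imports Defs
begin

text \<open>
  All existence statements come from Chevalley's theorem: if a multiplicative set P of homogeneous
  elements and a subset J of P satisfy 1 \<notin> \<open>additive_span (products P J)\<close>, then some graded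
  valuation ring of L contains P and has J in its maximal ideal.

  General position implies surjectivity. Let R be a valuation ring of K over k with maximal ideal m.
  By Chevalley it suffices that 1 does not lie in m l. Such a relation involves finitely many elements
  of l; let S be a maximal algebraically independent subset of them. As S stays independent over K,
  comparing coefficients shows that no nonzero element of k[S] lies in m[S], so by Chevalley there is a
  valuation ring of L containing k(S) whose maximal ideal contains m. It contains everything algebraic
  over k(S), which contradicts the relation.

  Surjectivity implies general position. Take R minimal among the valuation rings of K over k and lift
  it to V containing l. For S in l independent over k and a weight that separates the exponents of a
  relation over K, V can be refined to a valuation ring W over k in which monomials of larger weight are
  infinitely smaller. By minimality W still meets K in R, so after scaling, the term of lowest weight
  among those with unit coefficient dominates the relation.

  Finite fibres. A relation between the powers of a homogeneous f has two terms of equal value, whence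
  a power of f is an element of K times a unit of degree one. So the rings of a fibre are pairwise
  incomparable on the field \<open>D \<one>\<close>. Weak approximation in this field gives, for each ring of the
  fibre, an element that is a unit there and a nonunit in the others, and these elements are linearly
  independent over K.
\<close>

section \<open>Graded fields\<close>

text \<open>No polynomial ring, residue field or value group is built. A polynomial is a finite sum
  over exponent functions, a subring or ideal is an additive span of homogeneous products, and
  values are compared by asking whether a quotient lies in the ring. The price is that a maximal
  ideal is represented only by its homogeneous elements (\<open>nonunits\<close>), which may be
  added only within one degree. Hence the recurring contradiction takes place in degree one: a
  relation is cut down to a single degree (\<open>homogenize_relation\<close>), and then no term can
  strictly dominate all others (\<open>no_dominant_term\<close>). Minimality of R answers an
  obstacle: refining V in general shrinks its trace on K, and quotients of coefficients lying in R
  could leave W; a minimal R leaves no room for this. In the fibre argument, weak approximation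
  forms sums such as 1 + x and y + z^r, which are homogeneous only in a common degree; this is why
  everything is first moved to \<open>D \<one>\<close>.\<close>

inductive_set additive_span :: "'a::comm_monoid_add set \<Rightarrow> 'a set" for H where
  zero: "0 \<in> additive_span H"
| step: "h \<in> H \<Longrightarrow> x \<in> additive_span H \<Longrightarrow> h + x \<in> additive_span H"

lemma additive_span_base: "h \<in> H \<Longrightarrow> h \<in> additive_span H"
  using additive_span.step[OF _ additive_span.zero, of h H] by simp

lemma additive_span_add:
  "x \<in> additive_span H \<Longrightarrow> y \<in> additive_span H \<Longrightarrow> x + y \<in> additive_span H"
  by (induction rule: additive_span.induct) (auto simp: add.assoc intro: additive_span.intros)

lemma additive_span_least:
  assumes "x \<in> additive_span H" "\<And>h. h \<in> H \<Longrightarrow> h \<in> X" "0 \<in> X"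
    "\<And>x y. x \<in> X \<Longrightarrow> y \<in> X \<Longrightarrow> x + y \<in> X"
  shows "x \<in> X"
  using assms(1) by induction (use assms(2-) in auto)

lemma additive_span_subset:
  assumes "x \<in> additive_span H" "\<And>h. h \<in> H \<Longrightarrow> h \<in> additive_span H'"
  shows "x \<in> additive_span H'"
  using additive_span_least[OF assms] additive_span.zero additive_span_add by blast

lemma additive_span_mono: "x \<in> additive_span H \<Longrightarrow> H \<subseteq> H' \<Longrightarrow> x \<in> additive_span H'"
  by (erule additive_span_subset) (auto intro: additive_span_base)

lemma additive_span_sum:
  "finite T \<Longrightarrow> (\<And>t. t \<in> T \<Longrightarrow> f t \<in> additive_span H) \<Longrightarrow> sum f T \<in> additive_span H"
  by (induction T rule: finite_induct) (auto intro: additive_span.zero additive_span_add)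

lemma additive_span_times:
  fixes c :: "'a::comm_ring_1"
  assumes "x \<in> additive_span H" "\<And>h. h \<in> H \<Longrightarrow> h * c \<in> additive_span H'"
  shows "x * c \<in> additive_span H'"
  using assms(1)
  by induction (auto simp: distrib_right intro: additive_span.zero additive_span_add assms(2))

lemma additive_span_mult:
  fixes x y :: "'a::comm_ring_1"
  assumes "x \<in> additive_span H" "y \<in> additive_span H'"
    "\<And>h h'. h \<in> H \<Longrightarrow> h' \<in> H' \<Longrightarrow> h * h' \<in> additive_span H''"
  shows "x * y \<in> additive_span H''"
proof (rule additive_span_times[OF assms(1)])
  fix h assume "h \<in> H"
  then have "y * h \<in> additive_span H''"
    by (intro additive_span_times[OF assms(2)]) (metis assms(3) mult.commute)
  then show "h * y \<in> additive_span H''" by (simp add: mult.commute)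
qed

lemma additive_span_uminus:
  fixes x :: "'a::comm_ring_1"
  assumes "x \<in> additive_span H" "\<And>h. h \<in> H \<Longrightarrow> - h \<in> additive_span H'"
  shows "- x \<in> additive_span H'"
  using additive_span_times[OF assms(1), of "-1" H'] assms(2) by simp

lemma inverse_unique_comm: "x * y = 1 \<Longrightarrow> x * z = 1 \<Longrightarrow> y = (z::'a::comm_ring_1)"
  by (metis mult.commute mult.left_commute mult.right_neutral)

text \<open>Unspecified at elements without an inverse; in particular 0 has to be treated
  separately, as \<open>nonunits\<close> does.\<close>

definition hinv :: "'a::comm_ring_1 \<Rightarrow> 'a" where
  "hinv x = (THE y. x * y = 1)"

lemma hinv_eqI: "x * y = 1 \<Longrightarrow> hinv x = y"
  unfolding hinv_def by (rule the_equality) (auto dest: inverse_unique_comm)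

lemma hinv_1 [simp]: "hinv 1 = 1"
  by (rule hinv_eqI) simp

section \<open>Homogeneous components\<close>

locale gr_field = comm_group G for G (structure) +
  fixes D :: "'g \<Rightarrow> 'a::comm_ring_1 set"
  assumes graded_field: "graded_field G D"
begin

abbreviation "H \<equiv> homog G D"
abbreviation "U \<equiv> units_h G D UNIV"

lemma graded_ring: "graded_ring G D"
  and zero_neq_one: "(0::'a) \<noteq> 1"
  using graded_field by (auto simp: graded_field_def)

lemma D_zero: "g \<in> carrier G \<Longrightarrow> 0 \<in> D g"
  and D_add: "g \<in> carrier G \<Longrightarrow> x \<in> D g \<Longrightarrow> y \<in> D g \<Longrightarrow> x + y \<in> D g"
  and D_uminus: "g \<in> carrier G \<Longrightarrow> x \<in> D g \<Longrightarrow> - x \<in> D g"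
  using conjunct1[OF graded_ring[unfolded graded_ring_def]] by auto

lemma D_mult: "g \<in> carrier G \<Longrightarrow> h \<in> carrier G \<Longrightarrow> x \<in> D g \<Longrightarrow> y \<in> D h \<Longrightarrow> x * y \<in> D (g \<otimes> h)"
  using conjunct1[OF conjunct2[OF graded_ring[unfolded graded_ring_def]]] by auto

lemma D_diff: "g \<in> carrier G \<Longrightarrow> x \<in> D g \<Longrightarrow> y \<in> D g \<Longrightarrow> x - y \<in> D g"
  using D_add[of g x "-y"] D_uminus[of g y] by simp

lemma D_sum: "g \<in> carrier G \<Longrightarrow> (\<And>i. i \<in> I \<Longrightarrow> f i \<in> D g) \<Longrightarrow> sum f I \<in> D g"
  by (induction I rule: infinite_finite_induct) (auto simp: D_zero D_add)

definition decomposes :: "'a \<Rightarrow> 'g set \<Rightarrow> ('g \<Rightarrow> 'a) \<Rightarrow> bool" where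
  "decomposes x T f \<longleftrightarrow> finite T \<and> T \<subseteq> carrier G \<and> (\<forall>g\<in>T. f g \<in> D g) \<and> x = (\<Sum>g\<in>T. f g)"

lemma decomposes_exists: "\<exists>T f. decomposes x T f"
  using graded_ring unfolding graded_ring_def decomposes_def by blast

text \<open>Index sets can be padded with zero terms, so both families are extended by zero to
  \<open>T \<union> T'\<close>. Their difference decomposes 0, and the grading makes all its terms
  vanish.\<close>

lemma decomposes_unique:
  assumes "decomposes x T f" "decomposes x T' f'"
  shows "(if g \<in> T then f g else 0) = (if g \<in> T' then f' g else 0)"
proof -
  define e where "e = (\<lambda>g. (if g \<in> T then f g else 0) - (if g \<in> T' then f' g else 0))"
  have fin: "finite (T \<union> T')" and car: "T \<union> T' \<subseteq> carrier G"
    using assms by (auto simp: decomposes_def)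
  have "(\<Sum>g\<in>T \<union> T'. e g) = (\<Sum>g\<in>T. f g) - (\<Sum>g\<in>T'. f' g)"
    unfolding e_def sum_subtractf using fin
    by (simp add: sum.inter_restrict[symmetric] Int_absorb1 Int_absorb2)
  also have "\<dots> = 0" using assms by (simp add: decomposes_def)
  finally have "(\<Sum>g\<in>T \<union> T'. e g) = 0" .
  moreover have "\<forall>g\<in>T \<union> T'. e g \<in> D g"
    using assms by (auto simp: e_def decomposes_def D_zero D_uminus subset_eq intro!: D_diff)
  ultimately have "\<forall>g\<in>T \<union> T'. e g = 0"
    using graded_ring fin car unfolding graded_ring_def by blast
  then show ?thesis by (auto simp: e_def split: if_splits)
qed

definition component :: "'a \<Rightarrow> 'g \<Rightarrow> 'a" where
  "component x g = (THE y. \<exists>T f. decomposes x T f \<and> y = (if g \<in> T then f g else 0))"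

lemma component_eq:
  assumes "decomposes x T f"
  shows "component x g = (if g \<in> T then f g else 0)"
  unfolding component_def
proof (rule the_equality)
  show "\<exists>T' f'. decomposes x T' f' \<and> (if g \<in> T then f g else 0) = (if g \<in> T' then f' g else 0)"
    using assms by blast
next
  fix y assume "\<exists>T' f'. decomposes x T' f' \<and> y = (if g \<in> T' then f' g else 0)"
  then obtain T' f' where T': "decomposes x T' f'" "y = (if g \<in> T' then f' g else 0)" by blast
  show "y = (if g \<in> T then f g else 0)"
    unfolding T'(2) by (rule decomposes_unique[OF T'(1) assms])
qed

lemma component_in: "g \<in> carrier G \<Longrightarrow> component x g \<in> D g"
proof -
  assume g: "g \<in> carrier G"
  obtain T f where T: "decomposes x T f" using decomposes_exists by blast
  show ?thesis unfolding component_eq[OF T] using T D_zero[OF g] by (simp add: decomposes_def)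
qed

lemma component_outside: "g \<notin> carrier G \<Longrightarrow> component x g = 0"
proof -
  assume g: "g \<notin> carrier G"
  obtain T f where T: "decomposes x T f" using decomposes_exists by blast
  then have "g \<notin> T" using g by (auto simp: decomposes_def)
  then show ?thesis unfolding component_eq[OF T] by simp
qed

lemma decomposes_component: "\<exists>T. decomposes x T (component x)"
proof -
  obtain T f where T: "decomposes x T f" using decomposes_exists by blast
  have "sum (component x) T = sum f T" by (rule sum.cong) (simp_all add: component_eq[OF T])
  then have "decomposes x T (component x)"
    using T component_in by (auto simp: decomposes_def)
  then show ?thesis by blast
qed

lemma decomposes_superset:
  assumes "decomposes x T f" "T \<subseteq> T'" "finite T'" "T' \<subseteq> carrier G"
  shows "decomposes x T' (component x)"
proof -
  have "sum (component x) T' = sum f T"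
    using assms by (simp add: component_eq[OF assms(1)] sum.inter_restrict[symmetric] Int_absorb1)
  then show ?thesis using assms component_in by (auto simp: decomposes_def)
qed

lemma component_add: "component (x + y) g = component x g + component y g"
proof -
  obtain T T' where T: "decomposes x T (component x)" "decomposes y T' (component y)"
    using decomposes_component by blast
  have fin: "finite (T \<union> T')" "T \<union> T' \<subseteq> carrier G" using T by (auto simp: decomposes_def)
  have 1: "decomposes x (T \<union> T') (component x)" by (rule decomposes_superset[OF T(1)]) (use fin in auto)
  have 2: "decomposes y (T \<union> T') (component y)" by (rule decomposes_superset[OF T(2)]) (use fin in auto)
  have "decomposes (x + y) (T \<union> T') (\<lambda>g. component x g + component y g)"
    using 1 2 by (auto simp: decomposes_def sum.distrib D_add)
  from component_eq[OF this, of g] component_eq[OF 1, of g] component_eq[OF 2, of g]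
  show ?thesis by (cases "g \<in> T \<union> T'") simp_all
qed

lemma component_homog:
  assumes "h \<in> carrier G" "x \<in> D h"
  shows "component x g = (if g = h then x else 0)"
proof -
  have "decomposes x {h} (\<lambda>_. x)" using assms by (simp add: decomposes_def)
  from component_eq[OF this] show ?thesis by auto
qed

lemma component_0 [simp]: "component 0 g = 0"
  using component_homog[OF one_closed D_zero[OF one_closed]] by simp

lemma component_sum: "component (sum f I) g = (\<Sum>i\<in>I. component (f i) g)"
  by (induction I rule: infinite_finite_induct) (auto simp: component_add)

lemma component_all_0:
  assumes "\<And>g. g \<in> carrier G \<Longrightarrow> component x g = 0"
  shows "x = 0"
proof -
  obtain T where "decomposes x T (component x)" using decomposes_component by blast
  then show ?thesis using assms unfolding decomposes_def by (metis (no_types, lifting) subsetD sum.neutral)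
qed

lemma component_nonzero:
  assumes "x \<noteq> 0"
  obtains g where "g \<in> carrier G" "component x g \<noteq> 0"
  using assms component_all_0 by blast

text \<open>Multiplication by an element of degree h merely shifts the grading. This turns
  components of a relation into components of its coefficients.\<close>

lemma component_mult:
  assumes h: "h \<in> carrier G" "y \<in> D h" and g: "g \<in> carrier G"
  shows "component (x * y) g = component x (g \<otimes> inv h) * y"
proof -
  obtain T where T: "decomposes x T (component x)" using decomposes_component by blast
  then have fin: "finite T" "T \<subseteq> carrier G" "x = (\<Sum>g\<in>T. component x g)"
    by (auto simp: decomposes_def)
  have "component (x * y) g = (\<Sum>i\<in>T. component (component x i * y) g)"
    by (subst fin(3)) (simp add: sum_distrib_right component_sum)
  also have "\<dots> = (\<Sum>i\<in>T. if i = g \<otimes> inv h then component x i * y else 0)"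
  proof (rule sum.cong)
    fix i assume "i \<in> T"
    then have i: "i \<in> carrier G" using fin by auto
    have "component x i * y \<in> D (i \<otimes> h)" by (rule D_mult[OF i h(1) component_in[OF i] h(2)])
    from component_homog[OF m_closed[OF i h(1)] this, of g]
    show "component (component x i * y) g = (if i = g \<otimes> inv h then component x i * y else 0)"
      using i h(1) g inv_solve_right[of i g h] by (auto simp: eq_commute)
  qed simp
  also have "\<dots> = (if g \<otimes> inv h \<in> T then component x (g \<otimes> inv h) * y else 0)"
    using fin by simp
  also have "\<dots> = component x (g \<otimes> inv h) * y"
    using component_eq[OF T, of "g \<otimes> inv h"] by auto
  finally show ?thesis .
qed

lemma D_disjoint: "g \<in> carrier G \<Longrightarrow> h \<in> carrier G \<Longrightarrow> x \<in> D g \<Longrightarrow> x \<in> D h \<Longrightarrow> x \<noteq> 0 \<Longrightarrow> g = h"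
  using component_homog by metis

text \<open>That 1 has degree one is not part of \<open>graded_ring\<close>. Comparing degrees in
  \<open>1 * component x g\<close> shows that the degree-one component of 1 fixes every component of
  every x; summing this over the components of 1 identifies it with 1.\<close>

lemma one_D: "1 \<in> D \<one>"
proof -
  have *: "component x g = component x g * component 1 \<one>" if g: "g \<in> carrier G" for x g
  proof -
    have "component x g = component (1 * component x g) g"
      using component_homog[OF g component_in[OF g], of x g] by simp
    also have "\<dots> = component 1 \<one> * component x g"
      using component_mult[OF g component_in[OF g] g, of 1 x] g by simp
    finally show ?thesis by (simp add: mult.commute)
  qed
  obtain T where T: "decomposes 1 T (component 1)" using decomposes_component by blast
  have "1 = (\<Sum>g\<in>T. component 1 g * component 1 \<one>)"
    using T unfolding decomposes_def using * by (metis (no_types, lifting) subsetD sum.cong)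
  also have "\<dots> = component 1 \<one>"
    using T by (simp add: sum_distrib_right[symmetric] decomposes_def)
  finally show ?thesis using component_in[of \<one> 1] by simp
qed

section \<open>Homogeneous elements and their inverses\<close>

lemma homogI: "g \<in> carrier G \<Longrightarrow> x \<in> D g \<Longrightarrow> x \<in> H"
  by (auto simp: homog_def)

lemma homogE: assumes "x \<in> H" obtains g where "g \<in> carrier G" "x \<in> D g"
  using assms by (auto simp: homog_def)

lemma homog_0 [simp]: "0 \<in> H" and homog_1 [simp]: "1 \<in> H"
  using D_zero one_D homogI one_closed by blast+

lemma homog_mult: "x \<in> H \<Longrightarrow> y \<in> H \<Longrightarrow> x * y \<in> H"
  by (metis D_mult homogE homogI m_closed)

lemma homog_uminus: "x \<in> H \<Longrightarrow> - x \<in> H"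
  by (metis D_uminus homogE homogI)

lemma component_in_homog: "component x g \<in> H"
  by (cases "g \<in> carrier G") (auto simp: component_outside intro: homogI component_in)

lemma in_span_components: "x \<in> additive_span (range (component x))"
proof -
  obtain T where T: "decomposes x T (component x)" using decomposes_component by blast
  then have "sum (component x) T \<in> additive_span (range (component x))"
    by (intro additive_span_sum) (auto simp: decomposes_def intro: additive_span_base)
  then show ?thesis using T by (simp add: decomposes_def)
qed

lemma units_iff: "x \<in> U \<longleftrightarrow> x \<in> H \<and> x \<noteq> 0"
  by (auto simp: units_h_def)

lemma U_homog: "x \<in> U \<Longrightarrow> x \<in> H"
  by (simp add: units_iff)

lemma units_h_eq: "units_h G D F = F \<inter> U"
  by (auto simp: units_h_def)

lemma hinv: assumes "x \<in> U" shows "x * hinv x = 1"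
proof -
  obtain y where "x * y = 1" using assms graded_field by (auto simp: graded_field_def)
  then show ?thesis using hinv_eqI by metis
qed

lemma hinv_left: "x \<in> U \<Longrightarrow> hinv x * x = 1"
  using hinv by (simp add: mult.commute)

lemma hinv_cancel: "x \<in> U \<Longrightarrow> x * (hinv x * y) = y" "x \<in> U \<Longrightarrow> hinv x * (x * y) = y"
  by (simp_all add: hinv hinv_left mult.assoc[symmetric])

text \<open>The inverse supplied by \<open>graded_field\<close> is an arbitrary ring element. Its
  component in degree \<open>inv g\<close> already inverts x, and uniqueness of inverses identifies
  the two.\<close>

lemma hinv_D:
  assumes "x \<in> U" "g \<in> carrier G" "x \<in> D g"
  shows "hinv x \<in> D (inv g)"
proof -
  have "component (hinv x * x) \<one> = component (hinv x) (inv g) * x"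
    using component_mult[OF assms(2,3) one_closed, of "hinv x"] assms(2) by simp
  then have "x * component (hinv x) (inv g) = 1"
    using component_homog[OF one_closed one_D, of \<one>] hinv_left[OF assms(1)] by (simp add: mult.commute)
  then have "hinv x = component (hinv x) (inv g)" by (rule hinv_eqI)
  then show ?thesis using component_in[of "inv g" "hinv x"] assms(2) by simp
qed

lemma hinv_U [simp]: assumes "x \<in> U" shows "hinv x \<in> U"
proof -
  obtain g where g: "g \<in> carrier G" "x \<in> D g" using assms by (auto simp: units_iff elim: homogE)
  have "hinv x \<noteq> 0" using hinv[OF assms] zero_neq_one by auto
  then show ?thesis using hinv_D[OF assms g] g by (auto simp: units_iff intro: homogI[of "inv g"])
qed

lemma hinv_hinv [simp]: "x \<in> U \<Longrightarrow> hinv (hinv x) = x"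
  by (rule hinv_eqI) (rule hinv_left)

lemma U_1 [simp]: "1 \<in> U"
  using zero_neq_one by (auto simp: units_iff)

lemma U_mult [simp]: assumes "x \<in> U" "y \<in> U" shows "x * y \<in> U"
proof -
  have "x * y \<noteq> 0"
  proof
    assume "x * y = 0"
    then have "hinv x * (x * y) = 0" by simp
    then show False using assms hinv_cancel(2)[of x y] by (simp add: units_iff)
  qed
  then show ?thesis using assms by (simp add: units_iff homog_mult)
qed

lemma U_power [simp]: "x \<in> U \<Longrightarrow> x ^ n \<in> U"
  by (induction n) auto

lemma U_prod: "(\<And>i. i \<in> I \<Longrightarrow> f i \<in> U) \<Longrightarrow> prod f I \<in> U"
  by (induction I rule: infinite_finite_induct) auto

lemma hinv_mult: "x \<in> U \<Longrightarrow> y \<in> U \<Longrightarrow> hinv (x * y) = hinv x * hinv y"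
  by (rule hinv_eqI) (simp add: mult_ac hinv_cancel hinv)

lemma hinv_power: "x \<in> U \<Longrightarrow> hinv (x ^ n) = hinv x ^ n"
  by (induction n) (auto simp: hinv_mult)

section \<open>Graded subrings and subfields\<close>

lemma graded_subring_iff:
  "graded_subring G D S \<longleftrightarrow> 0 \<in> S \<and> 1 \<in> S \<and>
     (\<forall>x\<in>S. \<forall>y\<in>S. x + y \<in> S \<and> x * y \<in> S \<and> - x \<in> S) \<and> (\<forall>x\<in>S. \<forall>g. component x g \<in> S)"
proof -
  define C where "C x \<longleftrightarrow> (\<forall>T f. finite T \<and> T \<subseteq> carrier G \<and> (\<forall>g\<in>T. f g \<in> D g) \<and> x = (\<Sum>g\<in>T. f g)
            \<longrightarrow> (\<forall>g\<in>T. f g \<in> S))" for x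
  have "C x \<longleftrightarrow> (\<forall>g. component x g \<in> S)" if "0 \<in> S" for x
    unfolding C_def
  proof
    assume *: "\<forall>T f. finite T \<and> T \<subseteq> carrier G \<and> (\<forall>g\<in>T. f g \<in> D g) \<and> x = (\<Sum>g\<in>T. f g)
            \<longrightarrow> (\<forall>g\<in>T. f g \<in> S)"
    obtain T where T: "decomposes x T (component x)" using decomposes_component by blast
    then have "\<forall>g\<in>T. component x g \<in> S" using * unfolding decomposes_def by blast
    then show "\<forall>g. component x g \<in> S" using component_eq[OF T] \<open>0 \<in> S\<close> by metis
  next
    assume *: "\<forall>g. component x g \<in> S"
    show "\<forall>T f. finite T \<and> T \<subseteq> carrier G \<and> (\<forall>g\<in>T. f g \<in> D g) \<and> x = (\<Sum>g\<in>T. f g)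
            \<longrightarrow> (\<forall>g\<in>T. f g \<in> S)"
    proof (intro allI impI ballI)
      fix T f g
      assume "finite T \<and> T \<subseteq> carrier G \<and> (\<forall>g\<in>T. f g \<in> D g) \<and> x = (\<Sum>g\<in>T. f g)" "g \<in> T"
      then have "component x g = f g" using component_eq[of x T f g] by (simp add: decomposes_def)
      then show "f g \<in> S" using * by metis
    qed
  qed
  then show ?thesis unfolding graded_subring_def C_def[symmetric] by blast
qed

lemma subring_add: "graded_subring G D S \<Longrightarrow> x \<in> S \<Longrightarrow> y \<in> S \<Longrightarrow> x + y \<in> S"
  and subring_mult: "graded_subring G D S \<Longrightarrow> x \<in> S \<Longrightarrow> y \<in> S \<Longrightarrow> x * y \<in> S"
  and subring_uminus: "graded_subring G D S \<Longrightarrow> x \<in> S \<Longrightarrow> - x \<in> S"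
  and subring_0: "graded_subring G D S \<Longrightarrow> 0 \<in> S"
  and subring_1: "graded_subring G D S \<Longrightarrow> 1 \<in> S"
  and subring_component: "graded_subring G D S \<Longrightarrow> x \<in> S \<Longrightarrow> component x g \<in> S"
  by (auto simp: graded_subring_iff)

lemma subring_power: "graded_subring G D S \<Longrightarrow> x \<in> S \<Longrightarrow> x ^ n \<in> S"
  by (induction n) (auto simp: subring_1 subring_mult)

lemma subring_prod: "graded_subring G D S \<Longrightarrow> (\<And>i. i \<in> I \<Longrightarrow> f i \<in> S) \<Longrightarrow> prod f I \<in> S"
  by (induction I rule: infinite_finite_induct) (auto simp: subring_1 subring_mult)

lemma subring_sum: "graded_subring G D S \<Longrightarrow> (\<And>i. i \<in> I \<Longrightarrow> f i \<in> S) \<Longrightarrow> sum f I \<in> S"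
  by (induction I rule: infinite_finite_induct) (auto simp: subring_0 subring_add)

lemma subring_in_span:
  assumes "graded_subring G D S" "x \<in> S"
  shows "x \<in> additive_span (S \<inter> H)"
  using in_span_components[of x]
  by (rule additive_span_mono) (use assms subring_component component_in_homog in blast)

lemma span_least_subring:
  assumes "graded_subring G D S" "P \<subseteq> S" "x \<in> additive_span P"
  shows "x \<in> S"
  using assms(3)
  by (rule additive_span_least) (use assms subring_0 subring_add in blast)+

text \<open>A graded subring is spanned by its homogeneous elements, so an inclusion needs testing
  only on the nonzero homogeneous ones, where inverses are available.\<close>

lemma subring_subsetI:
  assumes "graded_subring G D S" "graded_subring G D S'" "\<And>x. x \<in> S \<Longrightarrow> x \<in> U \<Longrightarrow> x \<in> S'"
  shows "S \<subseteq> S'"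
proof
  fix x assume "x \<in> S"
  then have "x \<in> additive_span (S \<inter> H)" using subring_in_span assms(1) by blast
  moreover have "S \<inter> H \<subseteq> S'" using assms(2,3) subring_0 units_iff by blast
  ultimately show "x \<in> S'" using span_least_subring assms(2) by blast
qed

lemma component_span:
  assumes "x \<in> additive_span P" "P \<subseteq> H" "g \<in> carrier G"
  shows "component x g \<in> additive_span (P \<inter> D g)"
  using assms(1)
proof induction
  case zero
  then show ?case by (simp add: additive_span.zero)
next
  case (step h x)
  then obtain g' where "g' \<in> carrier G" "h \<in> D g'" using assms(2) by (auto elim: homogE)
  then have "component h g \<in> additive_span (P \<inter> D g)"
    using step.hyps by (auto simp: component_homog intro: additive_span_base additive_span.zero)
  then show ?case using step.IH by (simp add: component_add additive_span_add)
qed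

text \<open>The source of all generated subrings: closure under products and negatives already makes
  the additive span a ring, and homogeneous generators make it graded.\<close>

lemma graded_subring_span:
  assumes "P \<subseteq> H" "1 \<in> P" "\<And>x y. x \<in> P \<Longrightarrow> y \<in> P \<Longrightarrow> x * y \<in> P" "\<And>x. x \<in> P \<Longrightarrow> - x \<in> P"
  shows "graded_subring G D (additive_span P)"
  unfolding graded_subring_iff
proof (intro conjI ballI allI)
  show "0 \<in> additive_span P" by (rule additive_span.zero)
  show "1 \<in> additive_span P" by (rule additive_span_base) fact
next
  fix x y assume xy: "x \<in> additive_span P" "y \<in> additive_span P"
  show "x + y \<in> additive_span P" using xy by (rule additive_span_add)
  show "x * y \<in> additive_span P"
    by (rule additive_span_mult[OF xy]) (simp add: assms additive_span_base)
  show "- x \<in> additive_span P"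
    by (rule additive_span_uminus[OF xy(1)]) (simp add: assms additive_span_base)
next
  fix x g assume x: "x \<in> additive_span P"
  show "component x g \<in> additive_span P"
  proof (cases "g \<in> carrier G")
    case True
    from component_span[OF x assms(1) this] show ?thesis by (rule additive_span_mono) auto
  qed (simp add: component_outside additive_span.zero)
qed

lemma subfield_hinv:
  assumes "graded_subfield G D F" "x \<in> F" "x \<in> U"
  shows "hinv x \<in> F"
proof -
  have "x \<in> units_h G D F" using assms units_h_eq by blast
  then obtain y where "y \<in> F" "x * y = 1"
    using conjunct2[OF assms(1)[unfolded graded_subfield_def]] by blast
  then show ?thesis by (simp add: hinv_eqI)
qed

lemma subfield_subring: "graded_subfield G D F \<Longrightarrow> graded_subring G D F"
  by (simp add: graded_subfield_def)

lemma subfield_UNIV: "graded_subfield G D UNIV"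
  unfolding graded_subfield_def graded_subring_iff using hinv by blast

end

section \<open>Chevalley's theorem\<close>

text \<open>If A is a ring, then \<open>additive_span (products A B)\<close> is the ideal of A
  generated by B, or its extension when B lies in a larger ring.\<close>

definition products :: "'a::comm_ring_1 set \<Rightarrow> 'a set \<Rightarrow> 'a set" where
  "products A B = {a * b | a b. a \<in> A \<and> b \<in> B}"

lemma products_I: "a \<in> A \<Longrightarrow> b \<in> B \<Longrightarrow> a * b \<in> products A B"
  by (auto simp: products_def)

lemma products_E:
  assumes "x \<in> products A B"
  obtains a b where "x = a * b" "a \<in> A" "b \<in> B"
  using assms by (auto simp: products_def)

text \<open>Values at x of polynomials of degree at most n with coefficients in I. That 1 is among
  them says that I becomes the unit ideal once x is adjoined.\<close>

definition powers_span :: "'a::comm_ring_1 set \<Rightarrow> 'a \<Rightarrow> nat \<Rightarrow> 'a set" where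
  "powers_span I x n = additive_span {a * x ^ i | a i. a \<in> I \<and> i \<le> n}"

lemma powers_span_top:
  fixes x :: "'a::comm_ring_1"
  assumes "0 \<in> I" "\<And>a b. a \<in> I \<Longrightarrow> b \<in> I \<Longrightarrow> a + b \<in> I" "y \<in> powers_span I x (Suc n)"
  shows "\<exists>a\<in>I. \<exists>z\<in>powers_span I x n. y = z + a * x ^ Suc n"
  using assms(3) unfolding powers_span_def
proof induction
  case zero
  have "0 = 0 + 0 * x ^ Suc n" by simp
  then show ?case using assms(1) additive_span.zero by blast
next
  case (step h y)
  then obtain a z where az: "a \<in> I" "z \<in> additive_span {a * x ^ i | a i. a \<in> I \<and> i \<le> n}"
    "y = z + a * x ^ Suc n" by blast
  from step.hyps obtain b i where h: "h = b * x ^ i" "b \<in> I" "i \<le> Suc n" by blast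
  show ?case
  proof (cases "i = Suc n")
    case True
    then have "h + y = z + (a + b) * x ^ Suc n" using h az by (simp add: algebra_simps)
    then show ?thesis using az assms(2) h(2) by blast
  next
    case False
    then have "i \<le> n" using h by simp
    then have "h \<in> {a * x ^ i | a i. a \<in> I \<and> i \<le> n}" using h by blast
    then have "h + z \<in> additive_span {a * x ^ i | a i. a \<in> I \<and> i \<le> n}"
      using az(2) by (rule additive_span.step)
    moreover have "h + y = (h + z) + a * x ^ Suc n" using az by (simp add: add.assoc)
    ultimately show ?thesis using az(1) by blast
  qed
qed

lemma powers_span_bottom:
  fixes x :: "'a::comm_ring_1"
  assumes "0 \<in> I" "\<And>a b. a \<in> I \<Longrightarrow> b \<in> I \<Longrightarrow> a + b \<in> I" "y \<in> powers_span I x n"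
  shows "\<exists>a\<in>I. \<exists>z\<in>additive_span {a * x ^ i | a i. a \<in> I \<and> 1 \<le> i \<and> i \<le> n}. y = a + z"
  using assms(3) unfolding powers_span_def
proof induction
  case zero
  have "0 = 0 + (0::'a)" by simp
  then show ?case using assms(1) additive_span.zero by blast
next
  case (step h y)
  then obtain a z where az: "a \<in> I" "z \<in> additive_span {a * x ^ i | a i. a \<in> I \<and> 1 \<le> i \<and> i \<le> n}"
    "y = a + z" by blast
  from step.hyps obtain b i where h: "h = b * x ^ i" "b \<in> I" "i \<le> n" by blast
  show ?case
  proof (cases "i = 0")
    case True
    then have "h + y = (a + b) + z" using h az by (simp add: algebra_simps)
    then show ?thesis using az assms(2) h(2) by blast
  next
    case False
    then have "1 \<le> i" by simp
    then have "h \<in> {a * x ^ i | a i. a \<in> I \<and> 1 \<le> i \<and> i \<le> n}" using h by blast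
    then have "h + z \<in> additive_span {a * x ^ i | a i. a \<in> I \<and> 1 \<le> i \<and> i \<le> n}"
      using az(2) by (rule additive_span.step)
    moreover have "h + y = a + (h + z)" using az by (simp add: algebra_simps)
    ultimately show ?thesis using az(1) by blast
  qed
qed

text \<open>The lowering step of Chevalley's theorem, with y the inverse of x. Write 1 = b + w with
  b in I and w free of constant term in y, and 1 = z + a x^(n+1). Then 1 = b + w (z + a x^(n+1)),
  where w z = z - b z has degree at most n, and so does the last product. Working with w = 1 - b
  directly avoids inverting 1 - b.\<close>

lemma powers_span_reduce:
  fixes x y :: "'a::comm_ring_1"
  assumes I: "0 \<in> I" "\<And>a b. a \<in> I \<Longrightarrow> b \<in> I \<Longrightarrow> a + b \<in> I"
    "\<And>a b. a \<in> I \<Longrightarrow> b \<in> I \<Longrightarrow> a * b \<in> I" "\<And>a. a \<in> I \<Longrightarrow> - a \<in> I"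
    and xy: "x * y = 1"
    and n: "1 \<in> powers_span I x (Suc n)" and m: "1 \<in> powers_span I y m" "m \<le> Suc n"
  shows "1 \<in> powers_span I x n"
proof -
  obtain a z where a: "a \<in> I" "z \<in> powers_span I x n" "1 = z + a * x ^ Suc n"
    using powers_span_top[OF I(1,2) n] by blast
  obtain b w where b: "b \<in> I" "w \<in> additive_span {a * y ^ i | a i. a \<in> I \<and> 1 \<le> i \<and> i \<le> m}" "1 = b + w"
    using powers_span_bottom[OF I(1,2) m(1)] by blast
  \<comment> \<open>Each y^i cancels i factors of x. At least one is cancelled because i is
    positive, and enough are present because \<open>m \<le> Suc n\<close>.\<close>
  have w: "w * (a * x ^ Suc n) \<in> powers_span I x n"
    unfolding powers_span_def
  proof (rule additive_span_times[OF b(2)])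
    fix h assume "h \<in> {a * y ^ i | a i. a \<in> I \<and> 1 \<le> i \<and> i \<le> m}"
    then obtain c i where h: "h = c * y ^ i" "c \<in> I" "1 \<le> i" "i \<le> m" by blast
    have "x ^ Suc n = x ^ i * x ^ (Suc n - i)" using h m by (simp add: power_add[symmetric])
    then have "h * (a * x ^ Suc n) = (c * a) * x ^ (Suc n - i) * (x * y) ^ i"
      by (simp add: h power_mult_distrib mult_ac)
    then have "h * (a * x ^ Suc n) = (c * a) * x ^ (Suc n - i)" by (simp add: xy)
    moreover have "c * a \<in> I" "Suc n - i \<le> n" using h a I(3) by auto
    ultimately show "h * (a * x ^ Suc n) \<in> additive_span {a * x ^ i | a i. a \<in> I \<and> i \<le> n}"
      by (intro additive_span_base) blast
  qed
  have bz: "- (b * z) \<in> powers_span I x n"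
    unfolding mult.commute[of b z] minus_mult_right powers_span_def
  proof (rule additive_span_times[OF a(2)[unfolded powers_span_def]])
    fix h assume "h \<in> {a * x ^ i | a i. a \<in> I \<and> i \<le> n}"
    then obtain c i where h: "h = c * x ^ i" "c \<in> I" "i \<le> n" by blast
    have "h * - b = (- (c * b)) * x ^ i" by (simp add: h mult_ac)
    moreover have "- (c * b) \<in> I" using I h b by blast
    ultimately show "h * - b \<in> additive_span {a * x ^ i | a i. a \<in> I \<and> i \<le> n}"
      using h(3) by (intro additive_span_base) blast
  qed
  have "b = b * x ^ 0" by simp
  then have bb: "b \<in> powers_span I x n"
    unfolding powers_span_def using b(1) by (intro additive_span_base) blast
  have w1: "w = 1 - b" using b(3) by (simp add: algebra_simps)
  have "1 = b + w * (z + a * x ^ Suc n)" using b(3) a(3) by simp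
  also have "\<dots> = b + (z + - (b * z) + w * (a * x ^ Suc n))"
    by (simp add: w1 algebra_simps)
  finally show ?thesis
    using additive_span_add[OF bb[unfolded powers_span_def]
        additive_span_add[OF additive_span_add[OF a(2)[unfolded powers_span_def] bz[unfolded powers_span_def]]
          w[unfolded powers_span_def]]]
    by (simp add: powers_span_def)
qed

text \<open>Induction on n + m, always lowering the larger of the two bounds, which is the case that
  \<open>powers_span_reduce\<close> covers. Once a bound is 0, the relation exhibits 1 as an element
  of I.\<close>

lemma powers_span_descent:
  fixes x y :: "'a::comm_ring_1"
  assumes I: "0 \<in> I" "\<And>a b. a \<in> I \<Longrightarrow> b \<in> I \<Longrightarrow> a + b \<in> I"
    "\<And>a b. a \<in> I \<Longrightarrow> b \<in> I \<Longrightarrow> a * b \<in> I" "\<And>a. a \<in> I \<Longrightarrow> - a \<in> I"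
    and "x * y = 1" "1 \<in> powers_span I x n" "1 \<in> powers_span I y m"
  shows "1 \<in> I"
  using assms(5-)
proof (induction "n + m" arbitrary: x y n m rule: less_induct)
  case less
  have 0: "1 \<in> I" if "1 \<in> powers_span I u 0" for u
    using that unfolding powers_span_def
    by (rule additive_span_least) (use I in auto)
  show ?case
  proof (cases "n = 0 \<or> m = 0")
    case True
    then show ?thesis using 0 less.prems by blast
  next
    case False
    then obtain n' m' where nm: "n = Suc n'" "m = Suc m'" using not0_implies_Suc by blast
    show ?thesis
    proof (cases "m \<le> n")
      case True
      have "1 \<in> powers_span I x n'"
        by (rule powers_span_reduce[OF I less.prems(1)]) (use less.prems True nm in auto)
      from less.hyps[OF _ less.prems(1) this less.prems(3)] show ?thesis using nm by simp
    next
      case F: False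
      have yx: "y * x = 1" using less.prems by (simp add: mult.commute)
      have "1 \<in> powers_span I y m'"
        by (rule powers_span_reduce[OF I yx]) (use less.prems F nm in auto)
      from less.hyps[OF _ less.prems(1) less.prems(2) this] show ?thesis using nm by simp
    qed
  qed
qed

context gr_field begin

section \<open>Graded valuation rings and their homogeneous nonunits\<close>

definition valring :: "'a set \<Rightarrow> 'a set \<Rightarrow> bool" where
  "valring F R \<longleftrightarrow> graded_subring G D R \<and> R \<subseteq> F \<and> (\<forall>f\<in>F \<inter> U. f \<in> R \<or> hinv f \<in> R)"

lemma gval_rings_iff: "R \<in> gval_rings G D F k \<longleftrightarrow> valring F R \<and> k \<subseteq> R"
proof -
  have "(\<exists>y\<in>R. f * y = 1) \<longleftrightarrow> hinv f \<in> R" if "f \<in> F \<inter> U" for f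
    using that hinv hinv_eqI by (metis IntD2)
  then have "(\<forall>f\<in>F \<inter> U. f \<in> R \<or> (\<exists>y\<in>R. f * y = 1)) \<longleftrightarrow> (\<forall>f\<in>F \<inter> U. f \<in> R \<or> hinv f \<in> R)"
    by (meson)
  then show ?thesis unfolding gval_rings_def valring_def using units_h_eq[of F] by auto
qed

lemma valring_subring: "valring F R \<Longrightarrow> graded_subring G D R"
  and valring_subset: "valring F R \<Longrightarrow> R \<subseteq> F"
  and valring_cases: "valring F R \<Longrightarrow> f \<in> F \<Longrightarrow> f \<in> U \<Longrightarrow> f \<in> R \<or> hinv f \<in> R"
  by (auto simp: valring_def)

text \<open>The homogeneous part of the maximal ideal. Membership in R need not be demanded, since
  in a valuation ring \<open>hinv x \<notin> R\<close> forces it; in this form it is evident that a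
  larger R has fewer nonunits.\<close>

definition nonunits :: "'a set \<Rightarrow> 'a set \<Rightarrow> 'a set" where
  "nonunits F R = {x \<in> F \<inter> H. x = 0 \<or> hinv x \<notin> R}"

lemma nonunits_subset: "valring F R \<Longrightarrow> nonunits F R \<subseteq> R"
  using valring_cases subring_0[OF valring_subring] by (fastforce simp: nonunits_def units_iff)

lemma nonunits_homog: "nonunits F R \<subseteq> H"
  by (auto simp: nonunits_def)

lemma nonunits_0: "graded_subfield G D F \<Longrightarrow> 0 \<in> nonunits F R"
  by (auto simp: nonunits_def subring_0[OF subfield_subring])

lemma nonunits_mult:
  assumes F: "graded_subfield G D F" and R: "valring F R"
    and x: "x \<in> nonunits F R" and y: "y \<in> R" "y \<in> H"
  shows "x * y \<in> nonunits F R"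
proof -
  have F': "x \<in> F" "y \<in> F" "x \<in> H" using x y valring_subset[OF R] by (auto simp: nonunits_def)
  have xy: "x * y \<in> F \<inter> H"
    using F' y(2) subring_mult[OF subfield_subring[OF F]] homog_mult by blast
  show ?thesis
  proof (cases "x = 0 \<or> y = 0")
    case True
    then show ?thesis using xy by (auto simp: nonunits_def)
  next
    case False
    then have U: "x \<in> U" "y \<in> U" using F' y by (auto simp: units_iff)
    have "hinv (x * y) \<notin> R"
    proof
      assume "hinv (x * y) \<in> R"
      then have "y * hinv (x * y) \<in> R" using subring_mult[OF valring_subring[OF R]] y by blast
      moreover have "y * hinv (x * y) = hinv x" using U by (simp add: hinv_mult mult.left_commute[of y] hinv)
      ultimately show False using x False by (simp add: nonunits_def)
    qed
    then show ?thesis using xy by (simp add: nonunits_def)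
  qed
qed

text \<open>One of x/y and y/x lies in R, say x/y. If 1/(x + y) were in R too, then so would be (x/y
  + 1)/(x + y) = 1/y. The common degree keeps x + y homogeneous.\<close>

lemma nonunits_add:
  assumes F: "graded_subfield G D F" and R: "valring F R" and g: "g \<in> carrier G"
    and x: "x \<in> nonunits F R" "x \<in> D g" and y: "y \<in> nonunits F R" "y \<in> D g"
  shows "x + y \<in> nonunits F R"
proof (cases "x = 0 \<or> y = 0 \<or> x + y = 0")
  case True
  then show ?thesis using x y nonunits_0[OF F] by auto
next
  case False
  have F': "x \<in> F" "y \<in> F" using x y by (auto simp: nonunits_def)
  have xy: "x + y \<in> F" "x + y \<in> D g"
    using F' subring_add[OF subfield_subring[OF F]] D_add[OF g] x y by auto
  have U: "x \<in> U" "y \<in> U" "x + y \<in> U" using False x y xy g by (auto simp: units_iff intro: homogI)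
  note SR = valring_subring[OF R]
  have *: "hinv (u + v) \<notin> R" if uv: "u \<in> U" "v \<in> U" "u + v \<in> U" "u * hinv v \<in> R" "hinv v \<notin> R" for u v
  proof
    assume "hinv (u + v) \<in> R"
    then have "(u * hinv v + 1) * hinv (u + v) \<in> R"
      using uv SR subring_add subring_mult subring_1 by blast
    moreover have "(u * hinv v + 1) * hinv (u + v) = hinv v * ((u + v) * hinv (u + v))"
      using uv(2) by (simp add: algebra_simps hinv_cancel hinv_left)
    ultimately show False using uv(3,5) by (simp add: hinv)
  qed
  have nu: "hinv x \<notin> R" "hinv y \<notin> R" using x y False by (auto simp: nonunits_def)
  have "x * hinv y \<in> F" using F' U subfield_hinv[OF F] subring_mult[OF subfield_subring[OF F]] by blast
  then have "x * hinv y \<in> R \<or> hinv (x * hinv y) \<in> R"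
    using valring_cases[OF R] U by simp
  then have "hinv (x + y) \<notin> R"
  proof
    assume "x * hinv y \<in> R"
    then show ?thesis using * U nu by blast
  next
    assume "hinv (x * hinv y) \<in> R"
    then have "y * hinv x \<in> R" using U by (simp add: hinv_mult mult.commute)
    then show ?thesis using *[of y x] U nu by (simp add: add.commute)
  qed
  then show ?thesis using xy U by (simp add: nonunits_def units_iff)
qed

lemma nonunits_sum:
  assumes "graded_subfield G D F" "valring F R" "g \<in> carrier G"
    "\<And>i. i \<in> I \<Longrightarrow> f i \<in> nonunits F R" "\<And>i. i \<in> I \<Longrightarrow> f i \<in> D g"
  shows "sum f I \<in> nonunits F R"
  using assms(4,5)
proof (induction I rule: infinite_finite_induct)
  case (insert i I)
  have "f i + sum f I \<in> nonunits F R"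
    by (rule nonunits_add[OF assms(1-3)]) (use insert D_sum[OF assms(3), of I f] in auto)
  then show ?case using insert.hyps by simp
qed (simp_all add: nonunits_0[OF assms(1)])

lemma one_nonunit: "valring F R \<Longrightarrow> 1 \<notin> nonunits F R"
  using zero_neq_one subring_1[OF valring_subring] by (auto simp: nonunits_def)

text \<open>Nonunits of one degree are additively closed, so the ideal they span acquires no new
  homogeneous elements. In degree one this shows that the ideal is proper.\<close>

lemma component_span_nonunits:
  assumes F: "graded_subfield G D F" and R: "valring F R" and x: "x \<in> additive_span (nonunits F R)"
  shows "component x g \<in> nonunits F R"
proof (cases "g \<in> carrier G")
  case True
  have "component x g \<in> additive_span (nonunits F R \<inter> D g)"
    by (rule component_span[OF x nonunits_homog True])
  then have "component x g \<in> nonunits F R \<inter> D g"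
    by (rule additive_span_least)
      (use nonunits_0[OF F] D_zero[OF True] nonunits_add[OF F R True] D_add[OF True] in blast)+
  then show ?thesis by simp
qed (simp add: component_outside nonunits_0[OF F])

lemma one_span_nonunits:
  assumes "graded_subfield G D F" "valring F R"
  shows "1 \<notin> additive_span (nonunits F R)"
  using component_span_nonunits[OF assms, of 1 \<one>] one_nonunit[OF assms(2)]
    component_homog[OF one_closed one_D, of \<one>] by auto

text \<open>Divisibility in R is a total preorder on the nonzero homogeneous elements of F, and z
  divides all the others. The lemma serves to normalise the coefficients or terms of a
  relation.\<close>

lemma valring_max:
  assumes F: "graded_subfield G D F" and R: "valring F R"
  shows "finite Z \<Longrightarrow> Z \<noteq> {} \<Longrightarrow> Z \<subseteq> F \<inter> U \<Longrightarrow> \<exists>z\<in>Z. \<forall>y\<in>Z. y * hinv z \<in> R"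
proof (induction Z rule: finite_ne_induct)
  case (singleton x)
  then show ?case using hinv subring_1[OF valring_subring[OF R]] by simp
next
  case (insert x Z)
  then obtain z where z: "z \<in> Z" "\<forall>y\<in>Z. y * hinv z \<in> R" by blast
  have U: "x \<in> U" "z \<in> U" "x \<in> F" "z \<in> F" using insert.prems z by auto
  have "x * hinv z \<in> F" using U subfield_hinv[OF F] subring_mult[OF subfield_subring[OF F]] by blast
  then have "x * hinv z \<in> R \<or> hinv (x * hinv z) \<in> R" using valring_cases[OF R] U by simp
  then show ?case
  proof
    assume "x * hinv z \<in> R"
    then show ?thesis using z by blast
  next
    assume "hinv (x * hinv z) \<in> R"
    then have *: "z * hinv x \<in> R" using U by (simp add: hinv_mult mult.commute)
    have "y * hinv x \<in> R" if "y \<in> Z" for y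
    proof -
      have "(y * hinv z) * (z * hinv x) \<in> R"
        using z(2) that * subring_mult[OF valring_subring[OF R]] by blast
      then show ?thesis using U by (simp add: mult.assoc hinv_cancel)
    qed
    then have "\<forall>y\<in>insert x Z. y * hinv x \<in> R"
      using hinv[OF U(1)] subring_1[OF valring_subring[OF R]] by simp
    then show ?thesis by blast
  qed
qed

text \<open>If f were not in R, its inverse would be, and then f = f^n (1/f)^(n-1) would lie in R
  after all.\<close>

lemma valring_power:
  assumes R: "valring F R" and f: "f \<in> F" "f \<in> U" and n: "0 < n" "f ^ n \<in> R"
  shows "f \<in> R"
proof (rule ccontr)
  assume "f \<notin> R"
  then have "hinv f \<in> R" using valring_cases[OF R f] by blast
  then have 1: "f ^ n * hinv f ^ (n - 1) \<in> R"
    using n subring_mult subring_power valring_subring[OF R] by blast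
  have "f ^ n = f * f ^ (n - 1)" using n(1) by (simp add: power_eq_if)
  then have "f ^ n * hinv f ^ (n - 1) = f * (f * hinv f) ^ (n - 1)"
    by (simp only: power_mult_distrib mult.assoc)
  then show False using 1 \<open>f \<notin> R\<close> f by (simp add: hinv)
qed

lemma valring_restrict:
  assumes R: "valring UNIV R" and K: "graded_subfield G D K"
  shows "valring K (R \<inter> K)"
  using valring_subring[OF R] subfield_subring[OF K] valring_cases[OF R] subfield_hinv[OF K]
  by (auto simp: valring_def graded_subring_iff)

lemma valring_dominates:
  assumes R: "valring UNIV R" and K: "graded_subfield G D K" and R': "valring K R'"
    and sub: "R' \<subseteq> R" "nonunits K R' \<subseteq> nonunits UNIV R"
  shows "R \<inter> K = R'"
proof
  show "R' \<subseteq> R \<inter> K" using sub valring_subset[OF R'] by blast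
  show "R \<inter> K \<subseteq> R'"
  proof (rule subring_subsetI)
    show "graded_subring G D (R \<inter> K)" using valring_restrict[OF R K] valring_subring by blast
    show "graded_subring G D R'" using R' valring_subring by blast
    fix x assume x: "x \<in> R \<inter> K" "x \<in> U"
    show "x \<in> R'"
    proof (rule ccontr)
      assume "x \<notin> R'"
      then have "hinv x \<in> nonunits K R'"
        using x subfield_hinv[OF K] hinv_U[OF x(2)] by (simp add: nonunits_def units_iff)
      then show False using sub(2) x hinv_U[OF x(2)] by (auto simp: nonunits_def units_iff)
    qed
  qed
qed

section \<open>The existence theorem\<close>

lemma graded_subring_Union_chain:
  assumes "C \<noteq> {}" "subset.chain UNIV C" "\<And>B. B \<in> C \<Longrightarrow> graded_subring G D B"
  shows "graded_subring G D (\<Union>C)"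
proof -
  have ex: "\<exists>B\<in>C. x \<in> B \<and> y \<in> B" if "x \<in> \<Union>C" "y \<in> \<Union>C" for x y
    using that assms(2) unfolding subset_chain_def by (metis UnionE subsetD)
  show ?thesis unfolding graded_subring_iff
  proof (intro conjI ballI allI)
    show "0 \<in> \<Union>C" "1 \<in> \<Union>C" using assms(1,3) subring_0 subring_1 by blast+
    fix x y assume "x \<in> \<Union>C" "y \<in> \<Union>C"
    then obtain B where "B \<in> C" "x \<in> B" "y \<in> B" using ex by blast
    then show "x + y \<in> \<Union>C" "x * y \<in> \<Union>C" "- x \<in> \<Union>C"
      using assms(3) subring_add subring_mult subring_uminus by blast+
  next
    fix x g assume "x \<in> \<Union>C"
    then show "component x g \<in> \<Union>C" using assms(3) subring_component by blast
  qed
qed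

text \<open>The ring is maximal among the graded subrings B containing P in which J generates a
  proper ideal. If x and 1/x were both missing from B, maximality would put 1 into the extended
  ideals in B[x] and in B[1/x], and the descent would put it into the ideal itself. No element of J
  is invertible in B, because the ideal is proper.\<close>

theorem valring_exists:
  assumes P: "P \<subseteq> H" "1 \<in> P" "\<And>x y. x \<in> P \<Longrightarrow> y \<in> P \<Longrightarrow> x * y \<in> P" "\<And>x. x \<in> P \<Longrightarrow> - x \<in> P"
    and J: "J \<subseteq> P" "1 \<notin> additive_span (products P J)"
  obtains R where "valring UNIV R" "P \<subseteq> R" "J \<subseteq> nonunits UNIV R"
proof -
  define \<B> where "\<B> = {B. graded_subring G D B \<and> P \<subseteq> B \<and> 1 \<notin> additive_span (products B J)}"
  have "additive_span P \<in> \<B>"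
  proof -
    have "x \<in> additive_span (products P J)" if "x \<in> additive_span (products (additive_span P) J)" for x
      using that
    proof (rule additive_span_subset)
      fix h assume "h \<in> products (additive_span P) J"
      then obtain a j where "h = a * j" "a \<in> additive_span P" "j \<in> J" by (rule products_E)
      then show "h \<in> additive_span (products P J)"
        using additive_span_times[of a P j] by (auto intro: additive_span_base products_I)
    qed
    then show ?thesis
      using graded_subring_span[OF P] J(2) additive_span_base by (auto simp: \<B>_def)
  qed
  moreover have "\<Union>C \<in> \<B>" if C: "C \<noteq> {}" "subset.chain \<B> C" for C
  proof -
    have CB: "C \<subseteq> \<B>" and ch: "subset.chain UNIV C" using C(2) by (auto simp: subset_chain_def)
    \<comment> \<open>An element of the span involves finitely many coefficients, and in a chain a
      single B contains them all.\<close>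
    have "\<exists>B\<in>C. x \<in> additive_span (products B J)" if "x \<in> additive_span (products (\<Union>C) J)" for x
      using that
    proof induction
      case zero
      then show ?case using C(1) additive_span.zero by blast
    next
      case (step h x)
      then obtain B where B: "B \<in> C" "x \<in> additive_span (products B J)" by blast
      obtain a j where aj: "h = a * j" "a \<in> \<Union>C" "j \<in> J" using products_E[OF step.hyps(1)] by blast
      then obtain B' where B': "B' \<in> C" "a \<in> B'" by blast
      have "B \<subseteq> B' \<or> B' \<subseteq> B" using ch B(1) B'(1) by (auto simp: subset_chain_def)
      then obtain B'' where B'': "B'' \<in> C" "B \<subseteq> B''" "B' \<subseteq> B''" using B(1) B'(1) by blast
      have "x \<in> additive_span (products B'' J)"
        using B(2) by (rule additive_span_mono) (use B'' in \<open>auto simp: products_def\<close>)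
      then have "h + x \<in> additive_span (products B'' J)"
        by (rule additive_span.step[rotated]) (use aj B' B'' in \<open>auto intro: products_I\<close>)
      then show ?case using B''(1) by blast
    qed
    then have "1 \<notin> additive_span (products (\<Union>C) J)" using CB by (auto simp: \<B>_def)
    moreover have "graded_subring G D (\<Union>C)"
      by (rule graded_subring_Union_chain[OF C(1) ch]) (use CB in \<open>auto simp: \<B>_def\<close>)
    moreover have "P \<subseteq> \<Union>C" using C(1) CB by (auto simp: \<B>_def)
    ultimately show ?thesis by (simp add: \<B>_def)
  qed
  ultimately obtain B where B: "B \<in> \<B>" "\<And>X. X \<in> \<B> \<Longrightarrow> B \<subseteq> X \<Longrightarrow> X = B"
    using subset_Zorn_nonempty[of \<B>] by (metis empty_iff)
  then have SB: "graded_subring G D B" and PB: "P \<subseteq> B" and 1: "1 \<notin> additive_span (products B J)"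
    by (auto simp: \<B>_def)
  define I where "I = additive_span (products B J)"
  have I_times: "a * b \<in> I" if "a \<in> I" "b \<in> B" for a b
    using that(1) unfolding I_def
  proof (rule additive_span_times)
    fix h assume "h \<in> products B J"
    then obtain c j where "h = c * j" "c \<in> B" "j \<in> J" by (rule products_E)
    then have "h * b = (c * b) * j" "c * b \<in> B" "j \<in> J"
      using that(2) subring_mult[OF SB] by (auto simp: mult_ac)
    then show "h * b \<in> additive_span (products B J)" by (auto intro: additive_span_base products_I)
  qed
  have I0: "0 \<in> I" and I_add: "\<And>a b. a \<in> I \<Longrightarrow> b \<in> I \<Longrightarrow> a + b \<in> I"
    unfolding I_def by (auto intro: additive_span.zero additive_span_add)
  have I_um: "- a \<in> I" if "a \<in> I" for a
    using I_times[OF that, of "-1"] subring_1[OF SB] subring_uminus[OF SB] by auto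
  have adj: "\<exists>n. 1 \<in> powers_span I x n" if x: "x \<in> U" "x \<notin> B" for x
  proof -
    \<comment> \<open>Homogeneous generators of B[x]; the coefficients are taken from
      \<open>B \<inter> H\<close> so that their span is a graded ring.\<close>
    define Q where "Q = {b * x ^ i | b i. b \<in> B \<inter> H}"
    have QI: "b * x ^ i \<in> Q" if "b \<in> B" "b \<in> H" for b i using that by (auto simp: Q_def)
    have xH: "x ^ i \<in> H" for i using U_power[OF x(1)] by (simp add: units_iff)
    have SQ: "graded_subring G D (additive_span Q)"
    proof (rule graded_subring_span)
      show "Q \<subseteq> H" using xH by (auto simp: Q_def intro: homog_mult)
      show "1 \<in> Q" using QI[of 1 0] subring_1[OF SB] by simp
      fix u v assume "u \<in> Q"
      then obtain b i where u: "u = b * x ^ i" "b \<in> B" "b \<in> H" by (auto simp: Q_def)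
      show "- u \<in> Q" using QI[of "-b" i] u subring_uminus[OF SB] homog_uminus by simp
      assume "v \<in> Q"
      then obtain c j where v: "v = c * x ^ j" "c \<in> B" "c \<in> H" by (auto simp: Q_def)
      have "u * v = (b * c) * x ^ (i + j)" using u v by (simp add: power_add mult_ac)
      then show "u * v \<in> Q" using QI[of "b * c" "i + j"] u v subring_mult[OF SB] homog_mult by simp
    qed
    have BQ: "B \<subseteq> additive_span Q"
    proof
      fix b assume "b \<in> B"
      then have "b \<in> additive_span (B \<inter> H)" by (rule subring_in_span[OF SB])
      then show "b \<in> additive_span Q"
        by (rule additive_span_mono) (use QI[of _ 0] in auto)
    qed
    have "x \<in> additive_span Q"
      using QI[of 1 1] subring_1[OF SB] by (auto intro: additive_span_base)
    then have "additive_span Q \<notin> \<B>" using B(2)[of "additive_span Q"] BQ x(2) by auto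
    then have "1 \<in> additive_span (products (additive_span Q) J)" using SQ BQ PB by (auto simp: \<B>_def)
    moreover have "\<exists>n. y \<in> powers_span I x n" if "y \<in> additive_span (products (additive_span Q) J)" for y
    proof -
      have "y \<in> additive_span (products Q J)"
        using that
      proof (rule additive_span_subset)
        fix h assume "h \<in> products (additive_span Q) J"
        then obtain a j where "h = a * j" "a \<in> additive_span Q" "j \<in> J" by (rule products_E)
        then show "h \<in> additive_span (products Q J)"
          using additive_span_times[of a Q j] by (auto intro: additive_span_base products_I)
      qed
      then show ?thesis
      proof induction
        case zero
        then show ?case by (auto simp: powers_span_def intro: additive_span.zero)
      next
        case (step h y)
        then obtain n where n: "y \<in> powers_span I x n" by blast
        from step.hyps obtain b i j where h: "h = (b * x ^ i) * j" "b \<in> B" "j \<in> J"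
          by (auto simp: Q_def elim!: products_E)
        have "h = (b * j) * x ^ i" using h by (simp add: mult_ac)
        moreover have "b * j \<in> I" unfolding I_def using h by (auto intro: additive_span_base products_I)
        moreover have "i \<le> max n i" by simp
        ultimately have 1: "h \<in> {a * x ^ k | a k. a \<in> I \<and> k \<le> max n i}" by blast
        have "y \<in> powers_span I x (max n i)"
          using n unfolding powers_span_def by (rule additive_span_mono) (use max.coboundedI1 in blast)
        then have "h + y \<in> powers_span I x (max n i)"
          using 1 unfolding powers_span_def by (intro additive_span.step)
        then show ?case by blast
      qed
    qed
    ultimately show ?thesis by blast
  qed
  have "valring UNIV B"
    unfolding valring_def
  proof (intro conjI ballI)
    fix x assume "x \<in> UNIV \<inter> U"
    then have x: "x \<in> U" by simp
    show "x \<in> B \<or> hinv x \<in> B"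
    proof (rule ccontr)
      assume no: "\<not> (x \<in> B \<or> hinv x \<in> B)"
      then obtain n m where nm: "1 \<in> powers_span I x n" "1 \<in> powers_span I (hinv x) m"
        using adj[of x] adj[of "hinv x"] x by auto
      \<comment> \<open>An ideal lying inside B is closed under multiplication, which is what the
        descent asks of I.\<close>
      have IB: "I \<subseteq> B"
      proof
        fix y assume "y \<in> I"
        moreover have "products B J \<subseteq> B"
          using J(1) PB subring_mult[OF SB] by (auto simp: products_def)
        ultimately show "y \<in> B" using span_least_subring[OF SB] by (auto simp: I_def)
      qed
      have "1 \<in> I"
        by (rule powers_span_descent[OF I0 I_add _ I_um hinv[OF x] nm]) (use I_times IB in blast)+
      then show False using 1 by (simp add: I_def)
    qed
  qed (use SB in auto)
  moreover have "J \<subseteq> nonunits UNIV B"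
  proof
    fix j assume j: "j \<in> J"
    have "hinv j \<notin> B" if "j \<noteq> 0"
    proof
      assume "hinv j \<in> B"
      then have "hinv j * j \<in> products B J" using j by (rule products_I)
      moreover have "j \<in> U" using that j J(1) P(1) by (auto simp: units_iff)
      ultimately show False using 1 additive_span_base hinv_left by metis
    qed
    then show "j \<in> nonunits UNIV B" using j J(1) P(1) by (auto simp: nonunits_def)
  qed
  ultimately show ?thesis using that PB by blast
qed

end

section \<open>Extending valuation rings in general position\<close>

definition exponents :: "'a set \<Rightarrow> ('a \<Rightarrow> nat) set" where
  "exponents S = {\<alpha>. \<forall>s. s \<notin> S \<longrightarrow> \<alpha> s = 0}"

definition monomial :: "'a::comm_ring_1 set \<Rightarrow> ('a \<Rightarrow> nat) \<Rightarrow> 'a" where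
  "monomial S \<alpha> = (\<Prod>s\<in>S. s ^ \<alpha> s)"

text \<open>The additive span is k[S] if X is \<open>k \<inter> H\<close>, and the extended ideal
  m[S] if X is the set of nonunits of a valuation ring.\<close>

definition monomials :: "'a::comm_ring_1 set \<Rightarrow> 'a set \<Rightarrow> 'a set" where
  "monomials X S = {c * monomial S \<alpha> | c \<alpha>. c \<in> X \<and> \<alpha> \<in> exponents S}"

lemma alg_indep_iff:
  "alg_indep k S \<longleftrightarrow> finite S \<and> (\<forall>M c. finite M \<and> M \<subseteq> exponents S \<and> (\<forall>\<alpha>\<in>M. c \<alpha> \<in> k) \<and>
     (\<Sum>\<alpha>\<in>M. c \<alpha> * monomial S \<alpha>) = 0 \<longrightarrow> (\<forall>\<alpha>\<in>M. c \<alpha> = 0))"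
  unfolding alg_indep_def monomial_def exponents_def by (simp add: subset_eq)

lemma alg_indepD:
  assumes "alg_indep k S" "finite M" "M \<subseteq> exponents S" "\<And>\<alpha>. \<alpha> \<in> M \<Longrightarrow> c \<alpha> \<in> k"
    "(\<Sum>\<alpha>\<in>M. c \<alpha> * monomial S \<alpha>) = 0" "\<alpha> \<in> M"
  shows "c \<alpha> = 0"
  using assms unfolding alg_indep_iff by blast

lemma monomial_add: "monomial S (\<lambda>s. \<alpha> s + \<beta> s) = monomial S \<alpha> * monomial S \<beta>"
  by (simp add: monomial_def power_add prod.distrib)

lemma monomial_zero [simp]: "monomial S (\<lambda>_. 0) = 1"
  by (simp add: monomial_def)

lemma exponents_add: "\<alpha> \<in> exponents S \<Longrightarrow> \<beta> \<in> exponents S \<Longrightarrow> (\<lambda>s. \<alpha> s + \<beta> s) \<in> exponents S"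
  and exponents_zero [simp]: "(\<lambda>_. 0) \<in> exponents S"
  by (simp_all add: exponents_def)

lemma monomials_I: "c \<in> X \<Longrightarrow> \<alpha> \<in> exponents S \<Longrightarrow> c * monomial S \<alpha> \<in> monomials X S"
  by (auto simp: monomials_def)

lemma monomials_E:
  assumes "x \<in> monomials X S"
  obtains c \<alpha> where "x = c * monomial S \<alpha>" "c \<in> X" "\<alpha> \<in> exponents S"
  using assms by (auto simp: monomials_def)

lemma monomials_mult:
  assumes "x \<in> monomials X S" "y \<in> monomials Y S" "\<And>a b. a \<in> X \<Longrightarrow> b \<in> Y \<Longrightarrow> a * b \<in> Z"
  shows "x * y \<in> monomials Z S"
proof -
  obtain a \<alpha> where x: "x = a * monomial S \<alpha>" "a \<in> X" "\<alpha> \<in> exponents S"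
    using assms(1) by (rule monomials_E)
  obtain b \<beta> where y: "y = b * monomial S \<beta>" "b \<in> Y" "\<beta> \<in> exponents S"
    using assms(2) by (rule monomials_E)
  have "x * y = (a * b) * monomial S (\<lambda>s. \<alpha> s + \<beta> s)"
    by (simp add: x y monomial_add mult_ac)
  then show ?thesis using monomials_I[OF assms(3) exponents_add] x y by simp
qed

text \<open>Like terms are collected into one coefficient per exponent. The coefficients vanish
  outside M so that two expansions can be compared on a common index set; E is a parameter in order
  to retain a restriction on exponents, such as a weight bound.\<close>

lemma sum_monomials:
  fixes x :: "'a::comm_ring_1"
  assumes "x \<in> additive_span {c * monomial S \<alpha> | c \<alpha>. c \<in> X \<and> \<alpha> \<in> E}"
    and X: "0 \<in> X" "\<And>a b. a \<in> X \<Longrightarrow> b \<in> X \<Longrightarrow> a + b \<in> X"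
  shows "\<exists>M c. finite M \<and> M \<subseteq> E \<and> (\<forall>\<alpha>. c \<alpha> \<in> X) \<and> (\<forall>\<alpha>. \<alpha> \<notin> M \<longrightarrow> c \<alpha> = 0) \<and>
    x = (\<Sum>\<alpha>\<in>M. c \<alpha> * monomial S \<alpha>)"
  using assms(1)
proof induction
  case zero
  show ?case by (rule exI[of _ "{}"], rule exI[of _ "\<lambda>_. 0"]) (simp add: X(1))
next
  case (step h x)
  then obtain M c where M: "finite M" "M \<subseteq> E" "\<forall>\<alpha>. c \<alpha> \<in> X" "\<forall>\<alpha>. \<alpha> \<notin> M \<longrightarrow> c \<alpha> = 0"
    "x = (\<Sum>\<alpha>\<in>M. c \<alpha> * monomial S \<alpha>)" by blast
  from step.hyps obtain b \<beta> where h: "h = b * monomial S \<beta>" "b \<in> X" "\<beta> \<in> E" by blast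
  define c' where "c' = c(\<beta> := b + c \<beta>)"
  have "(\<Sum>\<alpha>\<in>insert \<beta> M. c' \<alpha> * monomial S \<alpha>) =
      (\<Sum>\<alpha>\<in>insert \<beta> M. (if \<alpha> = \<beta> then h else 0) + c \<alpha> * monomial S \<alpha>)"
    by (rule sum.cong) (auto simp: c'_def h(1) algebra_simps)
  also have "\<dots> = h + (\<Sum>\<alpha>\<in>insert \<beta> M. c \<alpha> * monomial S \<alpha>)"
    using M(1) by (simp add: sum.distrib)
  also have "(\<Sum>\<alpha>\<in>insert \<beta> M. c \<alpha> * monomial S \<alpha>) = x"
    using M by (cases "\<beta> \<in> M") (auto simp: insert_absorb)
  finally have "h + x = (\<Sum>\<alpha>\<in>insert \<beta> M. c' \<alpha> * monomial S \<alpha>)" by simp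
  moreover have "finite (insert \<beta> M)" "insert \<beta> M \<subseteq> E" "\<forall>\<alpha>. c' \<alpha> \<in> X"
    "\<forall>\<alpha>. \<alpha> \<notin> insert \<beta> M \<longrightarrow> c' \<alpha> = 0" using M h X by (auto simp: c'_def)
  ultimately show ?case by blast
qed

lemma alg_indep_empty: "alg_indep k {}"
proof -
  have "c \<alpha> = 0" if "finite M" "M \<subseteq> exponents {}" "(\<Sum>\<alpha>\<in>M. c \<alpha> * monomial {} \<alpha>) = 0" "\<alpha> \<in> M"
    for M and c :: "('a \<Rightarrow> nat) \<Rightarrow> 'a" and \<alpha>
  proof -
    have "M \<subseteq> {\<lambda>_. 0}" using that(2) by (auto simp: exponents_def)
    then have "M = {\<lambda>_. 0}" using that(4) by blast
    then show ?thesis using that(3,4) by simp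
  qed
  then show ?thesis unfolding alg_indep_iff by blast
qed

context gr_field begin

text \<open>Dependence allows inhomogeneous coefficients, whereas valuation rings are tested on
  homogeneous elements. As every y i is homogeneous, one component of a relation is again a
  relation; its coefficients are components of the old ones and so remain in any graded subring that
  contains those.\<close>

lemma homogenize_relation:
  assumes "finite I" "\<And>i. i \<in> I \<Longrightarrow> y i \<in> U" "(\<Sum>i\<in>I. p i * y i) = 0" "j \<in> I" "p j \<noteq> 0"
  obtains q g where "g \<in> carrier G" "\<And>i. \<exists>h. q i = component (p i) h"
    "\<And>i. i \<in> I \<Longrightarrow> q i * y i \<in> D g" "(\<Sum>i\<in>I. q i * y i) = 0" "q j \<noteq> 0"
proof -
  have "\<exists>d. \<forall>i\<in>I. d i \<in> carrier G \<and> y i \<in> D (d i)"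
  proof -
    have "\<forall>i\<in>I. \<exists>d. d \<in> carrier G \<and> y i \<in> D d" using assms(2) by (meson homogE units_iff)
    then show ?thesis by (rule bchoice)
  qed
  then obtain d where d: "\<And>i. i \<in> I \<Longrightarrow> d i \<in> carrier G" "\<And>i. i \<in> I \<Longrightarrow> y i \<in> D (d i)" by blast
  obtain h where h: "h \<in> carrier G" "component (p j) h \<noteq> 0" using component_nonzero[OF assms(5)] .
  \<comment> \<open>The total degree for which the nonzero component of p j in degree h
    survives.\<close>
  define g where "g = h \<otimes> d j"
  have g: "g \<in> carrier G" using h d assms(4) by (simp add: g_def)
  define q where "q = (\<lambda>i. component (p i) (g \<otimes> inv (d i)))"
  have eq: "component (p i * y i) g = q i * y i" if "i \<in> I" for i
    using component_mult[OF d(1,2)[OF that] g] by (simp add: q_def)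
  show thesis
  proof
    show "g \<in> carrier G" by fact
    show "\<exists>h. q i = component (p i) h" for i by (auto simp: q_def)
    show "q i * y i \<in> D g" if "i \<in> I" for i
      using eq[OF that] component_in[OF g, of "p i * y i"] by simp
    have "(\<Sum>i\<in>I. q i * y i) = component (\<Sum>i\<in>I. p i * y i) g"
      unfolding component_sum by (rule sum.cong) (simp_all add: eq)
    then show "(\<Sum>i\<in>I. q i * y i) = 0" by (simp add: assms(3))
    have "g \<otimes> inv (d j) = h" using h d[OF assms(4)] by (simp add: g_def m_assoc)
    then show "q j \<noteq> 0" using h by (simp add: q_def)
  qed
qed

text \<open>Division by t j writes -1 as a sum of nonunits. All terms share the degree g, so the
  quotients have degree one and their sum is again a nonunit.\<close>

lemma no_dominant_term:
  assumes W: "valring UNIV W" and fin: "finite I" and g: "g \<in> carrier G"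
    and t: "(\<Sum>i\<in>I. t i) = 0" "\<And>i. i \<in> I \<Longrightarrow> t i \<in> D g" "j \<in> I" "t j \<noteq> 0"
    and dom: "\<And>i. i \<in> I \<Longrightarrow> i \<noteq> j \<Longrightarrow> t i * hinv (t j) \<in> nonunits UNIV W"
  shows False
proof -
  have jU: "t j \<in> U" using t(2)[OF t(3)] t(4) homogI[OF g] by (simp add: units_iff)
  have j: "hinv (t j) \<in> D (inv g)" by (rule hinv_D[OF jU g]) (use t in auto)
  have "(\<Sum>i\<in>I - {j}. t i * hinv (t j)) \<in> nonunits UNIV W"
  proof (rule nonunits_sum[OF subfield_UNIV W one_closed])
    fix i assume "i \<in> I - {j}"
    then show "t i * hinv (t j) \<in> nonunits UNIV W" using dom by simp
    show "t i * hinv (t j) \<in> D \<one>" if "i \<in> I - {j}" for i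
      using D_mult[OF g inv_closed[OF g] t(2) j, of i] that g by simp
  qed
  moreover have "(\<Sum>i\<in>I - {j}. t i * hinv (t j)) = -1"
  proof -
    have "0 = (\<Sum>i\<in>I. t i * hinv (t j))" using t(1) by (simp add: sum_distrib_right[symmetric])
    also have "\<dots> = t j * hinv (t j) + (\<Sum>i\<in>I - {j}. t i * hinv (t j))"
      by (rule sum.remove[OF fin t(3)])
    finally show ?thesis using hinv[OF jU] by (simp add: eq_neg_iff_add_eq_0 add.commute)
  qed
  ultimately have "-1 \<in> nonunits UNIV W" by simp
  moreover have "-1 \<in> W" "-1 \<in> H"
    using subring_1[OF valring_subring[OF W]] subring_uminus[OF valring_subring[OF W]] homog_uminus by auto
  ultimately have "-1 * -1 \<in> nonunits UNIV W" using nonunits_mult[OF subfield_UNIV W] by blast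
  then show False using one_nonunit[OF W] by simp
qed

lemma monomial_U: "S \<subseteq> U \<Longrightarrow> monomial S \<alpha> \<in> U"
  unfolding monomial_def by (rule U_prod) auto

lemma monomial_subring: "graded_subring G D R \<Longrightarrow> S \<subseteq> R \<Longrightarrow> monomial S \<alpha> \<in> R"
  unfolding monomial_def by (rule subring_prod) (auto intro: subring_power)

lemma graded_subring_monomials:
  assumes k: "graded_subring G D k" and S: "S \<subseteq> U"
  shows "graded_subring G D (additive_span (monomials (k \<inter> H) S))"
proof (rule graded_subring_span)
  show "monomials (k \<inter> H) S \<subseteq> H"
    using monomial_U[OF S] by (auto simp: monomials_def units_iff intro: homog_mult)
  show "1 \<in> monomials (k \<inter> H) S"
    using monomials_I[of 1 "k \<inter> H" "\<lambda>_. 0" S] subring_1[OF k] by simp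
  fix x y assume x: "x \<in> monomials (k \<inter> H) S"
  show "x * y \<in> monomials (k \<inter> H) S" if "y \<in> monomials (k \<inter> H) S"
    by (rule monomials_mult[OF x that]) (auto intro: subring_mult[OF k] homog_mult)
  obtain c \<alpha> where "x = c * monomial S \<alpha>" "c \<in> k \<inter> H" "\<alpha> \<in> exponents S"
    using x by (rule monomials_E)
  then show "- x \<in> monomials (k \<inter> H) S"
    using monomials_I[of "-c" "k \<inter> H" \<alpha> S] subring_uminus[OF k] homog_uminus by simp
qed

lemma sum_monomials_in_span:
  assumes k: "graded_subring G D k" and M: "M \<subseteq> exponents S" "\<And>\<alpha>. \<alpha> \<in> M \<Longrightarrow> c \<alpha> \<in> k" "finite M"
  shows "(\<Sum>\<alpha>\<in>M. c \<alpha> * monomial S \<alpha>) \<in> additive_span (monomials (k \<inter> H) S)"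
proof (rule additive_span_sum[OF M(3)])
  fix \<alpha> assume a: "\<alpha> \<in> M"
  have "c \<alpha> \<in> additive_span (k \<inter> H)" by (rule subring_in_span[OF k M(2)[OF a]])
  then show "c \<alpha> * monomial S \<alpha> \<in> additive_span (monomials (k \<inter> H) S)"
    by (rule additive_span_times) (use a M(1) in \<open>auto intro: additive_span_base monomials_I\<close>)
qed

text \<open>A form of integral closedness: a satisfies an equation whose nonzero homogeneous
  coefficients, taken from k[S], are units of W. If a were not in W, the term with the highest power
  of a would dominate.\<close>

lemma valring_contains_dependent:
  assumes k: "graded_subfield G D k" and S: "S \<subseteq> U" "alg_indep k S"
    and a: "a \<in> U" "a \<notin> S" "\<not> alg_indep k (insert a S)" and W: "valring UNIV W"
    and unit: "\<And>u. u \<in> additive_span (monomials (k \<inter> H) S) \<Longrightarrow> u \<in> U \<Longrightarrow> u \<in> W \<and> hinv u \<in> W"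
  shows "a \<in> W"
proof (rule ccontr)
  assume aW: "a \<notin> W"
  note kr = subfield_subring[OF k]
  have finS: "finite S" using S(2) by (simp add: alg_indep_iff)
  obtain M c \<alpha>0 where M: "finite M" "M \<subseteq> exponents (insert a S)" "\<forall>\<alpha>\<in>M. c \<alpha> \<in> k"
    "(\<Sum>\<alpha>\<in>M. c \<alpha> * monomial (insert a S) \<alpha>) = 0" "\<alpha>0 \<in> M" "c \<alpha>0 \<noteq> 0"
    using a(3) finS unfolding alg_indep_iff by auto
  define Mi where "Mi i = {\<alpha> \<in> M. \<alpha> a = i}" for i
  define p where "p i = (\<Sum>\<alpha>\<in>Mi i. c \<alpha> * monomial S \<alpha>)" for i
  define T where "T = (\<lambda>\<alpha>. \<alpha> a) ` M"
  have finT: "finite T" using M(1) by (simp add: T_def)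
  \<comment> \<open>Here p i is the coefficient of a^i once the relation is sorted by powers of a.
    Resetting the exponent at a to 0 is injective on \<open>Mi i\<close> and presents p i as a
    polynomial in S alone, to which independence of S applies.\<close>
  have split: "p i = (\<Sum>\<beta>\<in>(\<lambda>\<alpha>. \<alpha>(a := 0)) ` Mi i. c (\<beta>(a := i)) * monomial S \<beta>)" for i
  proof -
    have inj: "inj_on (\<lambda>\<alpha>. \<alpha>(a := 0)) (Mi i)"
    proof (rule inj_onI)
      fix \<alpha> \<beta> assume "\<alpha> \<in> Mi i" "\<beta> \<in> Mi i" "\<alpha>(a := 0) = \<beta>(a := 0)"
      then have "(\<alpha>(a := 0))(a := \<alpha> a) = (\<beta>(a := 0))(a := \<beta> a)" by (simp only: Mi_def mem_Collect_eq)
      then show "\<alpha> = \<beta>" by simp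
    qed
    have "monomial S (\<alpha>(a := 0)) = monomial S \<alpha>" for \<alpha>
      unfolding monomial_def using a(2) by (intro prod.cong) auto
    moreover have "\<alpha>(a := i) = \<alpha>" if "\<alpha> \<in> Mi i" for \<alpha> using that by (auto simp: Mi_def)
    ultimately show ?thesis by (simp add: sum.reindex[OF inj] p_def)
  qed
  have Mexp: "(\<lambda>\<alpha>. \<alpha>(a := 0)) ` Mi i \<subseteq> exponents S" for i
    using M(2) by (auto simp: Mi_def exponents_def)
  have Mc: "c (\<beta>(a := i)) \<in> k" if "\<beta> \<in> (\<lambda>\<alpha>. \<alpha>(a := 0)) ` Mi i" for \<beta> i
  proof -
    obtain \<alpha> where "\<alpha> \<in> M" "\<alpha> a = i" "\<beta> = \<alpha>(a := 0)" using \<open>\<beta> \<in> _\<close> by (auto simp: Mi_def)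
    then have "\<beta>(a := i) = \<alpha>" by auto
    then show ?thesis using M(3) \<open>\<alpha> \<in> M\<close> by simp
  qed
  have Mfin: "finite ((\<lambda>\<alpha>. \<alpha>(a := 0)) ` Mi i)" for i using M(1) by (simp add: Mi_def)
  have p_span: "p i \<in> additive_span (monomials (k \<inter> H) S)" for i
    unfolding split by (rule sum_monomials_in_span[OF kr Mexp Mc Mfin])
  have p0: "p (\<alpha>0 a) \<noteq> 0"
  proof
    assume "p (\<alpha>0 a) = 0"
    then have "c ((\<alpha>0(a := 0))(a := \<alpha>0 a)) = 0"
      unfolding split by (intro alg_indepD[OF S(2) Mfin Mexp, where c = "\<lambda>\<beta>. c (\<beta>(a := \<alpha>0 a))"])
        (use M(5) in \<open>auto simp: Mi_def intro: Mc\<close>)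
    then show False using M(6) by simp
  qed
  have "(\<Sum>i\<in>T. p i * a ^ i) = (\<Sum>\<alpha>\<in>M. c \<alpha> * monomial (insert a S) \<alpha>)"
  proof -
    have "(\<Sum>\<alpha>\<in>M. c \<alpha> * monomial (insert a S) \<alpha>) =
        (\<Sum>i\<in>T. \<Sum>\<alpha>\<in>Mi i. c \<alpha> * monomial (insert a S) \<alpha>)"
      unfolding T_def Mi_def by (rule sum.image_gen[OF M(1)])
    also have "\<dots> = (\<Sum>i\<in>T. p i * a ^ i)"
      unfolding p_def sum_distrib_right
      by (intro sum.cong) (use a(2) finS in \<open>auto simp: Mi_def monomial_def mult_ac\<close>)
    finally show ?thesis by simp
  qed
  then have rel: "(\<Sum>i\<in>T. p i * a ^ i) = 0" using M(4) by simp
  obtain q g where q: "g \<in> carrier G" "\<And>i. \<exists>h. q i = component (p i) h"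
    "\<And>i. i \<in> T \<Longrightarrow> q i * a ^ i \<in> D g" "(\<Sum>i\<in>T. q i * a ^ i) = 0" "q (\<alpha>0 a) \<noteq> 0"
    by (rule homogenize_relation[OF finT _ rel, of "\<alpha>0 a"]) (use a(1) p0 M(5) in \<open>auto simp: T_def\<close>)
  have qU: "q i \<in> U" if "q i \<noteq> 0" for i
    using q(2)[of i] that component_in_homog by (auto simp: units_iff)
  have qW: "q i \<in> W \<and> hinv (q i) \<in> W" if "q i \<noteq> 0" for i
  proof (rule unit[OF _ qU[OF that]])
    show "q i \<in> additive_span (monomials (k \<inter> H) S)"
      using q(2)[of i] subring_component[OF graded_subring_monomials[OF kr S(1)] p_span] by auto
  qed
  define N where "N = Max {i \<in> T. q i \<noteq> 0}"
  have fin: "finite {i \<in> T. q i \<noteq> 0}" and ne: "{i \<in> T. q i \<noteq> 0} \<noteq> {}"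
    using finT q(5) M(5) by (auto simp: T_def)
  have N: "N \<in> T" "q N \<noteq> 0" using Max_in[OF fin ne] by (auto simp: N_def)
  have maxN: "i \<le> N" if "i \<in> T" "q i \<noteq> 0" for i using that Max_ge[OF fin] by (auto simp: N_def)
  have anu: "hinv a \<in> nonunits UNIV W"
    using hinv_U[OF a(1)] aW a(1) by (simp add: nonunits_def units_iff)
  have aW': "hinv a \<in> W" using aW valring_cases[OF W _ a(1)] by auto
  show False
  proof (rule no_dominant_term[OF W finT q(1) q(4) q(3) N(1)])
    show "q N * a ^ N \<noteq> 0" using U_mult[OF qU[OF N(2)] U_power[OF a(1)]] by (simp add: units_iff)
    fix i assume i: "i \<in> T" "i \<noteq> N"
    show "q i * a ^ i * hinv (q N * a ^ N) \<in> nonunits UNIV W"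
    proof (cases "q i = 0")
      case True
      then show ?thesis using nonunits_0[OF subfield_UNIV] by simp
    next
      case False
      \<comment> \<open>One factor \<open>hinv a\<close> is set aside to make the quotient a
        nonunit; the other r factors and the unit coefficients stay in W.\<close>
      define r where "r = N - i - 1"
      have N': "N = i + Suc r" using maxN[OF i(1) False] i(2) by (simp add: r_def)
      have y: "hinv a ^ r * (q i * hinv (q N)) \<in> W" "hinv a ^ r * (q i * hinv (q N)) \<in> U"
        using qW[OF False] qW[OF N(2)] qU[OF False] qU[OF N(2)] a(1) aW'
          subring_mult[OF valring_subring[OF W]] subring_power[OF valring_subring[OF W]] by auto
      have "q i * a ^ i * hinv (q N * a ^ N) = q i * a ^ i * (hinv (q N) * hinv a ^ N)"
        using qU[OF N(2)] a(1) by (simp add: hinv_mult hinv_power)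
      also have "\<dots> = (a * hinv a) ^ i * (hinv a * (hinv a ^ r * (q i * hinv (q N))))"
        by (simp add: N' power_add power_mult_distrib mult_ac)
      also have "\<dots> = hinv a * (hinv a ^ r * (q i * hinv (q N)))" using hinv[OF a(1)] by simp
      finally show ?thesis
        using nonunits_mult[OF subfield_UNIV W anu y(1)] y(2) by (simp add: units_iff)
    qed
  qed auto
qed

text \<open>This plays the role of a Gauss extension: nonzero homogeneous elements of k[S] become
  units while m stays in the maximal ideal. Chevalley's condition reduces to k[S] and m[S] meeting
  only in 0, where coefficients can be compared because S is independent over K and not merely over
  k.\<close>

lemma gauss_extension:
  assumes k: "graded_subfield G D k" and K: "graded_subfield G D K" and kK: "k \<subseteq> K"
    and R: "valring K R" "k \<subseteq> R" and S: "S \<subseteq> U" "alg_indep K S"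
  obtains W where "valring UNIV W" "nonunits K R \<subseteq> nonunits UNIV W"
    "\<And>u. u \<in> additive_span (monomials (k \<inter> H) S) \<Longrightarrow> u \<in> U \<Longrightarrow> u \<in> W \<and> hinv u \<in> W"
proof -
  note kr = subfield_subring[OF k]
  define A where "A = additive_span (monomials (k \<inter> H) S)"
  have SA: "graded_subring G D A" unfolding A_def by (rule graded_subring_monomials[OF kr S(1)])
  note SR = valring_subring[OF R(1)]
  define J where "J = nonunits K R"
  have JR: "J \<subseteq> R" "J \<subseteq> H" using nonunits_subset[OF R(1)] nonunits_homog by (auto simp: J_def)
  have J_mult: "j * r \<in> J" if "j \<in> J" "r \<in> R" "r \<in> H" for j r
    using nonunits_mult[OF K R(1)] that by (simp add: J_def)
  define Z where "Z = additive_span (monomials J S)"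
  have ZA: "z * u \<in> Z" if "z \<in> Z" "u \<in> A" for z u
    unfolding Z_def
  proof (rule additive_span_mult[OF that[unfolded Z_def A_def]])
    fix x y assume "x \<in> monomials J S" "y \<in> monomials (k \<inter> H) S"
    then show "x * y \<in> additive_span (monomials J S)"
      by (intro additive_span_base monomials_mult[of x J S y "k \<inter> H" J])
        (use J_mult R(2) in auto)
  qed
  \<comment> \<open>A nonzero homogeneous element of k has its inverse in k, hence in R, and is
    never a nonunit. Passing to components is necessary because coefficients from k may be
    inhomogeneous.\<close>
  have k_span_J: "x = 0" if x: "x \<in> k" "x \<in> additive_span J" for x
  proof (rule component_all_0)
    fix g
    have 1: "component x g \<in> J"
      using component_span_nonunits[OF K R(1)] x(2) by (simp add: J_def)
    have 2: "component x g \<in> k" by (rule subring_component[OF kr x(1)])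
    show "component x g = 0"
    proof (rule ccontr)
      assume "component x g \<noteq> 0"
      then have "hinv (component x g) \<in> k" "hinv (component x g) \<notin> R"
        using 1 2 subfield_hinv[OF k] by (auto simp: J_def nonunits_def units_iff)
      then show False using R(2) by blast
    qed
  qed
  have AZ: "u = 0" if u: "u \<in> A" "u \<in> Z" for u
  proof -
    have "u \<in> additive_span {c * monomial S \<alpha> | c \<alpha>. c \<in> k \<and> \<alpha> \<in> exponents S}"
      using u(1) unfolding A_def by (rule additive_span_mono) (auto simp: monomials_def)
    from sum_monomials[OF this subring_0[OF kr] subring_add[OF kr]]
    obtain M c where c: "finite M" "M \<subseteq> exponents S" "\<forall>\<alpha>. c \<alpha> \<in> k" "\<forall>\<alpha>. \<alpha> \<notin> M \<longrightarrow> c \<alpha> = 0"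
      "u = (\<Sum>\<alpha>\<in>M. c \<alpha> * monomial S \<alpha>)" by blast
    have "u \<in> additive_span {c * monomial S \<alpha> | c \<alpha>. c \<in> additive_span J \<and> \<alpha> \<in> exponents S}"
      using u(2) unfolding Z_def
      by (rule additive_span_mono) (auto simp: monomials_def intro: additive_span_base)
    from sum_monomials[OF this additive_span.zero additive_span_add]
    obtain N d where d: "finite N" "N \<subseteq> exponents S" "\<forall>\<alpha>. d \<alpha> \<in> additive_span J"
      "\<forall>\<alpha>. \<alpha> \<notin> N \<longrightarrow> d \<alpha> = 0" "u = (\<Sum>\<alpha>\<in>N. d \<alpha> * monomial S \<alpha>)" by blast
    \<comment> \<open>Both expansions of u are padded to the same exponents; their difference is a
      relation with coefficients in K.\<close>
    have "u = (\<Sum>\<alpha>\<in>M \<union> N. c \<alpha> * monomial S \<alpha>)"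
      unfolding c(5) by (rule sum.mono_neutral_left) (use c d in auto)
    moreover have "u = (\<Sum>\<alpha>\<in>M \<union> N. d \<alpha> * monomial S \<alpha>)"
      unfolding d(5) by (rule sum.mono_neutral_left) (use c d in auto)
    ultimately have 0: "(\<Sum>\<alpha>\<in>M \<union> N. (c \<alpha> - d \<alpha>) * monomial S \<alpha>) = 0"
      by (simp add: left_diff_distrib sum_subtractf)
    have dK: "d \<alpha> \<in> K" for \<alpha>
      using span_least_subring[OF subfield_subring[OF K], of J] JR(1) valring_subset[OF R(1)] d(3) by blast
    have cdK: "c \<alpha> - d \<alpha> \<in> K" for \<alpha>
    proof -
      have "c \<alpha> + - d \<alpha> \<in> K"
        using c(3) kK dK subring_add[OF subfield_subring[OF K]] subring_uminus[OF subfield_subring[OF K]] by blast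
      then show ?thesis by simp
    qed
    have "c \<alpha> = 0" if "\<alpha> \<in> M" for \<alpha>
    proof -
      have "c \<alpha> - d \<alpha> = 0"
        by (rule alg_indepD[OF S(2) _ _ cdK 0]) (use c d that in auto)
      then have "c \<alpha> = d \<alpha>" by simp
      then show ?thesis using k_span_J[of "c \<alpha>"] c(3) d(3) by metis
    qed
    then show ?thesis using c(5) by simp
  qed
  \<comment> \<open>Fractions with denominators from k[S], so that every ring containing P inverts
    the nonzero homogeneous elements of k[S].\<close>
  define P where "P = {r * (t * hinv u) | r t u. r \<in> R \<inter> H \<and> t \<in> A \<inter> H \<and> u \<in> A \<inter> U}"
  have PI: "r * (t * hinv u) \<in> P" if "r \<in> R" "r \<in> H" "t \<in> A" "t \<in> H" "u \<in> A" "u \<in> U" for r t u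
    using that unfolding P_def by blast
  have A1: "1 \<in> A" and R1: "1 \<in> R" using SA SR subring_1 by auto
  \<comment> \<open>Clearing denominators: if 1 were in the ideal generated by J, some nonzero u in
    k[S] would lie in m[S].\<close>
  have "\<exists>u\<in>A \<inter> U. x * u \<in> Z" if "x \<in> additive_span (products P J)" for x
    using that
  proof induction
    case zero
    then show ?case using A1 U_1 additive_span.zero by (auto simp: Z_def)
  next
    case (step h x)
    then obtain u where u: "u \<in> A" "u \<in> U" "x * u \<in> Z" by blast
    obtain b j where "h = b * j" "b \<in> P" and j: "j \<in> J" using products_E[OF step.hyps(1)] by blast
    then obtain r t v where h: "h = r * (t * hinv v) * j"
      and r: "r \<in> R" "r \<in> H" and t: "t \<in> A" "t \<in> H" and v: "v \<in> A" "v \<in> U" unfolding P_def by blast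
    have "j * r \<in> J" using J_mult j r by blast
    then have "j * r \<in> Z" unfolding Z_def
      using monomials_I[of "j * r" J "\<lambda>_. 0" S] by (auto intro: additive_span_base)
    then have "j * r * (t * u) \<in> Z" using ZA subring_mult[OF SA] t u by blast
    moreover have "h * (v * u) = j * r * (t * u)"
    proof -
      have "h * (v * u) = j * r * (t * u) * (v * hinv v)" by (simp add: h mult_ac)
      then show ?thesis using hinv[OF v(2)] by simp
    qed
    moreover have "x * (v * u) \<in> Z" using ZA[OF u(3) v(1)] by (simp add: mult_ac)
    ultimately have "(h + x) * (v * u) \<in> Z" unfolding Z_def by (simp add: distrib_right additive_span_add)
    then show ?case using u v subring_mult[OF SA] U_mult by blast
  qed
  then have one: "1 \<notin> additive_span (products P J)"
    using AZ by (force simp: units_iff)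
  have JP: "J \<subseteq> P"
    using PI[of _ 1 1] JR A1 U_1 by auto
  have PH: "P \<subseteq> H"
  proof
    fix x assume "x \<in> P"
    then obtain r t u where "x = r * (t * hinv u)" "r \<in> H" "t \<in> H" "u \<in> U" unfolding P_def by blast
    then show "x \<in> H" using homog_mult hinv_U units_iff by metis
  qed
  have Pm: "x * y \<in> P" if xP: "x \<in> P" and yP: "y \<in> P" for x y
  proof -
    obtain r t u where x: "x = r * (t * hinv u)" "r \<in> R" "r \<in> H" "t \<in> A" "t \<in> H" "u \<in> A" "u \<in> U"
      using xP unfolding P_def by blast
    obtain r' t' u' where y: "y = r' * (t' * hinv u')" "r' \<in> R" "r' \<in> H" "t' \<in> A" "t' \<in> H" "u' \<in> A" "u' \<in> U"
      using yP unfolding P_def by blast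
    have "x * y = (r * r') * ((t * t') * hinv (u * u'))"
      using x y by (simp add: hinv_mult mult_ac)
    moreover have "(r * r') * ((t * t') * hinv (u * u')) \<in> P"
      by (rule PI) (use x y subring_mult[OF SR] subring_mult[OF SA] homog_mult U_mult in blast)+
    ultimately show ?thesis by simp
  qed
  have Pu: "- x \<in> P" if xP: "x \<in> P" for x
  proof -
    obtain r t u where x: "x = r * (t * hinv u)" "r \<in> R" "r \<in> H" "t \<in> A" "t \<in> H" "u \<in> A" "u \<in> U"
      using xP unfolding P_def by blast
    have "(- r) * (t * hinv u) \<in> P"
      by (rule PI) (use x subring_uminus[OF SR] homog_uminus in blast)+
    then show ?thesis using x by simp
  qed
  have P1: "1 \<in> P" using PI[of 1 1 1] R1 A1 by simp
  obtain W where W: "valring UNIV W" "P \<subseteq> W" "J \<subseteq> nonunits UNIV W"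
    by (rule valring_exists[OF PH P1 Pm Pu JP one])
  show thesis
  proof (rule that[OF W(1)])
    show "nonunits K R \<subseteq> nonunits UNIV W" using W(3) by (simp add: J_def)
    fix u assume "u \<in> additive_span (monomials (k \<inter> H) S)" and u: "u \<in> U"
    then have uA: "u \<in> A" by (simp add: A_def)
    show "u \<in> W \<and> hinv u \<in> W"
      using PI[of 1 u 1] PI[of 1 1 u] u uA A1 R1 W(2) by (auto simp: units_iff)
  qed
qed

lemma one_notin_span_nonunits_times:
  assumes k: "graded_subfield G D k" and K: "graded_subfield G D K" and kK: "k \<subseteq> K"
    and l: "graded_subfield G D l"
    and R: "valring K R" "k \<subseteq> R" and gp: "general_position G D k l K"
  shows "1 \<notin> additive_span (products (nonunits K R) (l \<inter> H))"
proof
  assume "1 \<in> additive_span (products (nonunits K R) (l \<inter> H))"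
  \<comment> \<open>Restricting to the finitely many elements of l in the given sum makes a maximal
    independent subset available by finiteness alone.\<close>
  moreover have "\<exists>E\<subseteq>l \<inter> H. finite E \<and> x \<in> additive_span (products (nonunits K R) E)"
    if "x \<in> additive_span (products (nonunits K R) (l \<inter> H))" for x
    using that
  proof induction
    case zero
    then show ?case using additive_span.zero by blast
  next
    case (step h x)
    then obtain E where E: "E \<subseteq> l \<inter> H" "finite E" "x \<in> additive_span (products (nonunits K R) E)" by blast
    obtain m a where h: "h = m * a" "m \<in> nonunits K R" "a \<in> l \<inter> H"
      using products_E[OF step.hyps(1)] by blast
    have "h + x \<in> additive_span (products (nonunits K R) (insert a E))"
    proof (rule additive_span.step)
      show "h \<in> products (nonunits K R) (insert a E)" using h by (auto intro: products_I)
      show "x \<in> additive_span (products (nonunits K R) (insert a E))"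
        using E(3) by (rule additive_span_mono) (auto simp: products_def)
    qed
    then show ?case using E h by (intro exI[of _ "insert a E"]) auto
  qed
  ultimately obtain E where E: "E \<subseteq> l \<inter> H" "finite E" "1 \<in> additive_span (products (nonunits K R) E)"
    by blast
  define \<S> where "\<S> = {S. S \<subseteq> E \<inter> U \<and> alg_indep k S}"
  have "finite \<S>" by (rule finite_subset[of _ "Pow E"]) (use E(2) in \<open>auto simp: \<S>_def\<close>)
  moreover have "\<S> \<noteq> {}" using alg_indep_empty by (auto simp: \<S>_def)
  ultimately obtain S where S: "S \<in> \<S>" "\<And>T. T \<in> \<S> \<Longrightarrow> S \<subseteq> T \<Longrightarrow> T = S"
    using finite_has_maximal[of \<S>] by metis
  have SU: "S \<subseteq> U" and Sk: "alg_indep k S" and finS: "finite S" and Sl: "S \<subseteq> units_h G D l"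
    using S(1) E(1,2) units_h_eq[of l] by (auto simp: \<S>_def alg_indep_iff)
  \<comment> \<open>General position enters here; it is what makes the Gauss extension over K
    possible.\<close>
  have SK: "alg_indep K S" using gp finS Sl Sk by (simp add: general_position_def)
  obtain W where W: "valring UNIV W" "nonunits K R \<subseteq> nonunits UNIV W"
    and unit: "\<And>u. u \<in> additive_span (monomials (k \<inter> H) S) \<Longrightarrow> u \<in> U \<Longrightarrow> u \<in> W \<and> hinv u \<in> W"
    by (rule gauss_extension[OF k K kK R SU SK]) blast
  have EW: "a \<in> W" if "a \<in> E" for a
  proof (cases "a = 0")
    case True
    then show ?thesis using subring_0[OF valring_subring[OF W(1)]] by simp
  next
    case False
    then have aU: "a \<in> U" using that E(1) by (auto simp: units_iff)
    show ?thesis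
    proof (cases "a \<in> S")
      case True
      \<comment> \<open>An element a of S is itself a monomial, with exponent 1 at a and 0
        elsewhere, so it is a unit of W.\<close>
      have "monomial S ((\<lambda>_. 0)(a := 1)) = (\<Prod>s\<in>S. if s = a then a else 1)"
        unfolding monomial_def by (rule prod.cong) auto
      also have "\<dots> = a" using finS True by simp
      finally have "1 * monomial S ((\<lambda>_. 0)(a := 1)) = a" by simp
      moreover have "(\<lambda>_. 0)(a := 1) \<in> exponents S" using True by (auto simp: exponents_def)
      ultimately have "a \<in> monomials (k \<inter> H) S"
        using monomials_I[of 1 "k \<inter> H" "(\<lambda>_. 0)(a := 1)" S] subring_1[OF subfield_subring[OF k]] by simp
      then show ?thesis using unit aU additive_span_base by blast
    next
      case F: False
      have "insert a S \<notin> \<S>" using S(2)[of "insert a S"] F by blast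
      then have "\<not> alg_indep k (insert a S)" using S(1) that aU by (auto simp: \<S>_def)
      then show ?thesis using valring_contains_dependent[OF k SU Sk aU F _ W(1) unit] by blast
    qed
  qed
  have "products (nonunits K R) E \<subseteq> nonunits UNIV W"
    using nonunits_mult[OF subfield_UNIV W(1)] W(2) EW E(1) unfolding products_def by blast
  then have "1 \<in> additive_span (nonunits UNIV W)" using E(3) additive_span_mono by blast
  then show False using one_span_nonunits[OF subfield_UNIV W(1)] by blast
qed

text \<open>Chevalley's theorem is applied to the homogeneous products of R and l. The resulting W
  contains R and keeps m in its maximal ideal, which by \<open>valring_dominates\<close> forces its
  trace on K to be exactly R.\<close>

lemma extension_if_general_position:
  assumes k: "graded_subfield G D k" and K: "graded_subfield G D K" and kK: "k \<subseteq> K"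
    and l: "graded_subfield G D l"
    and R: "valring K R" "k \<subseteq> R" and gp: "general_position G D k l K"
  shows "\<exists>W. valring UNIV W \<and> l \<subseteq> W \<and> W \<inter> K = R"
proof -
  define P where "P = products (R \<inter> H) (l \<inter> H)"
  define J where "J = nonunits K R"
  note SR = valring_subring[OF R(1)] and Sl = subfield_subring[OF l]
  have PH: "P \<subseteq> H" by (auto simp: P_def products_def intro: homog_mult)
  have R1: "1 \<in> R" and l1: "1 \<in> l" using subring_1 SR Sl by auto
  have P1: "1 \<in> P" using products_I[of 1 "R \<inter> H" 1 "l \<inter> H"] R1 l1 by (simp add: P_def)
  have Pm: "x * y \<in> P" if xP: "x \<in> P" and yP: "y \<in> P" for x y
  proof -
    obtain r a where x: "x = r * a" "r \<in> R \<inter> H" "a \<in> l \<inter> H" using products_E[OF xP[unfolded P_def]] by blast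
    obtain r' a' where y: "y = r' * a'" "r' \<in> R \<inter> H" "a' \<in> l \<inter> H" using products_E[OF yP[unfolded P_def]] by blast
    have eq: "x * y = (r * r') * (a * a')" by (simp add: x y mult_ac)
    show ?thesis unfolding P_def eq
      using products_I[of "r * r'" "R \<inter> H" "a * a'" "l \<inter> H"] x y subring_mult[OF SR] subring_mult[OF Sl] homog_mult
      by auto
  qed
  have Pu: "- x \<in> P" if xP: "x \<in> P" for x
  proof -
    obtain r a where x: "x = r * a" "r \<in> R \<inter> H" "a \<in> l \<inter> H" using products_E[OF xP[unfolded P_def]] by blast
    then show ?thesis unfolding P_def
      using products_I[of "- r" "R \<inter> H" a "l \<inter> H"] subring_uminus[OF SR] homog_uminus by auto
  qed
  have RP: "R \<inter> H \<subseteq> P" using products_I[of _ "R \<inter> H" 1 "l \<inter> H"] l1 by (auto simp: P_def)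
  have lP: "l \<inter> H \<subseteq> P" using products_I[of 1 "R \<inter> H" _ "l \<inter> H"] R1 by (auto simp: P_def)
  have JP: "J \<subseteq> P" using RP nonunits_subset[OF R(1)] nonunits_homog[of K R] by (auto simp: J_def)
  \<comment> \<open>Since m absorbs homogeneous elements of R, the ideal it generates in R l is
    already m l.\<close>
  have "products P J \<subseteq> products J (l \<inter> H)"
  proof
    fix x assume "x \<in> products P J"
    then obtain p j where p: "x = p * j" "p \<in> P" and j: "j \<in> J" by (rule products_E)
    obtain r a where x: "x = r * a * j" "r \<in> R \<inter> H" "a \<in> l \<inter> H"
      using products_E[OF p(2)[unfolded P_def]] p(1) by blast
    have "j * r \<in> J" using nonunits_mult[OF K R(1)] j x by (auto simp: J_def)
    moreover have "x = (j * r) * a" by (simp add: x mult_ac)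
    ultimately show "x \<in> products J (l \<inter> H)" using x products_I by blast
  qed
  then have one: "1 \<notin> additive_span (products P J)"
    using one_notin_span_nonunits_times[OF k K kK l R gp] additive_span_mono by (auto simp: J_def)
  obtain W where W: "valring UNIV W" "P \<subseteq> W" "J \<subseteq> nonunits UNIV W"
    by (rule valring_exists[OF PH P1 Pm Pu JP one])
  note SW = valring_subring[OF W(1)]
  have "R \<subseteq> W" by (rule subring_subsetI[OF SR SW]) (use RP W(2) units_iff in blast)
  moreover have "l \<subseteq> W" by (rule subring_subsetI[OF Sl SW]) (use lP W(2) units_iff in blast)
  ultimately show ?thesis
    using valring_dominates[OF W(1) K R(1)] W by (auto simp: J_def)
qed

end

section \<open>General position from extendability\<close>

lemma additive_span_Un:
  assumes "x \<in> additive_span (A \<union> B)"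
  shows "\<exists>y\<in>additive_span A. \<exists>z\<in>additive_span B. x = y + z"
  using assms
proof induction
  case zero
  have "0 = 0 + (0::'a)" by simp
  then show ?case using additive_span.zero by blast
next
  case (step h x)
  then obtain y z where yz: "y \<in> additive_span A" "z \<in> additive_span B" "x = y + z" by blast
  from step.hyps(1) show ?case
  proof
    assume "h \<in> A"
    then have "h + y \<in> additive_span A" using yz(1) by (rule additive_span.step)
    moreover have "h + x = (h + y) + z" by (simp add: yz add.assoc)
    ultimately show ?thesis using yz(2) by blast
  next
    assume "h \<in> B"
    then have "h + z \<in> additive_span B" using yz(2) by (rule additive_span.step)
    moreover have "h + x = y + (h + z)" by (simp add: yz add.left_commute)
    ultimately show ?thesis using yz(1) by blast
  qed
qed

section \<open>Weights of exponents\<close>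

definition weight :: "'a set \<Rightarrow> ('a \<Rightarrow> nat) \<Rightarrow> ('a \<Rightarrow> nat) \<Rightarrow> nat" where
  "weight S w \<alpha> = (\<Sum>s\<in>S. w s * \<alpha> s)"

lemma weight_add: "weight S w (\<lambda>s. \<alpha> s + \<beta> s) = weight S w \<alpha> + weight S w \<beta>"
  by (simp add: weight_def algebra_simps sum.distrib)

text \<open>Positional notation: with a base N exceeding every exponent at a, the new variable gets
  weight 1 and the old weights are multiplied by N, so the exponent at a can be read off modulo
  N.\<close>

lemma separating_weights:
  assumes "finite S" "finite M"
  shows "\<exists>w. \<forall>\<alpha>\<in>M. \<forall>\<beta>\<in>M. weight S w \<alpha> = weight S w \<beta> \<longrightarrow> (\<forall>s\<in>S. \<alpha> s = \<beta> s)"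
  using assms(1)
proof (induction S rule: finite_induct)
  case empty
  then show ?case by simp
next
  case (insert a S)
  then obtain w where w: "\<forall>\<alpha>\<in>M. \<forall>\<beta>\<in>M. weight S w \<alpha> = weight S w \<beta> \<longrightarrow> (\<forall>s\<in>S. \<alpha> s = \<beta> s)" by blast
  define N where "N = Suc (Max ((\<lambda>\<alpha>. \<alpha> a) ` M))"
  have N: "\<alpha> a < N" if "\<alpha> \<in> M" for \<alpha>
    using that assms(2) by (auto simp: N_def less_Suc_eq_le intro: Max_ge)
  define w' where "w' = (\<lambda>s. if s = a then 1 else N * w s)"
  have w': "weight (insert a S) w' \<alpha> = \<alpha> a + N * weight S w \<alpha>" for \<alpha>
  proof -
    have "(\<Sum>s\<in>S. w' s * \<alpha> s) = (\<Sum>s\<in>S. N * (w s * \<alpha> s))"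
      by (rule sum.cong) (use insert.hyps in \<open>auto simp: w'_def\<close>)
    then show ?thesis using insert.hyps by (simp add: weight_def sum_distrib_left w'_def)
  qed
  have "\<forall>s\<in>insert a S. \<alpha> s = \<beta> s"
    if M: "\<alpha> \<in> M" "\<beta> \<in> M" and eq: "weight (insert a S) w' \<alpha> = weight (insert a S) w' \<beta>" for \<alpha> \<beta>
  proof -
    have e: "\<alpha> a + N * weight S w \<alpha> = \<beta> a + N * weight S w \<beta>" using eq by (simp add: w')
    have "(\<alpha> a + N * weight S w \<alpha>) mod N = (\<beta> a + N * weight S w \<beta>) mod N" using e by simp
    then have a: "\<alpha> a = \<beta> a" using N M by simp
    then have "weight S w \<alpha> = weight S w \<beta>" using e N[OF M(1)] by simp
    then show ?thesis using w M a by blast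
  qed
  then show ?case by blast
qed

context gr_field begin

section \<open>Minimal valuation rings and refinements\<close>

lemma minimal_valring:
  assumes k: "graded_subfield G D k" and K: "graded_subfield G D K" and kK: "k \<subseteq> K"
  obtains R where "valring K R" "k \<subseteq> R" "\<And>R'. valring K R' \<Longrightarrow> k \<subseteq> R' \<Longrightarrow> R' \<subseteq> R \<Longrightarrow> R' = R"
proof -
  \<comment> \<open>Zorn's lemma provides maximal sets under unions of chains, so rings are replaced
    by their complements and unions become intersections.\<close>
  define \<A> where "\<A> = {- R | R. valring K R \<and> k \<subseteq> R}"
  have "valring K K" using subfield_hinv[OF K] subfield_subring[OF K] by (simp add: valring_def)
  then have "- K \<in> \<A>" using kK by (auto simp: \<A>_def)
  then have ne: "\<A> \<noteq> {}" by blast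
  have "\<Union>C \<in> \<A>" if C: "C \<noteq> {}" "subset.chain \<A> C" for C
  proof -
    define \<R> where "\<R> = uminus ` C"
    have eq: "\<Union>C = - \<Inter>\<R>" by (auto simp: \<R>_def)
    have R: "valring K R" "k \<subseteq> R" if "R \<in> \<R>" for R
    proof -
      have "- R \<in> \<A>" using that C(2) by (auto simp: \<R>_def subset_chain_def)
      then show "valring K R" "k \<subseteq> R" by (auto simp: \<A>_def)
    qed
    have lin: "R \<subseteq> R' \<or> R' \<subseteq> R" if "R \<in> \<R>" "R' \<in> \<R>" for R R'
    proof -
      have "- R \<in> C" "- R' \<in> C" using that by (auto simp: \<R>_def)
      then have "- R \<subseteq> - R' \<or> - R' \<subseteq> - R" using C(2) unfolding subset_chain_def by blast
      then show ?thesis by auto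
    qed
    have ne': "\<R> \<noteq> {}" using C(1) by (simp add: \<R>_def)
    have "valring K (\<Inter>\<R>)"
      unfolding valring_def
    proof (intro conjI ballI)
      have "graded_subring G D R" if "R \<in> \<R>" for R using R(1)[OF that] valring_subring by blast
      then show "graded_subring G D (\<Inter>\<R>)" unfolding graded_subring_iff by blast
      show "\<Inter>\<R> \<subseteq> K" using ne' R(1) valring_subset by blast
      fix f assume f: "f \<in> K \<inter> U"
      show "f \<in> \<Inter>\<R> \<or> hinv f \<in> \<Inter>\<R>"
      proof (rule ccontr)
        assume "\<not> (f \<in> \<Inter>\<R> \<or> hinv f \<in> \<Inter>\<R>)"
        \<comment> \<open>The smaller of R and R' would contain neither f nor its inverse.\<close>
        then obtain R R' where RR: "R \<in> \<R>" "f \<notin> R" "R' \<in> \<R>" "hinv f \<notin> R'" by blast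
        then have "hinv f \<in> R" "f \<in> R'" using valring_cases R(1) f by blast+
        then show False using lin[OF RR(1,3)] RR by blast
      qed
    qed
    moreover have "k \<subseteq> \<Inter>\<R>" using R(2) by blast
    ultimately show ?thesis unfolding eq \<A>_def by blast
  qed
  then obtain X where X: "X \<in> \<A>" "\<And>Y. Y \<in> \<A> \<Longrightarrow> X \<subseteq> Y \<Longrightarrow> Y = X"
    using subset_Zorn_nonempty[OF ne] by blast
  then obtain R where R: "X = - R" "valring K R" "k \<subseteq> R" by (auto simp: \<A>_def)
  show thesis
  proof (rule that[OF R(2,3)])
    fix R' assume R': "valring K R'" "k \<subseteq> R'" "R' \<subseteq> R"
    then have "- R' = X" using X(2)[of "- R'"] R(1) by (auto simp: \<A>_def)
    then show "R' = R" using R(1) by simp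
  qed
qed

text \<open>A composite of valuations: the nonzero homogeneous elements of l are units of V, so k(S)
  is visible in the residue ring of V, where monomials can be ordered by weight. The composition is
  obtained from Chevalley's theorem with generators from k, from the products of k with monomial
  quotients of positive weight, and from m.\<close>

lemma monomial_quotient_refinement:
  fixes w :: "'a \<Rightarrow> nat"
  assumes k: "graded_subfield G D k" and l: "graded_subfield G D l" and kl: "k \<subseteq> l"
    and V: "valring UNIV V" "l \<subseteq> V" and S: "S \<subseteq> l" "S \<subseteq> U" "alg_indep k S"
  obtains W where "valring UNIV W" "k \<subseteq> W" "W \<subseteq> V"
    "\<And>\<alpha> \<beta>. \<alpha> \<in> exponents S \<Longrightarrow> \<beta> \<in> exponents S \<Longrightarrow> weight S w \<alpha> < weight S w \<beta> \<Longrightarrow>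
       monomial S \<beta> * hinv (monomial S \<alpha>) \<in> nonunits UNIV W"
proof -
  note kr = subfield_subring[OF k] and lr = subfield_subring[OF l] and Vr = valring_subring[OF V(1)]
  define Q where "Q = {monomial S \<beta> * hinv (monomial S \<alpha>) | \<alpha> \<beta>.
    \<alpha> \<in> exponents S \<and> \<beta> \<in> exponents S \<and> weight S w \<alpha> < weight S w \<beta>}"
  define m where "m = nonunits UNIV V"
  define N where "N = products (k \<inter> H) Q"
  define P where "P = (k \<inter> H) \<union> N \<union> m"
  define J where "J = Q \<union> m"
  have mU: "monomial S \<alpha> \<in> U" for \<alpha> by (rule monomial_U[OF S(2)])
  have ml: "monomial S \<alpha> \<in> l" "hinv (monomial S \<alpha>) \<in> l" for \<alpha>
    using monomial_subring[OF lr S(1)] subfield_hinv[OF l _ mU] by blast+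
  have Ql: "q \<in> l" "q \<in> U" if "q \<in> Q" for q
    using that ml mU subring_mult[OF lr] by (auto simp: Q_def)
  have QQ: "p * q \<in> Q" if pQ: "p \<in> Q" and qQ: "q \<in> Q" for p q
  proof -
    obtain \<alpha> \<beta> where p: "p = monomial S \<beta> * hinv (monomial S \<alpha>)" "\<alpha> \<in> exponents S" "\<beta> \<in> exponents S"
      "weight S w \<alpha> < weight S w \<beta>" using pQ unfolding Q_def by blast
    obtain \<alpha>' \<beta>' where q: "q = monomial S \<beta>' * hinv (monomial S \<alpha>')" "\<alpha>' \<in> exponents S" "\<beta>' \<in> exponents S"
      "weight S w \<alpha>' < weight S w \<beta>'" using qQ unfolding Q_def by blast
    have "p * q = monomial S (\<lambda>s. \<beta> s + \<beta>' s) * hinv (monomial S (\<lambda>s. \<alpha> s + \<alpha>' s))"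
      using mU by (simp add: p q monomial_add hinv_mult mult_ac)
    moreover have "weight S w (\<lambda>s. \<alpha> s + \<alpha>' s) < weight S w (\<lambda>s. \<beta> s + \<beta>' s)"
      using p q by (simp add: weight_add)
    ultimately show ?thesis using exponents_add p q unfolding Q_def by blast
  qed
  have NI: "c * q \<in> N" if "c \<in> k" "c \<in> H" "q \<in> Q" for c q using that by (auto simp: N_def intro: products_I)
  have NE: "\<exists>c q. x = c * q \<and> c \<in> k \<and> c \<in> H \<and> q \<in> Q" if "x \<in> N" for x
    using products_E[OF that[unfolded N_def]] by blast
  have Nl: "N \<subseteq> l" "N \<subseteq> H"
    using NE Ql kl subring_mult[OF lr] homog_mult units_iff by blast+
  have kN: "c * x \<in> N" if c: "c \<in> k \<inter> H" and x: "x \<in> N" for c x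
  proof -
    obtain b q where "x = b * q" "b \<in> k" "b \<in> H" "q \<in> Q" using NE[OF x] by blast
    then show ?thesis using NI[of "c * b" q] c subring_mult[OF kr] homog_mult by (simp add: mult.assoc)
  qed
  have NQ: "x * q \<in> N" if x: "x \<in> N" and q: "q \<in> Q" for x q
  proof -
    obtain b p where "x = b * p" "b \<in> k" "b \<in> H" "p \<in> Q" using NE[OF x] by blast
    then show ?thesis using NI[of b "p * q"] q QQ by (simp add: mult.assoc)
  qed
  have NN: "x * y \<in> N" if x: "x \<in> N" and y: "y \<in> N" for x y
  proof -
    obtain b q where b: "y = b * q" "b \<in> k" "b \<in> H" "q \<in> Q" using NE[OF y] by blast
    have "b * (x * q) \<in> N" using kN NQ x b by blast
    then show ?thesis by (simp add: b mult_ac)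
  qed
  have mm: "x * y \<in> m" "y * x \<in> m" if "x \<in> m" "y \<in> V" "y \<in> H" for x y
    using nonunits_mult[OF subfield_UNIV V(1)] that by (auto simp: m_def mult.commute)
  have mV: "m \<subseteq> V" "m \<subseteq> H" using nonunits_subset[OF V(1)] nonunits_homog by (auto simp: m_def)
  have PV: "P \<subseteq> V" and PH: "P \<subseteq> H" using Nl V(2) kl mV by (auto simp: P_def)
  have P1: "1 \<in> P" using subring_1[OF kr] by (simp add: P_def)
  have Pm: "x * y \<in> P" if xP: "x \<in> P" and yP: "y \<in> P" for x y
  proof -
    have xy: "x \<in> V" "x \<in> H" "y \<in> V" "y \<in> H" using xP yP PV PH by auto
    consider "x \<in> m" | "y \<in> m" | "x \<in> k \<inter> H" "y \<in> k \<inter> H" | "x \<in> k \<inter> H" "y \<in> N"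
      | "x \<in> N" "y \<in> k \<inter> H" | "x \<in> N" "y \<in> N" using xP yP by (auto simp: P_def)
    then show ?thesis
    proof cases
      case 1
      then show ?thesis using mm(1)[of x y] xy by (simp add: P_def)
    next
      case 2
      then show ?thesis using mm(2)[of y x] xy by (simp add: P_def)
    next
      case 3
      then show ?thesis using subring_mult[OF kr] homog_mult by (auto simp: P_def)
    next
      case 4
      then show ?thesis using kN by (auto simp: P_def)
    next
      case 5
      then show ?thesis using kN[of y x] by (simp add: P_def mult.commute)
    next
      case 6
      then show ?thesis using NN by (auto simp: P_def)
    qed
  qed
  have "-1 \<in> P" using subring_1[OF kr] subring_uminus[OF kr] homog_uminus by (simp add: P_def)
  then have Pu: "- x \<in> P" if "x \<in> P" for x using Pm[of "-1" x] that by simp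
  have QN: "Q \<subseteq> N" using NI[of 1] subring_1[OF kr] by auto
  then have JP: "J \<subseteq> P" by (auto simp: J_def P_def)
  have PJ: "products P J \<subseteq> N \<union> m"
  proof
    fix x assume "x \<in> products P J"
    then obtain p j where x: "x = p * j" "p \<in> P" "j \<in> J" by (rule products_E)
    have pj: "p \<in> V" "p \<in> H" "j \<in> V" "j \<in> H" using x JP PV PH by auto
    consider "j \<in> m" | "p \<in> m" | "j \<in> Q" "p \<in> k \<inter> H" | "j \<in> Q" "p \<in> N" using x by (auto simp: J_def P_def)
    then show "x \<in> N \<union> m"
    proof cases
      case 1
      then show ?thesis using mm(2)[of j p] x pj by simp
    next
      case 2
      then show ?thesis using mm(1)[of p j] x pj by simp
    next
      case 3
      then show ?thesis using kN QN x by auto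
    next
      case 4
      then show ?thesis using NQ x by auto
    qed
  qed
  \<comment> \<open>Multiplication by a common denominator, with exponent \<gamma>, turns an element
    of the span of N into a polynomial over k all of whose terms are heavier than \<gamma>.\<close>
  have clear: "\<exists>\<gamma>\<in>exponents S. y * monomial S \<gamma> \<in>
      additive_span {c * monomial S \<beta> | c \<beta>. c \<in> k \<and> \<beta> \<in> {\<beta> \<in> exponents S. weight S w \<gamma> < weight S w \<beta>}}"
    if "y \<in> additive_span N" for y
    using that
  proof induction
    case zero
    then show ?case using exponents_zero[of S] additive_span.zero by (metis (no_types, lifting) mult_zero_left)
  next
    case (step h y)
    then obtain \<gamma> where g: "\<gamma> \<in> exponents S" "y * monomial S \<gamma> \<in>
      additive_span {c * monomial S \<beta> | c \<beta>. c \<in> k \<and> \<beta> \<in> {\<beta> \<in> exponents S. weight S w \<gamma> < weight S w \<beta>}}"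
      by blast
    obtain c q where "h = c * q" and c: "c \<in> k" and "q \<in> Q" using NE[OF step.hyps(1)] by blast
    then obtain \<alpha> \<beta> where h: "h = c * (monomial S \<beta> * hinv (monomial S \<alpha>))"
      and ab: "\<alpha> \<in> exponents S" "\<beta> \<in> exponents S" "weight S w \<alpha> < weight S w \<beta>"
      unfolding Q_def by blast
    let ?\<delta> = "\<lambda>s. \<alpha> s + \<gamma> s"
    let ?T = "{c * monomial S \<beta> | c \<beta>. c \<in> k \<and> \<beta> \<in> {\<beta> \<in> exponents S. weight S w ?\<delta> < weight S w \<beta>}}"
    have "h * monomial S ?\<delta> = c * (monomial S \<beta> * monomial S \<gamma>) * (monomial S \<alpha> * hinv (monomial S \<alpha>))"
      by (simp add: h monomial_add mult_ac)
    then have "h * monomial S ?\<delta> = c * monomial S (\<lambda>s. \<beta> s + \<gamma> s)"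
      using hinv[OF mU] by (simp add: monomial_add)
    moreover have "(\<lambda>s. \<beta> s + \<gamma> s) \<in> {\<beta> \<in> exponents S. weight S w ?\<delta> < weight S w \<beta>}"
      using ab g(1) exponents_add by (simp add: weight_add)
    ultimately have 1: "h * monomial S ?\<delta> \<in> ?T" using c by blast
    have 2: "y * monomial S \<gamma> * monomial S \<alpha> \<in> additive_span ?T"
    proof (rule additive_span_times[OF g(2)])
      fix x assume "x \<in> {c * monomial S \<beta> | c \<beta>. c \<in> k \<and> \<beta> \<in> {\<beta> \<in> exponents S. weight S w \<gamma> < weight S w \<beta>}}"
      then obtain b \<epsilon> where x: "x = b * monomial S \<epsilon>" "b \<in> k" "\<epsilon> \<in> exponents S" "weight S w \<gamma> < weight S w \<epsilon>" by blast
      have "x * monomial S \<alpha> = b * monomial S (\<lambda>s. \<alpha> s + \<epsilon> s)" by (simp add: x monomial_add mult_ac)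
      moreover have "(\<lambda>s. \<alpha> s + \<epsilon> s) \<in> {\<beta> \<in> exponents S. weight S w ?\<delta> < weight S w \<beta>}"
        using ab x exponents_add by (simp add: weight_add)
      ultimately have "x * monomial S \<alpha> \<in> ?T" using x(2) by blast
      then show "x * monomial S \<alpha> \<in> additive_span ?T" by (rule additive_span_base)
    qed
    have "(h + y) * monomial S ?\<delta> = h * monomial S ?\<delta> + y * monomial S \<gamma> * monomial S \<alpha>"
      by (simp add: monomial_add algebra_simps)
    then have "(h + y) * monomial S ?\<delta> \<in> additive_span ?T" using additive_span.step[OF 1 2] by simp
    then show ?case using exponents_add[OF ab(1) g(1)] by blast
  qed
  have N1: "1 \<notin> additive_span N"
  proof
    assume "1 \<in> additive_span N"
    from clear[OF this] obtain \<gamma> where g: "\<gamma> \<in> exponents S" "monomial S \<gamma> \<in>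
      additive_span {c * monomial S \<beta> | c \<beta>. c \<in> k \<and> \<beta> \<in> {\<beta> \<in> exponents S. weight S w \<gamma> < weight S w \<beta>}}"
      by auto
    from sum_monomials[OF g(2) subring_0[OF kr] subring_add[OF kr]]
    obtain M c where M: "finite M" "M \<subseteq> {\<beta> \<in> exponents S. weight S w \<gamma> < weight S w \<beta>}" "\<forall>\<alpha>. c \<alpha> \<in> k"
      "monomial S \<gamma> = (\<Sum>\<alpha>\<in>M. c \<alpha> * monomial S \<alpha>)" by blast
    \<comment> \<open>A monomial equal to a combination of strictly heavier ones: \<gamma> is not in
      M because of its weight, so the coefficient -1 there yields a nontrivial relation over
      k.\<close>
    define c' where "c' = c(\<gamma> := -1)"
    have gM: "\<gamma> \<notin> M" using M(2) by auto
    have "(\<Sum>\<alpha>\<in>M. c' \<alpha> * monomial S \<alpha>) = monomial S \<gamma>"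
      unfolding M(4) by (rule sum.cong) (use gM in \<open>auto simp: c'_def\<close>)
    then have "(\<Sum>\<alpha>\<in>insert \<gamma> M. c' \<alpha> * monomial S \<alpha>) = 0"
      using gM M(1) by (simp add: c'_def)
    then have "c' \<gamma> = 0"
      by (intro alg_indepD[OF S(3), of "insert \<gamma> M" c'])
        (use M g(1) subring_1[OF kr] subring_uminus[OF kr] in \<open>auto simp: c'_def\<close>)
    then show False using zero_neq_one by (simp add: c'_def)
  qed
  have one: "1 \<notin> additive_span (products P J)"
  proof
    assume "1 \<in> additive_span (products P J)"
    then have "1 \<in> additive_span (N \<union> m)" using PJ by (rule additive_span_mono)
    from additive_span_Un[OF this] obtain y z where yz: "y \<in> additive_span N" "z \<in> additive_span m" "1 = y + z"
      by blast
    \<comment> \<open>In degree one the contribution z of m equals 1 minus an element of l, so it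
      lies in l. A nonzero homogeneous element of l is a unit of V; hence the contribution vanishes,
      and 1 would lie in the span of N alone.\<close>
    have 1: "component y \<one> + component z \<one> = 1"
      using component_homog[OF one_closed one_D, of \<one>] component_add[of y z \<one>] yz(3) by simp
    have z: "component z \<one> \<in> m" using component_span_nonunits[OF subfield_UNIV V(1)] yz(2) by (simp add: m_def)
    have y: "component y \<one> \<in> additive_span N"
      using component_span[OF yz(1) Nl(2) one_closed] by (rule additive_span_mono) auto
    then have "component y \<one> \<in> l" using span_least_subring[OF lr Nl(1)] by blast
    then have "1 + - component y \<one> \<in> l" using subring_add[OF lr] subring_1[OF lr] subring_uminus[OF lr] by blast
    moreover have "1 + - component y \<one> = component z \<one>" using 1 by (simp add: algebra_simps)
    ultimately have zl: "component z \<one> \<in> l" by simp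
    have "component z \<one> = 0"
    proof (rule ccontr)
      assume ne: "component z \<one> \<noteq> 0"
      then have "hinv (component z \<one>) \<in> l"
        using subfield_hinv[OF l zl] component_in_homog by (simp add: units_iff)
      then show False using z ne V(2) by (auto simp: m_def nonunits_def)
    qed
    then show False using 1 y N1 by simp
  qed
  obtain W where W: "valring UNIV W" "P \<subseteq> W" "J \<subseteq> nonunits UNIV W"
    by (rule valring_exists[OF PH P1 Pm Pu JP one])
  show thesis
  proof (rule that[OF W(1)])
    show "k \<subseteq> W"
      by (rule subring_subsetI[OF kr valring_subring[OF W(1)]])
        (use W(2) in \<open>auto simp: P_def units_iff\<close>)
    show "W \<subseteq> V"
    \<comment> \<open>An element of W outside V would have its inverse in m, which lies in the
      maximal ideal of W.\<close>
    proof (rule subring_subsetI[OF valring_subring[OF W(1)] Vr], rule ccontr)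
      fix x assume x: "x \<in> W" "x \<in> U" "x \<notin> V"
      then have "hinv x \<in> m" using hinv_U[OF x(2)] by (simp add: m_def nonunits_def units_iff)
      then have "hinv x \<in> nonunits UNIV W" using W(3) by (auto simp: J_def)
      then show False using x hinv_U[OF x(2)] by (auto simp: nonunits_def units_iff)
    qed
    fix \<alpha> \<beta> assume "\<alpha> \<in> exponents S" "\<beta> \<in> exponents S" "weight S w \<alpha> < weight S w \<beta>"
    then have "monomial S \<beta> * hinv (monomial S \<alpha>) \<in> Q" unfolding Q_def by blast
    then show "monomial S \<beta> * hinv (monomial S \<alpha>) \<in> nonunits UNIV W" using W(3) by (auto simp: J_def)
  qed
qed

lemma general_position_if_extension:
  assumes k: "graded_subfield G D k" and K: "graded_subfield G D K" and l: "graded_subfield G D l"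
    and kK: "k \<subseteq> K" and kl: "k \<subseteq> l"
    and ext: "\<And>R. valring K R \<Longrightarrow> k \<subseteq> R \<Longrightarrow> \<exists>V. valring UNIV V \<and> l \<subseteq> V \<and> V \<inter> K = R"
  shows "general_position G D k l K"
  unfolding general_position_def
proof (intro allI impI, rule ccontr)
  fix S assume S': "finite S \<and> S \<subseteq> units_h G D l \<and> alg_indep k S" and nK: "\<not> alg_indep K S"
  then have S: "finite S" "S \<subseteq> l" "S \<subseteq> U" "alg_indep k S" using units_h_eq[of l] by auto
  note Kr = subfield_subring[OF K] and lr = subfield_subring[OF l]
  obtain M c \<alpha>0 where M: "finite M" "M \<subseteq> exponents S" "\<forall>\<alpha>\<in>M. c \<alpha> \<in> K"
    "(\<Sum>\<alpha>\<in>M. c \<alpha> * monomial S \<alpha>) = 0" "\<alpha>0 \<in> M" "c \<alpha>0 \<noteq> 0"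
    using nK S(1) unfolding alg_indep_iff by auto
  have mU: "monomial S \<alpha> \<in> U" for \<alpha> by (rule monomial_U[OF S(3)])
  have ml: "monomial S \<alpha> \<in> l" "hinv (monomial S \<alpha>) \<in> l" for \<alpha>
    using monomial_subring[OF lr S(2)] subfield_hinv[OF l _ mU] by blast+
  obtain q g where q: "g \<in> carrier G" "\<And>\<alpha>. \<exists>h. q \<alpha> = component (c \<alpha>) h"
    "\<And>\<alpha>. \<alpha> \<in> M \<Longrightarrow> q \<alpha> * monomial S \<alpha> \<in> D g" "(\<Sum>\<alpha>\<in>M. q \<alpha> * monomial S \<alpha>) = 0" "q \<alpha>0 \<noteq> 0"
    by (rule homogenize_relation[where y = "monomial S" and p = c and j = \<alpha>0, OF M(1) mU M(4,5,6)]) blast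
  define M' where "M' = {\<alpha> \<in> M. q \<alpha> \<noteq> 0}"
  have qK: "q \<alpha> \<in> K" "q \<alpha> \<in> U" if "\<alpha> \<in> M'" for \<alpha>
    using that q(2)[of \<alpha>] subring_component[OF Kr] M(3) component_in_homog by (auto simp: M'_def units_iff)
  obtain R where R: "valring K R" "k \<subseteq> R" "\<And>R'. valring K R' \<Longrightarrow> k \<subseteq> R' \<Longrightarrow> R' \<subseteq> R \<Longrightarrow> R' = R"
    by (rule minimal_valring[OF k K kK]) blast
  obtain V where V: "valring UNIV V" "l \<subseteq> V" "V \<inter> K = R" using ext[OF R(1,2)] by blast
  obtain w where w: "\<forall>\<alpha>\<in>M. \<forall>\<beta>\<in>M. weight S w \<alpha> = weight S w \<beta> \<longrightarrow> (\<forall>s\<in>S. \<alpha> s = \<beta> s)"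
    using separating_weights[OF S(1) M(1)] by blast
  obtain W where W: "valring UNIV W" "k \<subseteq> W" "W \<subseteq> V"
    "\<And>\<alpha> \<beta>. \<alpha> \<in> exponents S \<Longrightarrow> \<beta> \<in> exponents S \<Longrightarrow> weight S w \<alpha> < weight S w \<beta> \<Longrightarrow>
       monomial S \<beta> * hinv (monomial S \<alpha>) \<in> nonunits UNIV W"
    by (rule monomial_quotient_refinement[OF k l kl V(1,2) S(2-4), of w]) blast
  have "W \<inter> K = R"
    by (rule R(3)[OF valring_restrict[OF W(1) K]]) (use W V kK in auto)
  then have RW: "R \<subseteq> W" by blast
  have "finite (q ` M')" "q ` M' \<noteq> {}" "q ` M' \<subseteq> K \<inter> U" using M(1,5) q(5) qK by (auto simp: M'_def)
  \<comment> \<open>Dividing by the coefficient of largest value puts all scaled coefficients into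
    R, and the one at \<alpha>1 becomes 1.\<close>
  from valring_max[OF K R(1) this] obtain \<alpha>1 where a1: "\<alpha>1 \<in> M'" "\<forall>\<alpha>\<in>M'. q \<alpha> * hinv (q \<alpha>1) \<in> R"
    by blast
  define d where "d \<alpha> = q \<alpha> * hinv (q \<alpha>1)" for \<alpha>
  have dU: "d \<alpha> \<in> U" "d \<alpha> \<in> R" "d \<alpha> \<in> K" if "\<alpha> \<in> M'" for \<alpha>
    using that qK a1 valring_subset[OF R(1)] by (auto simp: d_def)
  \<comment> \<open>The exponents whose scaled coefficient is a unit of R. Among these the weight
    alone decides, and the lowest weight dominates.\<close>
  define M1 where "M1 = {\<alpha> \<in> M'. hinv (d \<alpha>) \<in> R}"
  have "\<alpha>1 \<in> M1" using a1 hinv[OF qK(2)[OF a1(1)]] subring_1[OF valring_subring[OF R(1)]] by (simp add: M1_def d_def)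
  moreover have "finite M1" using M(1) by (simp add: M1_def M'_def)
  ultimately obtain \<alpha>2 where a2: "\<alpha>2 \<in> M1" "\<forall>\<alpha>\<in>M1. weight S w \<alpha>2 \<le> weight S w \<alpha>"
    using ex_min_if_finite[of "weight S w ` M1"] by (metis (no_types, lifting) arg_min_if_finite(1,2) empty_iff linorder_not_less)
  then have a2': "\<alpha>2 \<in> M'" "\<alpha>2 \<in> M" "hinv (d \<alpha>2) \<in> R" "q \<alpha>2 \<in> U" using qK by (auto simp: M1_def M'_def)
  show False
  proof (rule no_dominant_term[OF W(1) M(1) q(1,4,3) a2'(2)])
    show "q \<alpha>2 * monomial S \<alpha>2 \<noteq> 0" using U_mult[OF a2'(4) mU] by (simp add: units_iff)
    fix \<alpha> assume a: "\<alpha> \<in> M" "\<alpha> \<noteq> \<alpha>2"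
    show "q \<alpha> * monomial S \<alpha> * hinv (q \<alpha>2 * monomial S \<alpha>2) \<in> nonunits UNIV W"
    proof (cases "q \<alpha> = 0")
      case True
      then show ?thesis using nonunits_0[OF subfield_UNIV] by simp
    next
      case False
      then have aM': "\<alpha> \<in> M'" using a by (simp add: M'_def)
      let ?r = "monomial S \<alpha> * hinv (monomial S \<alpha>2)"
      have rl: "?r \<in> l" using ml subring_mult[OF lr] by blast
      have d2: "d \<alpha> * hinv (d \<alpha>2) = q \<alpha> * hinv (q \<alpha>2) * (q \<alpha>1 * hinv (q \<alpha>1))"
        using qK[OF a1(1)] a2'(4) by (simp add: d_def hinv_mult mult_ac)
      then have eq: "q \<alpha> * monomial S \<alpha> * hinv (q \<alpha>2 * monomial S \<alpha>2) = (d \<alpha> * hinv (d \<alpha>2)) * ?r"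
        using hinv[OF qK(2)[OF a1(1)]] a2'(4) mU by (simp add: hinv_mult mult_ac)
      show ?thesis
      proof (cases "\<alpha> \<in> M1")
        case True
        \<comment> \<open>Separation gives equality of exponents on S only; outside S both
          vanish.\<close>
        have "weight S w \<alpha>2 \<noteq> weight S w \<alpha>"
        proof
          assume "weight S w \<alpha>2 = weight S w \<alpha>"
          then have "\<forall>s\<in>S. \<alpha>2 s = \<alpha> s" using w a2'(2) a(1) by blast
          moreover have "\<alpha>2 \<in> exponents S" "\<alpha> \<in> exponents S" using M(2) a2'(2) a(1) by auto
          then have "\<forall>s. s \<notin> S \<longrightarrow> \<alpha>2 s = \<alpha> s" by (simp add: exponents_def)
          ultimately have "\<alpha>2 s = \<alpha> s" for s by blast
          then have "\<alpha>2 = \<alpha>" by (simp add: fun_eq_iff)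
          then show False using a(2) by simp
        qed
        then have "weight S w \<alpha>2 < weight S w \<alpha>" using a2(2) True by (simp add: order_less_le)
        then have "?r \<in> nonunits UNIV W" using W(4) M(2) a2'(2) a(1) by blast
        moreover have "d \<alpha> * hinv (d \<alpha>2) \<in> W"
          using dU(2)[OF aM'] a2'(3) RW subring_mult[OF valring_subring[OF W(1)]] by blast
        moreover have "d \<alpha> * hinv (d \<alpha>2) \<in> H" using dU(1)[OF aM'] dU(1)[OF a2'(1)] by (intro U_homog) simp
        ultimately have "?r * (d \<alpha> * hinv (d \<alpha>2)) \<in> nonunits UNIV W"
          using nonunits_mult[OF subfield_UNIV W(1)] by blast
        then show ?thesis unfolding eq by (simp add: mult.commute)
      next
        case notM1: False
        \<comment> \<open>The weight of \<alpha> may be smaller here, so the monomial quotient need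
          not lie in W. It does lie in l, hence in the coarser ring V, and there the nonunit
          coefficient makes the product a nonunit; nonunits of V are nonunits of W.\<close>
        have "hinv (d \<alpha>) \<notin> V"
          using notM1 aM' V(3) subfield_hinv[OF K dU(3)[OF aM'] dU(1)[OF aM']] by (auto simp: M1_def)
        then have "d \<alpha> \<in> nonunits UNIV V" using dU(1)[OF aM'] by (simp add: nonunits_def units_iff)
        moreover have "hinv (d \<alpha>2) * ?r \<in> V"
          using a2'(3) V(2,3) rl subring_mult[OF valring_subring[OF V(1)]] by blast
        moreover have "hinv (d \<alpha>2) * ?r \<in> H" using dU(1)[OF a2'(1)] mU by (intro U_homog) simp
        ultimately have "d \<alpha> * (hinv (d \<alpha>2) * ?r) \<in> nonunits UNIV V"
          using nonunits_mult[OF subfield_UNIV V(1)] by blast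
        then have "d \<alpha> * (hinv (d \<alpha>2) * ?r) \<in> nonunits UNIV W" using W(3) by (auto simp: nonunits_def)
        then show ?thesis unfolding eq by (simp add: mult.assoc)
      qed
    qed
  qed auto
qed

end

section \<open>Finite fibres and torsion extensions\<close>

context gr_field begin

section \<open>Linear dependence over a graded subfield\<close>

lemma homogeneous_system_solution:
  assumes K: "graded_subfield G D K" and "finite B"
  shows "finite I \<Longrightarrow> card B < card I \<Longrightarrow> (\<And>i. i \<in> I \<Longrightarrow> \<gamma> i \<in> carrier G) \<Longrightarrow>
    (\<And>b. b \<in> B \<Longrightarrow> \<delta> b \<in> carrier G) \<Longrightarrow>
    (\<And>i b. i \<in> I \<Longrightarrow> b \<in> B \<Longrightarrow> a i b \<in> K \<and> a i b \<in> D (\<gamma> i \<otimes> inv (\<delta> b))) \<Longrightarrow>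
    \<exists>c. (\<forall>i\<in>I. c i \<in> K) \<and> (\<exists>i\<in>I. c i \<noteq> 0) \<and> (\<forall>b\<in>B. (\<Sum>i\<in>I. c i * a i b) = 0)"
  using assms(2)
proof (induction B arbitrary: I a rule: finite_induct)
  case empty
  then obtain i where "i \<in> I" by fastforce
  then show ?case using zero_neq_one subring_1[OF subfield_subring[OF K]] by (intro exI[of _ "\<lambda>_. 1"]) auto
next
  case (insert b0 B)
  note Kr = subfield_subring[OF K]
  show ?case
  proof (cases "\<forall>i\<in>I. a i b0 = 0")
    case True
    have "\<exists>c. (\<forall>i\<in>I. c i \<in> K) \<and> (\<exists>i\<in>I. c i \<noteq> 0) \<and> (\<forall>b\<in>B. (\<Sum>i\<in>I. c i * a i b) = 0)"
      by (rule insert.IH) (use insert.prems insert.hyps in auto)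
    then obtain c where "\<forall>i\<in>I. c i \<in> K" "\<exists>i\<in>I. c i \<noteq> 0" "\<forall>b\<in>B. (\<Sum>i\<in>I. c i * a i b) = 0" by blast
    then show ?thesis using True by (intro exI[of _ c]) simp
  next
    case False
    then obtain i0 where i0: "i0 \<in> I" "a i0 b0 \<noteq> 0" by blast
    have carI: "\<gamma> i \<in> carrier G" if "i \<in> I" for i using insert.prems(3) that by blast
    have carB: "\<delta> b \<in> carrier G" if "b \<in> insert b0 B" for b using insert.prems(4) that by blast
    have aK: "a i b \<in> K" and aD: "a i b \<in> D (\<gamma> i \<otimes> inv (\<delta> b))" if "i \<in> I" "b \<in> insert b0 B" for i b
      using insert.prems(5) that by blast+
    have car: "\<gamma> i \<otimes> inv (\<delta> b) \<in> carrier G" if "i \<in> I" "b \<in> insert b0 B" for i b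
      using carI carB that by simp
    have b0: "b0 \<in> insert b0 B" by simp
    have pU: "a i0 b0 \<in> U" using i0 aD[OF i0(1) b0] car[OF i0(1) b0] by (auto simp: units_iff intro: homogI)
    define p where "p = hinv (a i0 b0)"
    have pK: "p \<in> K" using subfield_hinv[OF K aK[OF i0(1) b0] pU] by (simp add: p_def)
    have pD: "p \<in> D (inv (\<gamma> i0 \<otimes> inv (\<delta> b0)))"
      unfolding p_def by (rule hinv_D[OF pU car[OF i0(1) b0] aD[OF i0(1) b0]])
    \<comment> \<open>Gaussian elimination with pivot \<open>a i0 b0\<close>. Homogeneity makes the
      pivot invertible, and the degree pattern \<open>\<gamma> i \<otimes> inv (\<delta> b)\<close>
      is preserved by the elimination, so later pivots are homogeneous as well.\<close>
    define a' where "a' i b = a i b - a i b0 * p * a i0 b" for i b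
    define I' where "I' = I - {i0}"
    have "\<exists>c. (\<forall>i\<in>I'. c i \<in> K) \<and> (\<exists>i\<in>I'. c i \<noteq> 0) \<and> (\<forall>b\<in>B. (\<Sum>i\<in>I'. c i * a' i b) = 0)"
    proof (rule insert.IH)
      show "finite I'" "card B < card I'" using insert.prems(1,2) insert.hyps i0(1) by (auto simp: I'_def)
      show "\<gamma> i \<in> carrier G" if "i \<in> I'" for i using that carI by (simp add: I'_def)
      show "\<delta> b \<in> carrier G" if "b \<in> B" for b using that carB by simp
      show "a' i b \<in> K \<and> a' i b \<in> D (\<gamma> i \<otimes> inv (\<delta> b))" if ib: "i \<in> I'" "b \<in> B" for i b
      proof
        have i: "i \<in> I" and b: "b \<in> insert b0 B" using ib by (auto simp: I'_def)
        have "a i b + - (a i b0 * p * a i0 b) \<in> K"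
          using aK[OF i b] aK[OF i b0] aK[OF i0(1) b] pK Kr by (intro subring_add subring_uminus subring_mult)
        then show "a' i b \<in> K" by (simp add: a'_def)
        have "a i b0 * p * a i0 b \<in>
            D (((\<gamma> i \<otimes> inv (\<delta> b0)) \<otimes> inv (\<gamma> i0 \<otimes> inv (\<delta> b0))) \<otimes> (\<gamma> i0 \<otimes> inv (\<delta> b)))"
          using car[OF i b0] car[OF i0(1) b0] car[OF i0(1) b] aD[OF i b0] pD aD[OF i0(1) b]
          by (intro D_mult) auto
        moreover have "((\<gamma> i \<otimes> inv (\<delta> b0)) \<otimes> inv (\<gamma> i0 \<otimes> inv (\<delta> b0))) \<otimes> (\<gamma> i0 \<otimes> inv (\<delta> b))
            = \<gamma> i \<otimes> inv (\<delta> b)"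
        proof -
          have g: "\<gamma> i \<in> carrier G" "\<gamma> i0 \<in> carrier G" "\<delta> b0 \<in> carrier G" "\<delta> b \<in> carrier G"
            using carI carB i i0 b by auto
          have "inv (\<delta> b0) \<otimes> (\<delta> b0 \<otimes> inv (\<gamma> i0)) = inv (\<gamma> i0)"
            using g by (simp add: m_assoc[symmetric])
          then have "(\<gamma> i \<otimes> inv (\<delta> b0)) \<otimes> inv (\<gamma> i0 \<otimes> inv (\<delta> b0)) = \<gamma> i \<otimes> inv (\<gamma> i0)"
            using g by (simp add: inv_mult_group m_assoc)
          moreover have "inv (\<gamma> i0) \<otimes> (\<gamma> i0 \<otimes> inv (\<delta> b)) = inv (\<delta> b)"
            using g by (simp add: m_assoc[symmetric])
          ultimately show ?thesis using g by (simp add: m_assoc)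
        qed
        ultimately show "a' i b \<in> D (\<gamma> i \<otimes> inv (\<delta> b))"
          unfolding a'_def using D_diff[OF car[OF i b] aD[OF i b]] by simp
      qed
    qed
    then obtain c where c: "\<forall>i\<in>I'. c i \<in> K" "\<exists>i\<in>I'. c i \<noteq> 0" "\<forall>b\<in>B. (\<Sum>i\<in>I'. c i * a' i b) = 0" by blast
    \<comment> \<open>The coefficient at i0 is dictated by the equation for b0.\<close>
    define c' where "c' = c(i0 := - (\<Sum>i\<in>I'. c i * a i b0 * p))"
    have sum: "(\<Sum>i\<in>I. c' i * a i b) = (\<Sum>i\<in>I'. c i * a' i b)" for b
    proof -
      have "(\<Sum>i\<in>I. c' i * a i b) = c' i0 * a i0 b + (\<Sum>i\<in>I'. c' i * a i b)"
        unfolding I'_def by (rule sum.remove[OF insert.prems(1) i0(1)])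
      also have "(\<Sum>i\<in>I'. c' i * a i b) = (\<Sum>i\<in>I'. c i * a i b)"
        by (rule sum.cong) (auto simp: c'_def I'_def)
      also have "c' i0 * a i0 b = - (\<Sum>i\<in>I'. c i * a i b0 * p * a i0 b)"
        by (simp add: c'_def sum_distrib_right)
      finally show ?thesis by (simp add: a'_def algebra_simps sum_subtractf)
    qed
    have "\<forall>i\<in>I. c' i \<in> K"
    proof
      fix i assume "i \<in> I"
      have "(\<Sum>i\<in>I'. c i * a i b0 * p) \<in> K"
        by (rule subring_sum[OF Kr]) (use c(1) aK[OF _ b0] pK Kr in \<open>auto simp: I'_def intro!: subring_mult\<close>)
      then show "c' i \<in> K" using c(1) \<open>i \<in> I\<close> subring_uminus[OF Kr] by (auto simp: c'_def I'_def)
    qed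
    moreover have "\<exists>i\<in>I. c' i \<noteq> 0" using c(2) by (auto simp: c'_def I'_def)
    moreover have "(\<Sum>i\<in>I. c' i * a i b) = 0" if "b \<in> insert b0 B" for b
    proof (cases "b = b0")
      case True
      have "a' i b0 = 0" for i using hinv_left[OF pU] by (simp add: a'_def p_def mult.assoc)
      then show ?thesis using True by (simp add: sum)
    next
      case False
      then show ?thesis using that c(3) by (simp add: sum)
    qed
    ultimately show ?thesis by blast
  qed
qed

text \<open>The index type is left open because the bound serves both for powers of an element,
  indexed by numbers, and for elements indexed by valuation rings. Families rather than sets allow
  repetitions.\<close>

lemma homogeneous_dependence:
  assumes K: "graded_subfield G D K" and fin: "graded_finite G D K UNIV"
  obtains n where "\<And>(I::'i set) v. finite I \<Longrightarrow> n < card I \<Longrightarrow> (\<And>i. i \<in> I \<Longrightarrow> v i \<in> H) \<Longrightarrow>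
    \<exists>c. (\<forall>i\<in>I. c i \<in> K) \<and> (\<exists>i\<in>I. c i \<noteq> 0) \<and> (\<Sum>i\<in>I. c i * v i) = 0"
proof -
  note Kr = subfield_subring[OF K]
  obtain B where B: "finite B" "B \<subseteq> H" "\<forall>x. \<exists>c. (\<forall>b\<in>B. c b \<in> K) \<and> x = (\<Sum>b\<in>B. c b * b)"
    using fin unfolding graded_finite_def by auto
  have "\<forall>b\<in>B. \<exists>d. d \<in> carrier G \<and> b \<in> D d" using B(2) homogE by blast
  then obtain \<delta> where \<delta>: "\<And>b. b \<in> B \<Longrightarrow> \<delta> b \<in> carrier G" "\<And>b. b \<in> B \<Longrightarrow> b \<in> D (\<delta> b)"
    using bchoice[of B "\<lambda>b d. d \<in> carrier G \<and> b \<in> D d"] by blast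
  show thesis
  proof (rule that[of "card B"])
    fix I :: "'i set" and v assume I: "finite I" "card B < card I" and v: "\<And>i. i \<in> I \<Longrightarrow> v i \<in> H"
    have "\<forall>i\<in>I. \<exists>d. d \<in> carrier G \<and> v i \<in> D d" using v homogE by blast
    then obtain \<gamma> where \<gamma>: "\<And>i. i \<in> I \<Longrightarrow> \<gamma> i \<in> carrier G" "\<And>i. i \<in> I \<Longrightarrow> v i \<in> D (\<gamma> i)"
      using bchoice[of I "\<lambda>i d. d \<in> carrier G \<and> v i \<in> D d"] by blast
    have "\<forall>i. \<exists>c. (\<forall>b\<in>B. c b \<in> K) \<and> v i = (\<Sum>b\<in>B. c b * b)" using B(3) by blast
    then obtain e where e: "\<And>i b. b \<in> B \<Longrightarrow> e i b \<in> K" "\<And>i. v i = (\<Sum>b\<in>B. e i b * b)"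
      using choice[of "\<lambda>i c. (\<forall>b\<in>B. c b \<in> K) \<and> v i = (\<Sum>b\<in>B. c b * b)"] by blast
    \<comment> \<open>As v i is homogeneous, each coefficient may be replaced by its component in
      the only degree that contributes; this produces the degree pattern of the linear
      system.\<close>
    define a where "a i b = component (e i b) (\<gamma> i \<otimes> inv (\<delta> b))" for i b
    have "v i = (\<Sum>b\<in>B. a i b * b)" if i: "i \<in> I" for i
    proof -
      have "v i = component (v i) (\<gamma> i)" using component_homog[OF \<gamma>[OF i], of "\<gamma> i"] by simp
      also have "\<dots> = (\<Sum>b\<in>B. component (e i b * b) (\<gamma> i))" by (subst e(2)) (rule component_sum)
      also have "\<dots> = (\<Sum>b\<in>B. a i b * b)"
        unfolding a_def by (rule sum.cong) (auto simp: component_mult[OF \<delta> \<gamma>(1)[OF i]])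
      finally show ?thesis .
    qed
    note va = this
    have "\<exists>c. (\<forall>i\<in>I. c i \<in> K) \<and> (\<exists>i\<in>I. c i \<noteq> 0) \<and> (\<forall>b\<in>B. (\<Sum>i\<in>I. c i * a i b) = 0)"
    proof (rule homogeneous_system_solution[OF K B(1) I \<gamma>(1) \<delta>(1)])
      fix i b assume "i \<in> I" "b \<in> B"
      then show "a i b \<in> K \<and> a i b \<in> D (\<gamma> i \<otimes> inv (\<delta> b))"
        using subring_component[OF Kr e(1)] component_in \<gamma>(1) \<delta>(1) by (simp add: a_def)
    qed
    then obtain c where c: "\<forall>i\<in>I. c i \<in> K" "\<exists>i\<in>I. c i \<noteq> 0" "\<forall>b\<in>B. (\<Sum>i\<in>I. c i * a i b) = 0" by blast
    have "(\<Sum>i\<in>I. c i * v i) = (\<Sum>i\<in>I. \<Sum>b\<in>B. c i * a i b * b)"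
      by (rule sum.cong) (simp_all add: va sum_distrib_left mult.assoc)
    also have "\<dots> = (\<Sum>b\<in>B. (\<Sum>i\<in>I. c i * a i b) * b)"
      by (subst sum.swap) (simp add: sum_distrib_right)
    also have "\<dots> = 0" using c(3) by simp
    finally show "\<exists>c. (\<forall>i\<in>I. c i \<in> K) \<and> (\<exists>i\<in>I. c i \<noteq> 0) \<and> (\<Sum>i\<in>I. c i * v i) = 0" using c by blast
  qed
qed

section \<open>Rings with the same trace on a subfield of finite index\<close>

lemma power_eq_subfield_times_unit:
  assumes K: "graded_subfield G D K" and fin: "graded_finite G D K UNIV"
    and V: "valring UNIV V" and f: "f \<in> U"
  obtains N c w where "0 < N" "c \<in> K" "w \<in> D \<one>" "w \<in> U" "w \<in> V" "hinv w \<in> V" "f ^ N = c * w"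
proof -
  note result = that
  note Kr = subfield_subring[OF K]
  obtain n where n: "\<And>(I::nat set) v. finite I \<Longrightarrow> n < card I \<Longrightarrow> (\<And>i. i \<in> I \<Longrightarrow> v i \<in> H) \<Longrightarrow>
    \<exists>c. (\<forall>i\<in>I. c i \<in> K) \<and> (\<exists>i\<in>I. c i \<noteq> 0) \<and> (\<Sum>i\<in>I. c i * v i) = 0"
    by (rule homogeneous_dependence[OF K fin, where 'i = nat]) blast
  have fH: "f ^ i \<in> H" for i using U_power[OF f] by (simp add: units_iff)
  obtain c j0 where c: "\<forall>i\<in>{..n}. c i \<in> K" "j0 \<in> {..n}" "c j0 \<noteq> 0" "(\<Sum>i\<in>{..n}. c i * f ^ i) = 0"
    using n[of "{..n}" "\<lambda>i. f ^ i"] fH by auto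
  obtain q g where q: "g \<in> carrier G" "\<And>i. \<exists>h. q i = component (c i) h"
    "\<And>i. i \<in> {..n} \<Longrightarrow> q i * f ^ i \<in> D g" "(\<Sum>i\<in>{..n}. q i * f ^ i) = 0" "q j0 \<noteq> 0"
    by (rule homogenize_relation[where y = "\<lambda>i. f ^ i" and p = c and j = j0, OF _ _ c(4,2,3)])
      (use f in auto)
  define T where "T = {i \<in> {..n}. q i \<noteq> 0}"
  have qU: "q i \<in> U" "q i \<in> K" if "i \<in> T" for i
    using that q(2)[of i] component_in_homog subring_component[OF Kr] c(1) by (auto simp: T_def units_iff)
  define t where "t i = q i * f ^ i" for i
  have tU: "t i \<in> U" if "i \<in> T" for i using qU[OF that] f by (simp add: t_def)
  have "finite (t ` T)" "t ` T \<noteq> {}" "t ` T \<subseteq> UNIV \<inter> U" using tU q(5) c(2) by (auto simp: T_def)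
  from valring_max[OF subfield_UNIV V this] obtain j where j: "j \<in> T" "\<forall>i\<in>T. t i * hinv (t j) \<in> V" by blast
  \<comment> \<open>The term j of largest value cannot strictly dominate all others, so some other
    term i has the same value.\<close>
  have "\<exists>i\<in>{..n}. i \<noteq> j \<and> t i * hinv (t j) \<notin> nonunits UNIV V"
  proof (rule ccontr)
    assume no: "\<not> ?thesis"
    show False
      by (rule no_dominant_term[OF V _ q(1), of "{..n}" t j])
        (use q(3,4) tU[OF j(1)] j(1) no in \<open>auto simp: t_def T_def units_iff\<close>)
  qed
  then obtain i where i: "i \<in> {..n}" "i \<noteq> j" "t i * hinv (t j) \<notin> nonunits UNIV V" by blast
  have iT: "i \<in> T"
  proof (rule ccontr)
    assume "i \<notin> T"
    then have "t i * hinv (t j) = 0" using i(1) by (simp add: T_def t_def)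
    then show False using i(3) nonunits_0[OF subfield_UNIV] by simp
  qed
  have val: "t i * hinv (t j) \<in> V" "t j * hinv (t i) \<in> V"
  proof -
    show "t i * hinv (t j) \<in> V" using j iT by blast
    have "t i * hinv (t j) \<in> U" using tU iT j(1) by simp
    then have "hinv (t i * hinv (t j)) \<in> V" using i(3) by (simp add: nonunits_def units_iff)
    then show "t j * hinv (t i) \<in> V" using tU[OF iT] tU[OF j(1)] by (simp add: hinv_mult mult.commute)
  qed
  \<comment> \<open>The two terms are named so that a is the larger power and \<open>a - b\<close>
    is positive. Both have degree g, so their quotient w has degree one, and solving it for
    \<open>f ^ (a - b)\<close> leaves a quotient of coefficients in K.\<close>
  have from_pair: thesis if ab: "a \<in> T" "b \<in> T" "b < a" "t a * hinv (t b) \<in> V" "t b * hinv (t a) \<in> V" for a b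
  proof (rule result)
    define w where "w = t a * hinv (t b)"
    have tD: "t a \<in> D g" "t b \<in> D g" using q(3) ab by (auto simp: T_def t_def)
    show "0 < a - b" using ab by simp
    show "q b * hinv (q a) \<in> K" using ab(1,2) by (intro subring_mult[OF Kr] subfield_hinv[OF K] qU)
    have "w \<in> D (g \<otimes> inv g)"
      unfolding w_def by (rule D_mult[OF q(1) _ tD(1) hinv_D[OF tU[OF ab(2)] q(1) tD(2)]]) (simp add: q(1))
    then show "w \<in> D \<one>" using q(1) by simp
    show "w \<in> U" using tU ab by (simp add: w_def)
    show "w \<in> V" using ab by (simp add: w_def)
    show "hinv w \<in> V" using ab tU by (simp add: w_def hinv_mult mult.commute)
    have "f ^ a = f ^ (a - b) * f ^ b" using ab(3) by (simp add: power_add[symmetric])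
    then have "q b * hinv (q a) * w = f ^ (a - b) * (q a * hinv (q a)) * (q b * hinv (q b)) * (f ^ b * hinv (f ^ b))"
      using qU ab f by (simp add: w_def t_def hinv_mult mult_ac)
    then show "f ^ (a - b) = q b * hinv (q a) * w"
      using hinv[OF qU(1)[OF ab(1)]] hinv[OF qU(1)[OF ab(2)]] hinv[OF U_power[OF f]] by simp
  qed
  show thesis
  proof (cases "j < i")
    case True
    then show ?thesis using from_pair[OF iT j(1)] val by blast
  next
    case False
    then show ?thesis using from_pair[OF j(1) iT] val i(2) by simp
  qed
qed

text \<open>A power of f is c w with c in K and w, 1/w in degree one of V, hence in V'. For either
  ring, membership of f amounts to membership of c, which the common trace decides. A one-sided
  inclusion in degree one thus forces equality, so distinct rings of a fibre are incomparable
  there.\<close>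

lemma valring_eqI_of_degree_one:
  assumes K: "graded_subfield G D K" and fin: "graded_finite G D K UNIV"
    and V: "valring UNIV V" "valring UNIV V'" "V \<inter> K = V' \<inter> K" and sub: "V \<inter> D \<one> \<subseteq> V'"
  shows "V = V'"
proof -
  note Vr = valring_subring[OF V(1)] and Vr' = valring_subring[OF V(2)]
  have iff: "f \<in> V \<longleftrightarrow> f \<in> V'" if f: "f \<in> U" for f
  proof -
    obtain N c w where w: "0 < N" "c \<in> K" "w \<in> D \<one>" "w \<in> U" "w \<in> V" "hinv w \<in> V" "f ^ N = c * w"
      by (rule power_eq_subfield_times_unit[OF K fin V(1) f])
    have "hinv w \<in> D \<one>" using hinv_D[OF w(4) one_closed w(3)] by simp
    then have w': "w \<in> V'" "hinv w \<in> V'" using sub w by auto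
    have *: "f \<in> X \<longleftrightarrow> c \<in> X" if X: "valring UNIV X" "w \<in> X" "hinv w \<in> X" for X
    proof
      assume "f \<in> X"
      then have "f ^ N * hinv w \<in> X"
        using X subring_power subring_mult valring_subring by blast
      moreover have "f ^ N * hinv w = c" using hinv[OF w(4)] by (simp add: w(7) mult.assoc)
      ultimately show "c \<in> X" by simp
    next
      assume "c \<in> X"
      then have "f ^ N \<in> X" using X w(7) subring_mult valring_subring by metis
      then show "f \<in> X" using valring_power[OF X(1) _ f w(1)] by simp
    qed
    show ?thesis using *[OF V(1) w(5,6)] *[OF V(2) w'] V(3) w(2) by blast
  qed
  show ?thesis
    using subring_subsetI[OF Vr Vr'] subring_subsetI[OF Vr' Vr] iff by blast
qed

section \<open>Weak approximation in degree one\<close>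

lemma D_one_power: "x \<in> D \<one> \<Longrightarrow> x ^ n \<in> D \<one>"
  by (induction n) (use one_D D_mult[OF one_closed one_closed] in auto)

text \<open>Let y serve for \<Psi> and z for the new ring P. If y lies in P, then y + z^r replaces
  it: a power of z pushes the sum out of P, and each ring of \<Psi> excludes at most one exponent
  r.\<close>

lemma separating_element:
  assumes V: "valring UNIV V"
  shows "finite \<Psi> \<Longrightarrow> (\<And>P. P \<in> \<Psi> \<Longrightarrow> valring UNIV P) \<Longrightarrow>
    (\<And>P. P \<in> \<Psi> \<Longrightarrow> \<exists>x\<in>D \<one>. x \<in> nonunits UNIV V \<and> x \<notin> P) \<Longrightarrow>
    \<exists>x\<in>D \<one>. x \<in> nonunits UNIV V \<and> (\<forall>P\<in>\<Psi>. x \<notin> P)"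
proof (induction \<Psi> rule: finite_induct)
  case empty
  then show ?case using nonunits_0[OF subfield_UNIV] D_zero[OF one_closed] by blast
next
  case (insert P \<Psi>)
  have val: "valring UNIV Q" if "Q \<in> insert P \<Psi>" for Q using insert.prems(1) that by blast
  have "\<exists>x\<in>D \<one>. x \<in> nonunits UNIV V \<and> (\<forall>Q\<in>\<Psi>. x \<notin> Q)"
    by (rule insert.IH) (use insert.prems in auto)
  then obtain y where y: "y \<in> D \<one>" "y \<in> nonunits UNIV V" "\<forall>Q\<in>\<Psi>. y \<notin> Q" by blast
  obtain z where z: "z \<in> D \<one>" "z \<in> nonunits UNIV V" "z \<notin> P" using insert.prems(2)[of P] by blast
  show ?case
  proof (cases "y \<in> P")
    case False
    then show ?thesis using y by blast
  next
    case True
    have DH: "x \<in> H" if "x \<in> D \<one>" for x using that one_closed homogI by blast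
    have sub_mem: "u + v \<in> Q \<Longrightarrow> v \<in> Q \<Longrightarrow> u \<in> Q" if "Q \<in> insert P \<Psi>" for Q u v
      using subring_add[OF valring_subring[OF val[OF that]], of "u + v" "- v"]
        subring_uminus[OF valring_subring[OF val[OF that]], of v] by simp
    \<comment> \<open>If both sums were in Q, then z could not be in Q, as y is not, so 1/z is a
      nonunit. Dividing the difference z^s - z^r of the sums by z^s makes 1 - (1/z)^(s-r) a nonunit,
      and with it 1.\<close>
    have bad: "\<not> (y + z ^ r \<in> Q \<and> y + z ^ s \<in> Q)" if Q: "Q \<in> \<Psi>" and rs: "r < s" for Q r s
    proof
      assume *: "y + z ^ r \<in> Q \<and> y + z ^ s \<in> Q"
      have QQ: "Q \<in> insert P \<Psi>" using Q by simp
      note vQ = val[OF QQ] and Qr = valring_subring[OF val[OF QQ]]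
      have "z \<notin> Q" using * sub_mem[OF QQ, of y "z ^ r"] y(3) Q subring_power[OF Qr] by blast
      moreover have "z \<noteq> 0" using calculation subring_0[OF Qr] by blast
      then have zU: "z \<in> U" using DH[OF z(1)] by (simp add: units_iff)
      ultimately have iz: "hinv z \<in> nonunits UNIV Q" "hinv z \<in> Q"
        using hinv_U[OF zU] valring_cases[OF vQ _ zU] by (auto simp: nonunits_def units_iff)
      have izD: "hinv z \<in> D \<one>" using hinv_D[OF zU one_closed z(1)] by simp
      have pw: "hinv z ^ Suc m \<in> nonunits UNIV Q" for m
        using nonunits_mult[OF subfield_UNIV vQ iz(1) subring_power[OF Qr iz(2)] DH[OF D_one_power[OF izD]]] by simp
      obtain m where m: "s = r + Suc m" using rs less_iff_Suc_add by auto
      have "(y + z ^ s) + - (y + z ^ r) \<in> Q" using * subring_add[OF Qr] subring_uminus[OF Qr] by blast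
      then have u: "z ^ s - z ^ r \<in> Q" by simp
      have uD: "z ^ s - z ^ r \<in> D \<one>" using D_diff[OF one_closed] D_one_power[OF z(1)] by blast
      have "hinv z ^ s * (z ^ s - z ^ r) \<in> nonunits UNIV Q"
        using nonunits_mult[OF subfield_UNIV vQ pw[of "r + m"] u DH[OF uD]] by (simp add: m)
      moreover have "hinv z ^ s * (z ^ s - z ^ r) = 1 - hinv z ^ Suc m"
      proof -
        have "hinv z ^ s * (z ^ s - z ^ r) = (hinv z * z) ^ s - hinv z ^ Suc m * (hinv z * z) ^ r"
          by (simp add: m power_add power_mult_distrib algebra_simps)
        then show ?thesis using hinv_left[OF zU] by simp
      qed
      ultimately have "1 - hinv z ^ Suc m \<in> nonunits UNIV Q" by simp
      then have "(1 - hinv z ^ Suc m) + hinv z ^ Suc m \<in> nonunits UNIV Q"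
        by (rule nonunits_add[OF subfield_UNIV vQ one_closed _ _ pw])
          (use D_diff[OF one_closed one_D] D_one_power[OF izD] in blast)+
      then show False using one_nonunit[OF vQ] by simp
    qed
    \<comment> \<open>The exponent 0 is excluded because z^0 = 1 is a unit of V and lies in
      P.\<close>
    define E where "E = {0} \<union> (\<Union>Q\<in>\<Psi>. {r. y + z ^ r \<in> Q})"
    have "finite {r. y + z ^ r \<in> Q}" if "Q \<in> \<Psi>" for Q
    proof -
      have "\<exists>r. {r. y + z ^ r \<in> Q} \<subseteq> {r}"
        using bad[OF that] by (metis (mono_tags, lifting) insertCI linorder_neqE_nat mem_Collect_eq subsetI)
      then show ?thesis using finite_subset by blast
    qed
    then have "finite E" using insert.hyps by (simp add: E_def)
    then obtain r where "r \<notin> E" using ex_new_if_finite infinite_UNIV_nat by blast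
    then have r: "0 < r" "\<forall>Q\<in>\<Psi>. y + z ^ r \<notin> Q" by (auto simp: E_def)
    have PP: "P \<in> insert P \<Psi>" by simp
    have "y + z ^ r \<notin> P"
    proof
      assume "y + z ^ r \<in> P"
      then have "z ^ r \<in> P" using sub_mem[OF PP, of "z ^ r" y] True by (simp add: add.commute)
      moreover have "z \<in> U" using z DH subring_0[OF valring_subring[OF val[OF PP]]] by (auto simp: units_iff)
      ultimately show False using valring_power[OF val[OF PP] _ _ r(1)] z(3) by blast
    qed
    moreover have "z ^ r \<in> nonunits UNIV V"
    proof -
      have "z * z ^ (r - 1) \<in> nonunits UNIV V"
        using nonunits_mult[OF subfield_UNIV V z(2)] subring_power[OF valring_subring[OF V]]
          nonunits_subset[OF V] z(2) DH[OF D_one_power[OF z(1)]] by blast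
      then show ?thesis using r(1) by (simp add: power_eq_if)
    qed
    then have "y + z ^ r \<in> nonunits UNIV V"
      using nonunits_add[OF subfield_UNIV V one_closed y(2,1)] D_one_power[OF z(1)] by blast
    moreover have "y + z ^ r \<in> D \<one>" using D_add[OF one_closed y(1)] D_one_power[OF z(1)] by blast
    ultimately show ?thesis using r(2) by blast
  qed
qed

lemma finite_fibre:
  assumes K: "graded_subfield G D K" and fin: "graded_finite G D K UNIV" and R: "valring K R"
  shows "finite {V. valring UNIV V \<and> V \<inter> K = R}"
proof -
  let ?\<Phi> = "{V. valring UNIV V \<and> V \<inter> K = R}"
  note Kr = subfield_subring[OF K]
  obtain n where n: "\<And>(I::'a set set) v. finite I \<Longrightarrow> n < card I \<Longrightarrow> (\<And>i. i \<in> I \<Longrightarrow> v i \<in> H) \<Longrightarrow>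
    \<exists>c. (\<forall>i\<in>I. c i \<in> K) \<and> (\<exists>i\<in>I. c i \<noteq> 0) \<and> (\<Sum>i\<in>I. c i * v i) = 0"
    by (rule homogeneous_dependence[OF K fin, where 'i = "'a set"]) blast
  have "card \<Phi> \<le> n" if \<Phi>: "\<Phi> \<subseteq> ?\<Phi>" "finite \<Phi>" for \<Phi>
  proof (rule ccontr)
    assume "\<not> card \<Phi> \<le> n"
    then have card: "n < card \<Phi>" by simp
    have val: "valring UNIV V" "V \<inter> K = R" if "V \<in> \<Phi>" for V using that \<Phi> by auto
    have ring: "graded_subring G D V" if "V \<in> \<Phi>" for V using val(1)[OF that] valring_subring by blast
    have DH: "x \<in> H" if "x \<in> D \<one>" for x using that one_closed homogI by blast
    have "\<exists>x\<in>D \<one>. x \<in> nonunits UNIV V \<and> (\<forall>P\<in>\<Phi> - {V}. x \<notin> P)" if V: "V \<in> \<Phi>" for V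
    proof (rule separating_element[OF val(1)[OF V]])
      show "finite (\<Phi> - {V})" using \<Phi> by simp
      fix P assume "P \<in> \<Phi> - {V}"
      then have P: "P \<in> \<Phi>" "P \<noteq> V" by auto
      show "valring UNIV P" using val P by blast
      \<comment> \<open>With x in V only and y in P only, x/y is a nonunit of V that lies outside
        P.\<close>
      have "\<not> V \<inter> D \<one> \<subseteq> P" "\<not> P \<inter> D \<one> \<subseteq> V"
        using valring_eqI_of_degree_one[OF K fin val(1)[OF V] val(1)[OF P(1)]]
          valring_eqI_of_degree_one[OF K fin val(1)[OF P(1)] val(1)[OF V]] val(2)[OF V] val(2)[OF P(1)] P(2) by auto
      then obtain x y where x: "x \<in> V" "x \<in> D \<one>" "x \<notin> P" and y: "y \<in> P" "y \<in> D \<one>" "y \<notin> V" by blast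
      have xU: "x \<in> U" using x DH subring_0[OF ring[OF P(1)]] by (auto simp: units_iff)
      have yU: "y \<in> U" using y DH subring_0[OF ring[OF V]] by (auto simp: units_iff)
      have "x * hinv y \<in> D \<one>"
        using D_mult[OF one_closed inv_closed[OF one_closed] x(2) hinv_D[OF yU one_closed y(2)]] by simp
      moreover have "x * hinv y \<notin> P"
      proof
        assume "x * hinv y \<in> P"
        then have "x * hinv y * y \<in> P" using y subring_mult[OF ring[OF P(1)]] by blast
        then show False using x hinv_left[OF yU] by (simp add: mult.assoc)
      qed
      moreover have "hinv (x * hinv y) \<notin> V"
      proof
        assume "hinv (x * hinv y) \<in> V"
        then have "x * hinv (x * hinv y) \<in> V" using x subring_mult[OF ring[OF V]] by blast
        then show False using y xU yU by (simp add: hinv_mult hinv_cancel)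
      qed
      moreover have "x * hinv y \<in> H" using xU yU by (intro U_homog) simp
      ultimately show "\<exists>x\<in>D \<one>. x \<in> nonunits UNIV V \<and> x \<notin> P" by (auto simp: nonunits_def)
    qed
    then have "\<forall>V\<in>\<Phi>. \<exists>x. x \<in> D \<one> \<and> x \<in> nonunits UNIV V \<and> (\<forall>P\<in>\<Phi> - {V}. x \<notin> P)" by blast
    then obtain x where x: "\<And>V. V \<in> \<Phi> \<Longrightarrow> x V \<in> D \<one>" "\<And>V. V \<in> \<Phi> \<Longrightarrow> x V \<in> nonunits UNIV V"
      "\<And>V P. V \<in> \<Phi> \<Longrightarrow> P \<in> \<Phi> \<Longrightarrow> P \<noteq> V \<Longrightarrow> x V \<notin> P"
      using bchoice[of \<Phi> "\<lambda>V x. x \<in> D \<one> \<and> x \<in> nonunits UNIV V \<and> (\<forall>P\<in>\<Phi> - {V}. x \<notin> P)"] by blast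
    \<comment> \<open>Adding 1 to a nonunit of V gives a unit of V, and the sum still lies in no
      other ring. Its inverse e V is therefore a unit of V and a nonunit of every other
      ring.\<close>
    define s where "s V = 1 + x V" for V
    have sD: "s V \<in> D \<one>" if "V \<in> \<Phi>" for V using D_add[OF one_closed one_D x(1)[OF that]] by (simp add: s_def)
    have s_unit: "s V \<notin> nonunits UNIV V" if V: "V \<in> \<Phi>" for V
    proof
      assume "s V \<in> nonunits UNIV V"
      moreover have "x V * -1 \<in> nonunits UNIV V"
        by (rule nonunits_mult[OF subfield_UNIV val(1)[OF V] x(2)[OF V]])
          (use subring_1[OF ring[OF V]] subring_uminus[OF ring[OF V]] homog_uminus in auto)
      moreover have "x V * -1 \<in> D \<one>" using D_uminus[OF one_closed x(1)[OF V]] by simp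
      ultimately have "s V + x V * -1 \<in> nonunits UNIV V"
        using nonunits_add[OF subfield_UNIV val(1)[OF V] one_closed _ sD[OF V]] by blast
      then show False using one_nonunit[OF val(1)[OF V]] by (simp add: s_def)
    qed
    have sU: "s V \<in> U" if "V \<in> \<Phi>" for V
      using s_unit[OF that] DH[OF sD[OF that]] nonunits_0[OF subfield_UNIV] by (auto simp: units_iff)
    have sV: "s V \<in> V" if "V \<in> \<Phi>" for V
      using subring_add[OF ring subring_1[OF ring]] that x(2) nonunits_subset[OF val(1)] by (fastforce simp: s_def)
    have sP: "s V \<notin> P" if "V \<in> \<Phi>" "P \<in> \<Phi>" "P \<noteq> V" for V P
    proof
      assume "s V \<in> P"
      then have "s V + -1 \<in> P" using subring_add[OF ring] subring_1[OF ring] subring_uminus[OF ring] that by blast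
      then show False using x(3)[OF that] by (simp add: s_def)
    qed
    define e where "e V = hinv (s V)" for V
    have eU: "e V \<in> U" "hinv (e V) = s V" if "V \<in> \<Phi>" for V using sU[OF that] by (auto simp: e_def)
    have eH: "e V \<in> H" if "V \<in> \<Phi>" for V using eU[OF that] by (simp add: units_iff)
    obtain c V0 where c: "\<forall>V\<in>\<Phi>. c V \<in> K" "V0 \<in> \<Phi>" "c V0 \<noteq> 0" "(\<Sum>V\<in>\<Phi>. c V * e V) = 0"
      using n[OF \<Phi>(2) card, of e] eH by blast
    obtain q g where q: "g \<in> carrier G" "\<And>V. \<exists>h. q V = component (c V) h"
      "\<And>V. V \<in> \<Phi> \<Longrightarrow> q V * e V \<in> D g" "(\<Sum>V\<in>\<Phi>. q V * e V) = 0" "q V0 \<noteq> 0"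
      by (rule homogenize_relation[where y = e and p = c and j = V0, OF \<Phi>(2) eU(1) c(4,2,3)]) blast+
    define T where "T = {V \<in> \<Phi>. q V \<noteq> 0}"
    have qU: "q V \<in> U" "q V \<in> K" if "V \<in> T" for V
      using that q(2)[of V] component_in_homog subring_component[OF Kr] c(1) by (auto simp: T_def units_iff)
    have "finite (q ` T)" "q ` T \<noteq> {}" "q ` T \<subseteq> K \<inter> U" using qU q(5) c(2) \<Phi>(2) by (auto simp: T_def)
    \<comment> \<open>Coefficients are compared in R, the common trace of all the rings. In the ring
      V1 belonging to the largest coefficient, e V1 is a unit and the other e V are nonunits, so the
      term at V1 dominates.\<close>
    from valring_max[OF K R this] obtain V1 where V1: "V1 \<in> T" "\<forall>V\<in>T. q V * hinv (q V1) \<in> R" by blast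
    have V1\<Phi>: "V1 \<in> \<Phi>" using V1 by (simp add: T_def)
    show False
    proof (rule no_dominant_term[OF val(1)[OF V1\<Phi>] \<Phi>(2) q(1,4,3) V1\<Phi>])
      show "q V1 * e V1 \<noteq> 0" using U_mult[OF qU(1)[OF V1(1)] eU(1)[OF V1\<Phi>]] by (simp add: units_iff)
      fix V assume V: "V \<in> \<Phi>" "V \<noteq> V1"
      show "q V * e V * hinv (q V1 * e V1) \<in> nonunits UNIV V1"
      proof (cases "q V = 0")
        case True
        then show ?thesis using nonunits_0[OF subfield_UNIV] by simp
      next
        case False
        then have VT: "V \<in> T" using V by (simp add: T_def)
        have "e V \<in> nonunits UNIV V1"
          using eU[OF V(1)] sP[OF V(1) V1\<Phi>] V(2) by (auto simp: nonunits_def units_iff)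
        moreover have "q V * hinv (q V1) * s V1 \<in> V1"
          using V1(2) VT val(2)[OF V1\<Phi>] sV[OF V1\<Phi>] subring_mult[OF ring[OF V1\<Phi>]] by blast
        moreover have "q V * hinv (q V1) * s V1 \<in> H"
          using qU(1)[OF VT] qU(1)[OF V1(1)] sU[OF V1\<Phi>] by (intro U_homog) simp
        ultimately have "e V * (q V * hinv (q V1) * s V1) \<in> nonunits UNIV V1"
          using nonunits_mult[OF subfield_UNIV val(1)[OF V1\<Phi>]] by blast
        moreover have "e V * (q V * hinv (q V1) * s V1) = q V * e V * hinv (q V1 * e V1)"
          using qU(1)[OF V1(1)] eU[OF V1\<Phi>] by (simp add: hinv_mult mult_ac)
        ultimately show ?thesis by simp
      qed
    qed auto
  qed
  then show ?thesis using finite_if_finite_subsets_card_bdd[of ?\<Phi> n] by blast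
qed

section \<open>Torsion degree quotients and algebraic base\<close>

lemma deg_eq: assumes "x \<in> U" "g \<in> carrier G" "x \<in> D g" shows "deg G D x = g"
  unfolding deg_def by (rule the_equality) (use assms D_disjoint in \<open>auto simp: units_iff\<close>)

lemma D_power: "g \<in> carrier G \<Longrightarrow> x \<in> D g \<Longrightarrow> x ^ n \<in> D (g [^] n)"
proof (induction n)
  case (Suc n)
  then show ?case using D_mult[of "g [^] n" g "x ^ n" x] by (simp add: mult.commute)
qed (simp add: one_D)

text \<open>Torsion brings a power f^n into the degree of some y in K. The quotient has degree one
  and so lies in K, whence f^n lies in K. A valuation ring contains f exactly when it contains
  f^n.\<close>

lemma valring_eqI_of_torsion:
  assumes K: "graded_subfield G D K" "D \<one> \<subseteq> K"
    and tors: "\<forall>x\<in>U. \<exists>n::nat. n > 0 \<and> deg G D x [^] n \<in> deg G D ` units_h G D K"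
    and V: "valring UNIV V" "valring UNIV V'" "V \<inter> K = V' \<inter> K"
  shows "V = V'"
proof -
  note Kr = subfield_subring[OF K(1)]
  have iff: "f \<in> V \<longleftrightarrow> f \<in> V'" if f: "f \<in> U" for f
  proof -
    obtain n :: nat and y where n: "0 < n" "y \<in> units_h G D K" "deg G D f [^] n = deg G D y"
      using tors f by blast
    have y: "y \<in> K" "y \<in> U" using n(2) units_h_eq[of K] by auto
    obtain g where g: "g \<in> carrier G" "f \<in> D g" using f by (auto simp: units_iff elim: homogE)
    obtain h where h: "h \<in> carrier G" "y \<in> D h" using y by (auto simp: units_iff elim: homogE)
    have gh: "g [^] n = h" using n(3) deg_eq[OF f g] deg_eq[OF y(2) h] by simp
    have "f ^ n * hinv y \<in> D (h \<otimes> inv h)"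
      using D_mult[OF h(1) inv_closed[OF h(1)]] D_power[OF g, of n] hinv_D[OF y(2) h] gh by simp
    then have "f ^ n * hinv y \<in> K" using K(2) h by auto
    then have "f ^ n * hinv y * y \<in> K" using y subring_mult[OF Kr] by blast
    then have fK: "f ^ n \<in> K" using hinv_left[OF y(2)] by (simp add: mult.assoc)
    have *: "f \<in> X \<longleftrightarrow> f ^ n \<in> X" if X: "valring UNIV X" for X
      using valring_power[OF X _ f n(1)] subring_power[OF valring_subring[OF X]] by blast
    show ?thesis using *[OF V(1)] *[OF V(2)] V(3) fK by blast
  qed
  show ?thesis
    using subring_subsetI[of V V'] subring_subsetI[of V' V] valring_subring V iff by blast
qed

text \<open>A monic equation over k makes every single element of l dependent, so the empty set is
  the only independent subset to be tested.\<close>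

lemma general_position_if_algebraic:
  assumes k: "graded_subfield G D k" and alg: "graded_algebraic k l"
  shows "general_position G D k l K"
  unfolding general_position_def
proof (intro allI impI)
  fix S assume S': "finite S \<and> S \<subseteq> units_h G D l \<and> alg_indep k S"
  then have S: "finite S" "S \<subseteq> l" "alg_indep k S" using units_h_eq[of l] by auto
  note kr = subfield_subring[OF k]
  have "S = {}"
  proof (rule ccontr)
    assume "S \<noteq> {}"
    then obtain s where s: "s \<in> S" by blast
    then obtain n c where c: "\<forall>i<n. c i \<in> k" "s ^ n + (\<Sum>i<n. c i * s ^ i) = 0"
      using alg S(2) unfolding graded_algebraic_def by blast
    \<comment> \<open>Exponent functions concentrated at s carry the one-variable equation into the
      form used by \<open>alg_indep\<close>; its leading coefficient 1 sits at
      \<open>e n\<close>.\<close>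
    define e :: "nat \<Rightarrow> 'a \<Rightarrow> nat" where "e i = (\<lambda>_. 0)(s := i)" for i
    have inj: "inj_on e {..n}" by (rule inj_onI) (metis e_def fun_upd_same)
    define c' where "c' \<alpha> = (if \<alpha> s = n then 1 else c (\<alpha> s))" for \<alpha> :: "'a \<Rightarrow> nat"
    have c'_e: "c' (e i) = (if i = n then 1 else c i)" for i by (simp add: c'_def e_def)
    have mon: "monomial S (e i) = s ^ i" for i
    proof -
      have "monomial S (e i) = (\<Prod>t\<in>S. if t = s then s ^ i else 1)"
        unfolding monomial_def by (rule prod.cong) (auto simp: e_def)
      then show ?thesis using S(1) s by simp
    qed
    have "(\<Sum>\<alpha>\<in>e ` {..n}. c' \<alpha> * monomial S \<alpha>) = (\<Sum>i\<le>n. (if i = n then 1 else c i) * s ^ i)"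
      by (subst sum.reindex[OF inj]) (simp add: mon c'_e)
    also have "\<dots> = s ^ n + (\<Sum>i<n. c i * s ^ i)"
    proof -
      have "{..n} = insert n {..<n}" by auto
      then show ?thesis by (auto intro!: sum.cong)
    qed
    finally have "(\<Sum>\<alpha>\<in>e ` {..n}. c' \<alpha> * monomial S \<alpha>) = 0" using c(2) by simp
    then have "c' (e n) = 0"
      by (intro alg_indepD[OF S(3), of "e ` {..n}" c'])
        (use c(1) s subring_1[OF kr] in \<open>auto simp: c'_def e_def exponents_def\<close>)
    then show False using zero_neq_one by (simp add: c'_def e_def)
  qed
  then show "alg_indep K S" by (simp add: alg_indep_empty)
qed

end

section \<open>The restriction map and its fibres\<close>

theorem theorem7p4:
  fixes G :: "('g, 'b) monoid_scheme" and D :: "'g \<Rightarrow> 'a::comm_ring_1 set"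
    and l K k :: "'a set"
  assumes "comm_group G"
    and "graded_field G D"
    and "graded_subfield G D l" and "graded_subfield G D K" and "graded_subfield G D k"
    and "k \<subseteq> l \<inter> K"
  defines "\<psi> \<equiv> (\<lambda>R. R \<inter> K)"
  shows "((\<psi> ` gval_rings G D UNIV l = gval_rings G D K k) \<longleftrightarrow> general_position G D k l K)
    \<and> (graded_finite G D K UNIV \<longrightarrow>
         (\<forall>R'\<in>gval_rings G D K k. finite {R \<in> gval_rings G D UNIV l. \<psi> R = R'}))
    \<and> (K = UNIV \<longrightarrow> inj_on \<psi> (gval_rings G D UNIV l))
    \<and> (graded_algebraic k l \<and> D \<one>\<^bsub>G\<^esub> \<subseteq> K \<and>
       (\<forall>x\<in>units_h G D UNIV. \<exists>n::nat. n > 0 \<and>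
           deg G D x [^]\<^bsub>G\<^esub> n \<in> deg G D ` units_h G D K)
       \<longrightarrow> bij_betw \<psi> (gval_rings G D UNIV l) (gval_rings G D K k))"
proof -
  interpret gr_field G D
    by (rule gr_field.intro) (use assms in \<open>auto simp: gr_field_axioms_def\<close>)
  note l = assms(3) and K = assms(4) and k = assms(5)
  have kl: "k \<subseteq> l" and kK: "k \<subseteq> K" using assms(6) by auto
  have into: "\<psi> ` gval_rings G D UNIV l \<subseteq> gval_rings G D K k"
    unfolding \<psi>_def
  proof (rule image_subsetI)
    fix R assume "R \<in> gval_rings G D UNIV l"
    then show "R \<inter> K \<in> gval_rings G D K k"
      using valring_restrict[OF _ K, of R] kl kK unfolding gval_rings_iff by blast
  qed
  have surj: "\<psi> ` gval_rings G D UNIV l = gval_rings G D K k \<longleftrightarrow> general_position G D k l K"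
  proof
    assume eq: "\<psi> ` gval_rings G D UNIV l = gval_rings G D K k"
    show "general_position G D k l K"
    proof (rule general_position_if_extension[OF k K l kK kl])
      fix R assume "valring K R" "k \<subseteq> R"
      then have "R \<in> \<psi> ` gval_rings G D UNIV l" by (simp add: eq gval_rings_iff)
      then show "\<exists>V. valring UNIV V \<and> l \<subseteq> V \<and> V \<inter> K = R" by (auto simp: gval_rings_iff \<psi>_def)
    qed
  next
    assume gp: "general_position G D k l K"
    have "gval_rings G D K k \<subseteq> \<psi> ` gval_rings G D UNIV l"
    proof
      fix R assume "R \<in> gval_rings G D K k"
      then have "valring K R" "k \<subseteq> R" by (auto simp: gval_rings_iff)
      from extension_if_general_position[OF k K kK l this gp]
      obtain W where "valring UNIV W" "l \<subseteq> W" "W \<inter> K = R" by blast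
      then show "R \<in> \<psi> ` gval_rings G D UNIV l" by (auto simp: gval_rings_iff \<psi>_def)
    qed
    then show "\<psi> ` gval_rings G D UNIV l = gval_rings G D K k" using into by blast
  qed
  moreover have "finite {R \<in> gval_rings G D UNIV l. \<psi> R = R'}"
    if "graded_finite G D K UNIV" "R' \<in> gval_rings G D K k" for R'
  proof -
    have "valring K R'" using that by (simp add: gval_rings_iff)
    from finite_fibre[OF K that(1) this] show ?thesis
      by (rule rev_finite_subset) (auto simp: gval_rings_iff \<psi>_def)
  qed
  moreover have "inj_on \<psi> (gval_rings G D UNIV l)" if "K = UNIV"
    using that by (simp add: \<psi>_def inj_on_def)
  moreover have "bij_betw \<psi> (gval_rings G D UNIV l) (gval_rings G D K k)"
    if alg: "graded_algebraic k l" and one: "D \<one>\<^bsub>G\<^esub> \<subseteq> K"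
      and tors: "\<forall>x\<in>units_h G D UNIV. \<exists>n::nat. n > 0 \<and>
           deg G D x [^]\<^bsub>G\<^esub> n \<in> deg G D ` units_h G D K"
    unfolding bij_betw_def
  proof
    show "inj_on \<psi> (gval_rings G D UNIV l)"
      by (rule inj_onI, rule valring_eqI_of_torsion[OF K one tors]) (auto simp: gval_rings_iff \<psi>_def)
    \<comment> \<open>Surjectivity is an instance of the first statement, since an algebraic l is in
      general position with every K.\<close>
    show "\<psi> ` gval_rings G D UNIV l = gval_rings G D K k"
      using surj general_position_if_algebraic[OF k alg] by blast
  qed
  ultimately show ?thesis by blast
qed

end
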